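(* Let $1<p,q<\infty$ and consider the complex Banach space $X=\ell_p(\ell_q^n)$. Then $\mathcal{K}(X)$ is the only nontrivial $M$-ideal in $\mathcal{L}(X)$; that is, $\mathcal{K}(X)$ is an $M$-ideal in $\mathcal{L}(X)$, and every $M$-ideal $\mathcal{J}$ in $\mathcal{L}(X)$ with $\{0\}\neq\mathcal{J}\neq\mathcal{L}(X)$ equals $\mathcal{K}(X)$.
   Context: For a Banach space $X$, $\mathcal{L}(X)$ denotes the Banach space of bounded linear operators on $X$ with the operator norm, and $\mathcal{K}(X)$ its subspace of compact operators. For a sequence $(E_n)_{n\ge 1}$ of Banach spaces, $\ell_p(E_n)$ denotes the $\ell_p$-direct sum: the space of all sequences $(x_n)$ with $x_n\in E_n$ and $\|(x_n)\|=(\sum_n\|x_n\|^p)^{1/p}<\infty$. Thus $\ell_p(\ell_q^n)$ is the $\ell_p$-direct sum of the spaces $\ell_q^n$, $n=1,2,\ldots$, where $\ell_q^n$ is $\mathbb{C}^n$ with the $\ell_q$-norm. A closed subspace $J$ of a Banach space $Y$ is called an $M$-ideal in $Y$ if there is a subspace $V\subset Y^*$ such that $Y^*=J^\perp\oplus_1 V$, i.e. $Y^*$ is the direct sum of the annihilator $J^\perp=\{y^*\in Y^*: y^*|_J=0\}$ and $V$, and $\|y^*+v\|=\|y^*\|+\|v\|$ for all $y^*\in J^\perp$, $v\in V$. An $M$-ideal $J$ is nontrivial if $\{0\}\neq J\neq Y$. *)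

theory Defs
  imports "HOL-Analysis.Analysis" "HOL-Library.Function_Algebras"
begin

text \<open>
  The spaces involved depend on real exponents, so a complex normed space is represented as a
  carrier set together with a norm. The vector space operations are those of the ambient type,
  which is always an iterated function space over \<open>complex\<close> with the pointwise operations.
\<close>

class complex_vec = ab_group_add +
  fixes scaleC :: "complex \<Rightarrow> 'a \<Rightarrow> 'a"  (infixr \<open>*\<^sub>C\<close> 75)
  assumes scaleC_add_right: "a *\<^sub>C (x + y) = a *\<^sub>C x + a *\<^sub>C y"
    and scaleC_add_left: "(a + b) *\<^sub>C x = a *\<^sub>C x + b *\<^sub>C x"
    and scaleC_scaleC: "a *\<^sub>C b *\<^sub>C x = (a * b) *\<^sub>C x"
    and scaleC_one: "1 *\<^sub>C x = x"

instantiation complex :: complex_vec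
begin
definition scaleC_complex :: "complex \<Rightarrow> complex \<Rightarrow> complex"
  where "scaleC_complex a x = a * x"
instance
  by standard (simp_all add: scaleC_complex_def algebra_simps)
end

instantiation "fun" :: (type, complex_vec) complex_vec
begin
definition scaleC_fun :: "complex \<Rightarrow> ('a \<Rightarrow> 'b) \<Rightarrow> 'a \<Rightarrow> 'b"
  where "scaleC_fun a f = (\<lambda>x. a *\<^sub>C f x)"
instance
  by standard
    (simp_all add: scaleC_fun_def fun_eq_iff scaleC_add_right scaleC_add_left scaleC_scaleC scaleC_one)
end

global_interpretation complex_vec: vector_space "scaleC :: complex \<Rightarrow> 'a \<Rightarrow> 'a :: complex_vec"
  defines csubspace = complex_vec.subspace
  by standard (simp_all add: scaleC_add_right scaleC_add_left scaleC_scaleC scaleC_one)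

record 'a cnspace =
  carr :: "'a set"
  nrm :: "'a \<Rightarrow> real"

text \<open>
  The guard makes the distance symmetric and nonnegative on the whole ambient type, as
  \<^locale>\<open>Metric_space\<close> demands; the values outside the carrier do not influence the topology.
\<close>

definition ndist :: "'a::complex_vec cnspace \<Rightarrow> 'a \<Rightarrow> 'a \<Rightarrow> real"
  where "ndist A x y = (if x \<in> carr A \<and> y \<in> carr A then nrm A (x - y) else 0)"

definition ntop :: "'a::complex_vec cnspace \<Rightarrow> 'a topology"
  where "ntop A = Metric_space.mtopology (carr A) (ndist A)"

definition scalar_space :: "complex cnspace"
  where "scalar_space = \<lparr>carr = UNIV, nrm = cmod\<rparr>"

text \<open>
  A bounded linear operator on the carrier of \<open>A\<close> is extended by \<open>0\<close> to the ambient type, so that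
  it is represented by exactly one function and the pointwise operations apply.
\<close>

definition bounded_ops :: "'a::complex_vec cnspace \<Rightarrow> 'b::complex_vec cnspace \<Rightarrow> ('a \<Rightarrow> 'b) set"
  where "bounded_ops A B = {T.
    T \<in> carr A \<rightarrow> carr B \<and>
    (\<forall>x\<in>carr A. \<forall>y\<in>carr A. T (x + y) = T x + T y) \<and>
    (\<forall>c. \<forall>x\<in>carr A. T (c *\<^sub>C x) = c *\<^sub>C T x) \<and>
    (\<exists>K. \<forall>x\<in>carr A. nrm B (T x) \<le> K * nrm A x) \<and>
    (\<forall>x. x \<notin> carr A \<longrightarrow> T x = 0)}"

definition op_norm :: "'a::complex_vec cnspace \<Rightarrow> 'b::complex_vec cnspace \<Rightarrow> ('a \<Rightarrow> 'b) \<Rightarrow> real"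
  where "op_norm A B T = (SUP x\<in>{x\<in>carr A. nrm A x \<le> 1}. nrm B (T x))"

definition op_space :: "'a::complex_vec cnspace \<Rightarrow> 'b::complex_vec cnspace \<Rightarrow> ('a \<Rightarrow> 'b) cnspace"
  where "op_space A B = \<lparr>carr = bounded_ops A B, nrm = op_norm A B\<rparr>"

abbreviation endo_space :: "'a::complex_vec cnspace \<Rightarrow> ('a \<Rightarrow> 'a) cnspace"
  where "endo_space A \<equiv> op_space A A"

abbreviation dual_space :: "'a::complex_vec cnspace \<Rightarrow> ('a \<Rightarrow> complex) cnspace"
  where "dual_space A \<equiv> op_space A scalar_space"

definition compact_ops :: "'a::complex_vec cnspace \<Rightarrow> ('a \<Rightarrow> 'a) set"
  where "compact_ops A = {T \<in> bounded_ops A A.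
    compactin (ntop A) (ntop A closure_of (T ` {x\<in>carr A. nrm A x \<le> 1}))}"

definition annihilator :: "'a::complex_vec cnspace \<Rightarrow> 'a set \<Rightarrow> ('a \<Rightarrow> complex) set"
  where "annihilator Y J = {f \<in> carr (dual_space Y). \<forall>x\<in>J. f x = 0}"

text \<open>\<open>l1_direct_sum Z U V\<close> says that \<open>Z = U \<oplus>\<^sub>1 V\<close>.\<close>

definition l1_direct_sum :: "'a::complex_vec cnspace \<Rightarrow> 'a set \<Rightarrow> 'a set \<Rightarrow> bool"
  where "l1_direct_sum Z U V \<longleftrightarrow>
    csubspace U \<and> csubspace V \<and>
    U \<inter> V = {0} \<and> carr Z = {u + v |u v. u \<in> U \<and> v \<in> V} \<and>
    (\<forall>u\<in>U. \<forall>v\<in>V. nrm Z (u + v) = nrm Z u + nrm Z v)"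

definition M_ideal :: "'a::complex_vec cnspace \<Rightarrow> 'a set \<Rightarrow> bool"
  where "M_ideal Y J \<longleftrightarrow>
    J \<subseteq> carr Y \<and> csubspace J \<and> closedin (ntop Y) J \<and>
    (\<exists>V \<subseteq> carr (dual_space Y). l1_direct_sum (dual_space Y) (annihilator Y J) V)"

definition nontrivial_M_ideal :: "'a::complex_vec cnspace \<Rightarrow> 'a set \<Rightarrow> bool"
  where "nontrivial_M_ideal Y J \<longleftrightarrow> M_ideal Y J \<and> J \<noteq> {0} \<and> J \<noteq> carr Y"

definition lp_sum :: "real \<Rightarrow> (nat \<Rightarrow> 'a::complex_vec cnspace) \<Rightarrow> (nat \<Rightarrow> 'a) cnspace"
  where "lp_sum p E = \<lparr>
    carr = {x. (\<forall>n. x n \<in> carr (E n)) \<and> summable (\<lambda>n. nrm (E n) (x n) powr p)},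
    nrm = (\<lambda>x. (\<Sum>n. nrm (E n) (x n) powr p) powr (1 / p))\<rparr>"

text \<open>\<open>\<complex>\<^sup>n\<close> is encoded as the sequences that vanish from index \<open>n\<close> on.\<close>

definition lq_fin :: "real \<Rightarrow> nat \<Rightarrow> (nat \<Rightarrow> complex) cnspace"
  where "lq_fin q n = \<lparr>
    carr = {x. \<forall>i\<ge>n. x i = 0},
    nrm = (\<lambda>x. (\<Sum>i<n. cmod (x i) powr q) powr (1 / q))\<rparr>"

text \<open>The summands are \<open>\<complex>\<^sup>1, \<complex>\<^sup>2, \<dots>\<close>, hence the shift of the index.\<close>

definition lp_lq_sum :: "real \<Rightarrow> real \<Rightarrow> (nat \<Rightarrow> nat \<Rightarrow> complex) cnspace"
  where "lp_lq_sum p q = lp_sum p (\<lambda>n. lq_fin q (Suc n))"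

end

theory Submission
  imports Defs "HOL-Complex_Analysis.Great_Picard"
begin

text \<open>
  Let \<open>P n\<close> be the projections onto the first \<open>n\<close> blocks. For a functional \<open>f\<close> on the operators
  the limit of \<open>f (P n T)\<close> exists for every \<open>T\<close>, and it splits \<open>f\<close> into a part that annihilates the compact
  operators and a part that is determined by its values on them; the norms add because operators
  acting on disjoint groups of blocks can be combined without increasing the norm.

  Conversely, uniform smoothness and uniform convexity of the space make the annihilator of an
  \<open>M\<close>-ideal \<open>J\<close> invariant under multiplication, so that \<open>J\<close> is a two-sided ideal and contains the compact
  operators. If it contains a non-compact operator, a gliding hump yields the projection onto the first
  coordinates of all blocks. For \<open>p = q\<close> the identity factors through this projection. For \<open>p \<noteq> q\<close> the
  two-ball property, applied to the identity of every second block and an operator \<open>\<plusminus>j\<close> in \<open>J\<close> that moves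
  first coordinates between neighbouring blocks, produces a perturbation of this identity by an element
  of \<open>J\<close> whose norm is less than one since \<open>\<ell>\<^sub>p\<close>- and \<open>\<ell>\<^sub>q\<close>-sums of two unit vectors differ; powers
  of it show that the identity lies in \<open>J\<close>.
\<close>

section \<open>Real inequalities\<close>


text \<open>Invariance under multiplication is a first-order estimate: smoothness and convexity
  enter as bounds \<open>2 + \<eta> * t\<close> with \<open>\<eta>\<close> arbitrarily small, while
  a \<open>V\<close>-component of the transported functional would contribute a fixed multiple of
  \<open>t\<close>. Convexity is deduced by duality from smoothness for the conjugate exponents, so
  both rest on one inequality for complex numbers.

  The factorisation of the identity through first coordinates relabels coordinates, which respects
  the norm only for p = q. For p \<noteq> q the M-ideal property is therefore used once more. The
  exponents are told apart by the number 2^(p/q): adding to a vector without first coordinates a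
  copy of its block norms multiplies the p-th power of the norm by 2^(p/q) if the copy sits in the
  first coordinates of the same blocks, and by 2 if it sits in free blocks. Restriction to every
  second block provides the free blocks, the shift between the two positions lies in
  \<open>J\<close>, and the two-ball property compares the two sums up to a factor as close to 1 as
  desired.\<close>

lemma convex_powr_nonneg:
  fixes a b s u :: real
  assumes "s \<ge> 1" "0 \<le> a" "0 \<le> b" "0 \<le> u" "u \<le> 1"
  shows "(u * a + (1 - u) * b) powr s \<le> u * a powr s + (1 - u) * b powr s"
proof -
  \<comment> \<open>Convexity is applied on the open half line only. If one of the points is zero,
    the claim reduces to this bound for the weight of the other.\<close>
  have contr: "v powr s \<le> v" if "0 \<le> v" "v \<le> 1" for v :: real
    using that assms(1) powr_mono'[of 1 s v] by (cases "v = 0") auto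
  consider "a = 0" | "b = 0" | "a > 0" "b > 0" using assms by force
  then show ?thesis
  proof cases
    case 1
    then show ?thesis
      using contr[of "1 - u"] assms by (simp add: powr_mult mult_right_mono)
  next
    case 2
    then show ?thesis
      using contr[of u] assms by (simp add: powr_mult mult_right_mono)
  next
    case 3
    have c: "convex_on {0<..} (\<lambda>x::real. x powr s)" by (rule powr_convex[OF assms(1)])
    show ?thesis
      using convex_onD[OF c, of u b a] 3 assms by (simp add: algebra_simps)
  qed
qed

text \<open>After division by \<open>u + v\<close> both bases lie in the unit interval, where a
  power with exponent at least one does not exceed its base.\<close>

lemma powr_superadd:
  fixes u v k :: real
  assumes "k \<ge> 1" "0 \<le> u" "0 \<le> v"
  shows "u powr k + v powr k \<le> (u + v) powr k"
proof (cases "u + v = 0")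
  case True
  then show ?thesis using assms by (simp add: add_nonneg_eq_0_iff)
next
  case False
  then have p: "u + v > 0" using assms by simp
  have contr: "w powr k \<le> w" if "0 \<le> w" "w \<le> 1" for w :: real
    using that assms(1) powr_mono'[of 1 k w] by (cases "w = 0") auto
  have "(u / (u+v)) powr k + (v / (u+v)) powr k \<le> u / (u+v) + v / (u+v)"
    using p assms by (intro add_mono contr) auto
  also have "\<dots> = 1" using p by (simp flip: add_divide_distrib)
  finally show ?thesis
    using p assms by (simp add: powr_divide field_simps)
qed

text \<open>The outer root is left off on the left, because later estimates compare s-th powers of
  partial sums. An infinite index set is harmless: the sum over it is zero.\<close>

lemma minkowski_sum:
  fixes a b :: "'i \<Rightarrow> real"
  assumes s: "s \<ge> 1" and a: "\<And>i. i \<in> I \<Longrightarrow> 0 \<le> a i" and b: "\<And>i. i \<in> I \<Longrightarrow> 0 \<le> b i"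
  shows "(\<Sum>i\<in>I. (a i + b i) powr s)
    \<le> ((\<Sum>i\<in>I. a i powr s) powr (1/s) + (\<Sum>i\<in>I. b i powr s) powr (1/s)) powr s"
proof (cases "finite I")
  case False
  then show ?thesis by simp
next
  case fin: True
  define A where "A = (\<Sum>i\<in>I. a i powr s) powr (1/s)"
  define B where "B = (\<Sum>i\<in>I. b i powr s) powr (1/s)"
  have A0: "A \<ge> 0" "B \<ge> 0" by (auto simp: A_def B_def)
  have As: "A powr s = (\<Sum>i\<in>I. a i powr s)" "B powr s = (\<Sum>i\<in>I. b i powr s)"
    using s by (auto simp: A_def B_def powr_powr sum_nonneg)
  show ?thesis
  proof (cases "A = 0 \<or> B = 0")
    case True
    then show ?thesis
    proof
      assume "A = 0"
      then have "(\<Sum>i\<in>I. a i powr s) = 0" using As by simp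
      then have "\<And>i. i \<in> I \<Longrightarrow> a i = 0"
        using fin by (subst (asm) sum_nonneg_eq_0_iff) auto
      then show ?thesis using As \<open>A = 0\<close> A0 by (simp flip: A_def B_def)
    next
      assume "B = 0"
      then have "(\<Sum>i\<in>I. b i powr s) = 0" using As by simp
      then have "\<And>i. i \<in> I \<Longrightarrow> b i = 0"
        using fin by (subst (asm) sum_nonneg_eq_0_iff) auto
      then show ?thesis using As \<open>B = 0\<close> A0 by (simp flip: A_def B_def)
    qed
  next
    case False
    then have P: "A > 0" "B > 0" using A0 by auto
    \<comment> \<open>With this weight \<open>a i + b i\<close> is \<open>A + B\<close> times a
      convex combination of the normalised terms \<open>a i / A\<close> and \<open>b i / B\<close>,
      so convexity of the power applies termwise.\<close>
    define u where "u = A / (A + B)"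
    have u: "0 \<le> u" "u \<le> 1" "1 - u = B / (A + B)" using P by (auto simp: u_def field_simps)
    have "(a i + b i) powr s \<le> (A+B) powr s * (u * (a i powr s / A powr s) + (1-u) * (b i powr s / B powr s))"
      if i: "i \<in> I" for i
    proof -
      have "a i + b i = (A+B) * (u * (a i / A) + (1-u) * (b i / B))"
      proof -
        have "(A+B) * u = A" "(A+B) * (1-u) = B" using P u(3) by (auto simp: u_def)
        then have "(A+B) * (u * (a i / A)) = a i" "(A+B) * ((1-u) * (b i / B)) = b i"
          using P by (simp_all flip: mult.assoc)
        then show ?thesis by (simp only: distrib_left)
      qed
      then have "(a i + b i) powr s = (A+B) powr s * (u * (a i / A) + (1-u) * (b i / B)) powr s"
        using P u a[OF i] b[OF i] by (simp add: powr_mult)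
      also have "\<dots> \<le> (A+B) powr s * (u * (a i / A) powr s + (1-u) * (b i / B) powr s)"
        using P u a[OF i] b[OF i] s by (intro mult_left_mono convex_powr_nonneg) auto
      finally show ?thesis using P a[OF i] b[OF i] by (simp add: powr_divide)
    qed
    then have "(\<Sum>i\<in>I. (a i + b i) powr s)
      \<le> (\<Sum>i\<in>I. (A+B) powr s * (u * (a i powr s / A powr s) + (1-u) * (b i powr s / B powr s)))"
      by (rule sum_mono)
    also have "\<dots> = (A+B) powr s * (u * ((\<Sum>i\<in>I. a i powr s) / A powr s) + (1-u) * ((\<Sum>i\<in>I. b i powr s) / B powr s))"
      by (simp add: sum_distrib_left sum.distrib sum_divide_distrib distrib_left)
    also have "\<dots> = (A+B) powr s"
      using P by (simp flip: As)
    finally show ?thesis by (simp add: A_def B_def)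
  qed
qed

text \<open>Young's inequality for each pair of normalised terms; the two resulting sums add up to
  1/p + 1/q = 1.\<close>

lemma holder_sum:
  fixes a b :: "'i \<Rightarrow> real"
  assumes pq: "p > 1" "q > 1" "1/p + 1/q = 1"
    and a: "\<And>i. i \<in> I \<Longrightarrow> 0 \<le> a i" and b: "\<And>i. i \<in> I \<Longrightarrow> 0 \<le> b i"
  shows "(\<Sum>i\<in>I. a i * b i) \<le> (\<Sum>i\<in>I. a i powr p) powr (1/p) * (\<Sum>i\<in>I. b i powr q) powr (1/q)"
proof (cases "finite I")
  case False
  then show ?thesis by simp
next
  case fin: True
  define A where "A = (\<Sum>i\<in>I. a i powr p) powr (1/p)"
  define B where "B = (\<Sum>i\<in>I. b i powr q) powr (1/q)"
  have A0: "A \<ge> 0" "B \<ge> 0" by (auto simp: A_def B_def)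
  have As: "A powr p = (\<Sum>i\<in>I. a i powr p)" "B powr q = (\<Sum>i\<in>I. b i powr q)"
    using pq by (auto simp: A_def B_def powr_powr sum_nonneg)
  show ?thesis
  proof (cases "A = 0 \<or> B = 0")
    case True
    then have "a i * b i = 0" if "i \<in> I" for i
    proof
      assume "A = 0"
      then have "(\<Sum>i\<in>I. a i powr p) = 0" using As by simp
      then show ?thesis
        using fin that by (subst (asm) sum_nonneg_eq_0_iff) auto
    next
      assume "B = 0"
      then have "(\<Sum>i\<in>I. b i powr q) = 0" using As by simp
      then show ?thesis
        using fin that by (subst (asm) sum_nonneg_eq_0_iff) auto
    qed
    then have "(\<Sum>i\<in>I. a i * b i) = 0" by (intro sum.neutral) blast
    then show ?thesis by simp
  next
    case False
    then have P: "A > 0" "B > 0" using A0 by auto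
    have "a i * b i \<le> A * B * (a i powr p / A powr p / p + b i powr q / B powr q / q)" if i: "i \<in> I" for i
    proof -
      have "(a i / A) * (b i / B) \<le> (a i / A) powr p / p + (b i / B) powr q / q"
        using P a[OF i] b[OF i] pq by (intro Youngs_inequality) auto
      then show ?thesis using P a[OF i] b[OF i] by (simp add: powr_divide field_simps)
    qed
    then have "(\<Sum>i\<in>I. a i * b i) \<le> (\<Sum>i\<in>I. A * B * (a i powr p / A powr p / p + b i powr q / B powr q / q))"
      by (rule sum_mono)
    also have "\<dots> = A * B * ((\<Sum>i\<in>I. a i powr p) / A powr p / p + (\<Sum>i\<in>I. b i powr q) / B powr q / q)"
      by (simp add: sum_distrib_left sum.distrib sum_divide_distrib distrib_left)
    also have "\<dots> = A * B"
      using P pq by (simp flip: As)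
    finally show ?thesis by (simp add: A_def B_def)
  qed
qed

text \<open>Convexity of the power with exponent t/s. It serves to trade the averaging exponent of a
  two-point smoothness estimate for another one.\<close>

lemma power_mean_two:
  fixes a b s t :: real
  assumes "0 < s" "s \<le> t" "0 \<le> a" "0 \<le> b"
  shows "((a powr s + b powr s) / 2) powr (1/s) \<le> ((a powr t + b powr t) / 2) powr (1/t)"
proof -
  have "((a powr s + b powr s) / 2) powr (t/s) \<le> (a powr t + b powr t) / 2"
    using convex_powr_nonneg[of "t/s" "a powr s" "b powr s" "1/2"] assms
    by (simp add: powr_powr add_divide_distrib)
  then have "(((a powr s + b powr s) / 2) powr (t/s)) powr (1/t) \<le> ((a powr t + b powr t) / 2) powr (1/t)"
    using assms by (intro powr_mono2) auto
  then show ?thesis using assms by (simp add: powr_powr)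
qed

text \<open>An upper bound of Taylor type with exact linear term. On the interval the factor
  \<open>1 + x\<close> lies between 0 and 4, so the induction may multiply by it and the quadratic
  constant grows in a controlled way.\<close>

lemma bernoulli_quadratic:
  "\<exists>K\<ge>0. \<forall>x\<in>{-1..3::real}. (1 + x) ^ m \<le> 1 + real m * x + K * x\<^sup>2"
proof (induction m)
  case 0
  then show ?case by (intro exI[of _ 0]) auto
next
  case (Suc m)
  then obtain K where K: "K \<ge> 0" "\<And>x. x \<in> {-1..3::real} \<Longrightarrow> (1 + x) ^ m \<le> 1 + real m * x + K * x\<^sup>2"
    by auto
  have "(1 + x) ^ Suc m \<le> 1 + real (Suc m) * x + (real m + 4 * K) * x\<^sup>2" if x: "x \<in> {-1..3}" for x :: real
  proof -
    have "(1 + x) ^ Suc m \<le> (1 + x) * (1 + real m * x + K * x\<^sup>2)"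
      using K(2)[OF x] x by (auto intro!: mult_left_mono)
    also have "\<dots> = 1 + real (Suc m) * x + (real m + K * (1 + x)) * x\<^sup>2"
      by (simp add: algebra_simps power2_eq_square)
    also have "\<dots> \<le> 1 + real (Suc m) * x + (real m + K * 4) * x\<^sup>2"
      using x K(1) by (intro add_left_mono mult_right_mono mult_left_mono) auto
    finally show ?thesis by (simp add: algebra_simps)
  qed
  then show ?case using K(1) by (intro exI[of _ "real m + 4 * K"]) auto
qed

text \<open>The squared moduli of a + b and a - b are |a|^2 times 1 + \<beta> + \<gamma> and 1 +
  \<beta> - \<gamma>, where \<gamma>^2 is at most 4\<beta>. Averaging cancels the terms linear in
  \<gamma>, the rest is of order \<beta> and is absorbed by Bernoulli's inequality. Even exponents
  make these natural powers of squared moduli.\<close>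

lemma complex_two_smooth_even:
  assumes m: "m \<ge> 1"
  shows "\<exists>C\<ge>0. \<forall>a b::complex. (cmod (a + b) ^ (2*m) + cmod (a - b) ^ (2*m)) / 2 \<le> ((cmod a)\<^sup>2 + C * (cmod b)\<^sup>2) ^ m"
proof -
  obtain K where K: "K \<ge> 0" "\<And>x. x \<in> {-1..3::real} \<Longrightarrow> (1 + x) ^ m \<le> 1 + real m * x + K * x\<^sup>2"
    using bernoulli_quadratic[of m] by auto
  \<comment> \<open>The 4 settles the case of b dominating a, where both moduli are at most 2|b|;
    the \<open>5 * K\<close> comes from \<beta>^2 + \<gamma>^2 \<le> 5\<beta>.\<close>
  define C where "C = 4 + 5 * K"
  have "(cmod (a + b) ^ (2*m) + cmod (a - b) ^ (2*m)) / 2 \<le> ((cmod a)\<^sup>2 + C * (cmod b)\<^sup>2) ^ m" for a b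
  proof (cases "cmod b \<le> cmod a \<and> a \<noteq> 0")
    case True
    define A where "A = (cmod a)\<^sup>2"
    define \<beta> where "\<beta> = (cmod b)\<^sup>2 / A"
    define \<gamma> where "\<gamma> = 2 * (a \<bullet> b) / A"
    have A: "A > 0" using True by (simp add: A_def)
    have bA: "(cmod b)\<^sup>2 = A * \<beta>" using A by (simp add: \<beta>_def)
    have \<beta>: "0 \<le> \<beta>" "\<beta> \<le> 1"
      using True A by (auto simp: \<beta>_def A_def intro!: divide_le_eq_1_pos[THEN iffD2] power_mono)
    have "\<bar>a \<bullet> b\<bar> \<le> cmod a * cmod b" by (rule Cauchy_Schwarz_ineq2)
    then have "(a \<bullet> b)\<^sup>2 \<le> (cmod a * cmod b)\<^sup>2"
      using abs_le_square_iff by (metis abs_mult abs_norm_cancel)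
    then have g: "\<gamma>\<^sup>2 \<le> 4 * \<beta>"
      using A by (simp add: \<gamma>_def \<beta>_def power_divide power_mult_distrib A_def power2_eq_square field_simps)
    have plus: "(cmod (a + b))\<^sup>2 = A * (1 + (\<beta> + \<gamma>))" "(cmod (a - b))\<^sup>2 = A * (1 + (\<beta> - \<gamma>))"
      using A unfolding power2_norm_eq_inner
      by (auto simp: inner_add inner_diff inner_commute \<beta>_def \<gamma>_def A_def power2_norm_eq_inner field_simps)
    have g2: "\<bar>\<gamma>\<bar> \<le> 2"
    proof (rule power2_le_imp_le)
      show "\<bar>\<gamma>\<bar>\<^sup>2 \<le> 2\<^sup>2" using g \<beta> by simp
    qed simp
    have "0 \<le> A * (1 + (\<beta> + \<gamma>))" "0 \<le> A * (1 + (\<beta> - \<gamma>))"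
      by (simp_all flip: plus)
    then have r: "\<beta> + \<gamma> \<in> {-1..3}" "\<beta> - \<gamma> \<in> {-1..3}"
      using A g2 \<beta> by (auto simp: zero_le_mult_iff)
    have "(1 + (\<beta> + \<gamma>)) ^ m + (1 + (\<beta> - \<gamma>)) ^ m
      \<le> (1 + real m * (\<beta> + \<gamma>) + K * (\<beta> + \<gamma>)\<^sup>2) + (1 + real m * (\<beta> - \<gamma>) + K * (\<beta> - \<gamma>)\<^sup>2)"
      using K(2) r by (intro add_mono) auto
    also have "\<dots> = 2 * (1 + real m * \<beta> + K * (\<beta>\<^sup>2 + \<gamma>\<^sup>2))"
      by (simp add: algebra_simps power2_eq_square)
    also have "\<dots> \<le> 2 * (1 + real m * \<beta> + K * (5 * \<beta>))"
    proof -
      have "\<beta>\<^sup>2 \<le> \<beta>" using \<beta> by (simp add: power2_eq_square mult_left_le)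
      then show ?thesis using g K(1) by (intro mult_left_mono add_left_mono) auto
    qed
    also have "\<dots> \<le> 2 * (1 + real m * (C * \<beta>))"
    proof -
      have "1 * (K * \<beta>) \<le> real m * (K * \<beta>)" using m K \<beta> by (intro mult_right_mono) auto
      moreover have "0 \<le> real m * \<beta>" using \<beta> by simp
      ultimately show ?thesis unfolding C_def by (simp add: algebra_simps)
    qed
    also have "1 + real m * (C * \<beta>) \<le> (1 + C * \<beta>) ^ m"
      using \<beta> K by (intro Bernoulli_inequality) (auto simp: C_def intro: order_trans[of _ 0])
    finally have *: "((1 + (\<beta> + \<gamma>)) ^ m + (1 + (\<beta> - \<gamma>)) ^ m) / 2 \<le> (1 + C * \<beta>) ^ m"
      by simp
    have "(cmod (a + b) ^ (2*m) + cmod (a - b) ^ (2*m)) / 2 = A ^ m * (((1 + (\<beta> + \<gamma>)) ^ m + (1 + (\<beta> - \<gamma>)) ^ m) / 2)"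
      unfolding power_mult plus power_mult_distrib by (simp only: distrib_left[symmetric] times_divide_eq_right)
    also have "\<dots> \<le> A ^ m * (1 + C * \<beta>) ^ m"
      using * A by (intro mult_left_mono) auto
    also have "\<dots> = ((cmod a)\<^sup>2 + C * (cmod b)\<^sup>2) ^ m"
      unfolding bA by (simp add: power_mult_distrib[symmetric] algebra_simps A_def)
    finally show ?thesis .
  next
    case False
    then have ab: "cmod a \<le> cmod b" by auto
    have n: "cmod z ^ (2*m) \<le> ((cmod a)\<^sup>2 + C * (cmod b)\<^sup>2) ^ m" if "cmod z \<le> 2 * cmod b" for z
    proof -
      have "(cmod z)\<^sup>2 \<le> (2 * cmod b)\<^sup>2" using that by (intro power_mono) auto
      also have "\<dots> \<le> (cmod a)\<^sup>2 + C * (cmod b)\<^sup>2"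
        using K(1) by (simp add: C_def power_mult_distrib algebra_simps)
      finally show ?thesis by (simp add: power_mult power_mono)
    qed
    have "cmod (a + b) \<le> 2 * cmod b" "cmod (a - b) \<le> 2 * cmod b"
      using ab norm_triangle_ineq[of a b] norm_triangle_ineq4[of a b] by auto
    from n[OF this(1)] n[OF this(2)] show ?thesis by simp
  qed
  then show ?thesis using K(1) by (intro exI[of _ C]) (auto simp: C_def)
qed

text \<open>Power means lead from s up to an even exponent, where the quadratic estimate holds.
  Superadditivity of the power with exponent 2/r then replaces the squares by r-th powers, at the
  price of the constant \<open>C powr (r/2)\<close>.\<close>

lemma complex_smooth:
  fixes s r :: real
  assumes s: "s > 1" and r: "1 < r" "r \<le> 2"
  shows "\<exists>C\<ge>0. \<forall>a b::complex. (cmod (a + b) powr s + cmod (a - b) powr s) / 2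
           \<le> (cmod a powr r + C * cmod b powr r) powr (s/r)"
proof -
  obtain m :: nat where m: "m \<ge> 1" "s \<le> 2 * real m"
  proof -
    obtain k :: nat where "s < real k" using reals_Archimedean2 by blast
    then show ?thesis using that[of "Suc k"] by auto
  qed
  obtain C where C: "C \<ge> 0"
    "\<And>a b::complex. (cmod (a + b) ^ (2*m) + cmod (a - b) ^ (2*m)) / 2 \<le> ((cmod a)\<^sup>2 + C * (cmod b)\<^sup>2) ^ m"
    using complex_two_smooth_even[OF m(1)] by auto
  define t where "t = 2 * real m"
  have t: "t > 0" "s \<le> t" using m by (auto simp: t_def)
  have sq: "x ^ (2*m) = x powr t" if "x \<ge> 0" for x :: real
    using that m by (cases "x = 0") (simp_all add: t_def flip: powr_realpow)
  have "(cmod (a + b) powr s + cmod (a - b) powr s) / 2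
           \<le> (cmod a powr r + C powr (r/2) * cmod b powr r) powr (s/r)" for a b
  proof -
    define X where "X = (cmod a)\<^sup>2 + C * (cmod b)\<^sup>2"
    have X0: "X \<ge> 0" using C(1) by (simp add: X_def)
    have Xm: "X ^ m = X powr (t/2)"
      using X0 m by (cases "X = 0") (simp_all add: t_def powr_realpow)
    have "((cmod (a + b) powr s + cmod (a - b) powr s) / 2) powr (1/s)
      \<le> ((cmod (a + b) powr t + cmod (a - b) powr t) / 2) powr (1/t)"
      using s t by (intro power_mean_two) auto
    also have "\<dots> \<le> (X powr (t/2)) powr (1/t)"
      using C(2)[of a b] t by (intro powr_mono2) (auto simp: sq Xm simp flip: X_def)
    also have "\<dots> = X powr (1/2)" using t by (simp add: powr_powr)
    finally have "(((cmod (a + b) powr s + cmod (a - b) powr s) / 2) powr (1/s)) powr s \<le> (X powr (1/2)) powr s"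
      using s by (intro powr_mono2) auto
    then have 1: "(cmod (a + b) powr s + cmod (a - b) powr s) / 2 \<le> X powr (s/2)"
      using s by (simp add: powr_powr)
    have "X = (cmod a powr r) powr (2/r) + (C powr (r/2) * cmod b powr r) powr (2/r)"
      using r C(1) by (simp add: X_def powr_powr powr_mult)
    also have "\<dots> \<le> (cmod a powr r + C powr (r/2) * cmod b powr r) powr (2/r)"
      using r by (intro powr_superadd) auto
    finally have "X powr (s/2) \<le> ((cmod a powr r + C powr (r/2) * cmod b powr r) powr (2/r)) powr (s/2)"
      using s X0 by (intro powr_mono2) auto
    also have "\<dots> = (cmod a powr r + C powr (r/2) * cmod b powr r) powr (s/r)"
      by (simp add: powr_powr)
    finally show ?thesis using 1 by simp
  qed
  then show ?thesis by (intro exI[of _ "C powr (r/2)"]) auto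
qed

text \<open>Only numbers occur: \<open>u\<close> and \<open>v\<close> stand for the norms of x + y
  and x - y. Their half sum is bounded through the estimate for s, their half difference by
  \<open>y\<close>, and the scalar inequality for t is applied to these two reals. This links the
  inner exponent of the space to the outer one with the same r.\<close>

lemma smooth_exponent_change:
  fixes s t r C D :: real
  assumes st: "s > 1" "t > 1" "r > 1" and C: "C \<ge> 0"
    and D: "D \<ge> 0" "\<And>a b::complex. (cmod (a + b) powr t + cmod (a - b) powr t) / 2
           \<le> (cmod a powr r + D * cmod b powr r) powr (t/r)"
    and nn: "u \<ge> 0" "v \<ge> 0" "x \<ge> 0" "y \<ge> 0"
    and uv: "\<bar>u - v\<bar> \<le> 2 * y"
    and le: "(u powr s + v powr s) / 2 \<le> (x powr r + C * y powr r) powr (s/r)"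
  shows "(u powr t + v powr t) / 2 \<le> (x powr r + (C + D) * y powr r) powr (t/r)"
proof -
  define a where "a = (u + v) / 2"
  define b where "b = (u - v) / 2"
  have a0: "a \<ge> 0" and b: "\<bar>b\<bar> \<le> y" using nn uv by (auto simp: a_def b_def)
  have "a \<le> ((u powr s + v powr s) / 2) powr (1/s)"
    using power_mean_two[of 1 s u v] st nn by (simp add: a_def)
  also have "\<dots> \<le> ((x powr r + C * y powr r) powr (s/r)) powr (1/s)"
    using le st by (intro powr_mono2) auto
  also have "\<dots> = (x powr r + C * y powr r) powr (1/r)" using st by (simp add: powr_powr)
  finally have "a powr r \<le> ((x powr r + C * y powr r) powr (1/r)) powr r"
    using st a0 by (intro powr_mono2) auto
  then have ar: "a powr r \<le> x powr r + C * y powr r" using st C by (simp add: powr_powr)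
  have br: "D * \<bar>b\<bar> powr r \<le> D * y powr r"
    using b st D(1) by (intro mult_left_mono powr_mono2) auto
  have "(u powr t + v powr t) / 2 = (cmod (complex_of_real a + complex_of_real b) powr t + cmod (complex_of_real a - complex_of_real b) powr t) / 2"
  proof -
    have "a + b = u" "a - b = v" by (auto simp: a_def b_def field_simps)
    then show ?thesis using nn by (simp flip: of_real_add of_real_diff)
  qed
  also have "\<dots> \<le> (a powr r + D * \<bar>b\<bar> powr r) powr (t/r)"
    using D(2)[of "complex_of_real a" "complex_of_real b"] a0 by simp
  also have "\<dots> \<le> (x powr r + (C + D) * y powr r) powr (t/r)"
    using ar br st D(1) by (intro powr_mono2) (auto simp: algebra_simps)
  finally show ?thesis .
qed

text \<open>Minkowski's inequality with exponent s/r for the families of r-th powers, which is the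
  reason for \<open>r \<le> s\<close>.\<close>

lemma smooth_sum:
  fixes \<alpha> \<beta> u :: "'i \<Rightarrow> real"
  assumes r: "0 < r" "r \<le> s" and C: "C \<ge> 0"
    and nn: "\<And>i. i \<in> I \<Longrightarrow> 0 \<le> \<alpha> i" "\<And>i. i \<in> I \<Longrightarrow> 0 \<le> \<beta> i"
    and le: "\<And>i. i \<in> I \<Longrightarrow> u i \<le> (\<alpha> i powr r + C * \<beta> i powr r) powr (s/r)"
  shows "(\<Sum>i\<in>I. u i) \<le> (((\<Sum>i\<in>I. \<alpha> i powr s) powr (1/s)) powr r
           + C * ((\<Sum>i\<in>I. \<beta> i powr s) powr (1/s)) powr r) powr (s/r)"
proof -
  have "(\<Sum>i\<in>I. u i) \<le> (\<Sum>i\<in>I. (\<alpha> i powr r + C * \<beta> i powr r) powr (s/r))"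
    by (rule sum_mono) (rule le)
  also have "\<dots> \<le> ((\<Sum>i\<in>I. (\<alpha> i powr r) powr (s/r)) powr (1/(s/r)) + (\<Sum>i\<in>I. (C * \<beta> i powr r) powr (s/r)) powr (1/(s/r))) powr (s/r)"
    using r C by (intro minkowski_sum) auto
  also have "(\<Sum>i\<in>I. (\<alpha> i powr r) powr (s/r)) = (\<Sum>i\<in>I. \<alpha> i powr s)"
    using r by (simp add: powr_powr)
  also have "(\<Sum>i\<in>I. (C * \<beta> i powr r) powr (s/r)) = C powr (s/r) * (\<Sum>i\<in>I. \<beta> i powr s)"
    using r C by (simp add: powr_mult powr_powr sum_distrib_left)
  also have "(C powr (s/r) * (\<Sum>i\<in>I. \<beta> i powr s)) powr (1/(s/r)) = C * ((\<Sum>i\<in>I. \<beta> i powr s) powr (1/s)) powr r"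
    using r C by (simp add: powr_mult powr_powr sum_nonneg)
  also have "(\<Sum>i\<in>I. \<alpha> i powr s) powr (1/(s/r)) = ((\<Sum>i\<in>I. \<alpha> i powr s) powr (1/s)) powr r"
    using r by (simp add: powr_powr)
  finally show ?thesis .
qed

section \<open>The Hahn-Banach theorem\<close>


text \<open>Homogeneity is real, as the complex structure is restored only at the end. The value 0
  off \<open>C\<close> determines the function everywhere, so that minimality can be expressed by
  equality of functions.\<close>

definition sublin :: "'a::complex_vec set \<Rightarrow> ('a \<Rightarrow> real) \<Rightarrow> bool"
  where "sublin C q \<longleftrightarrow> (\<forall>x\<in>C. \<forall>y\<in>C. q (x + y) \<le> q x + q y) \<and>
    (\<forall>x\<in>C. \<forall>r>0. q (complex_of_real r *\<^sub>C x) = r * q x) \<and> (\<forall>x. x \<notin> C \<longrightarrow> q x = 0)"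

lemma sublin_zero: "csubspace C \<Longrightarrow> sublin C q \<Longrightarrow> q 0 = 0"
  using complex_vec.subspace_0[of C]
  unfolding sublin_def by (metis complex_vec.scale_zero_right mult_cancel_right2 zero_less_numeral one_eq_numeral_iff semiring_norm(83))

lemma sublin_neg_bound:
  assumes "csubspace C" "sublin C q" "x \<in> C"
  shows "0 \<le> q x + q (- x)"
  using assms complex_vec.subspace_neg[of C x] sublin_zero[of C q]
  unfolding sublin_def by (metis add.right_inverse)

text \<open>Lowering a sublinear functional along a convex cone of pairs \<open>(y, c)\<close> with \<open>c \<le> q y\<close>
  forces \<open>c\<close> to become a lower bound at \<open>y\<close>.\<close>

lemma sublin_lower_along_cone:
  fixes C :: "'a::complex_vec set"
  assumes C: "csubspace C" and q: "sublin C q" and M: "M \<subseteq> C \<times> UNIV"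
    and M0: "(0, 0) \<in> M"
    and Madd: "\<And>y c y' c'. (y, c) \<in> M \<Longrightarrow> (y', c') \<in> M \<Longrightarrow> (y + y', c + c') \<in> M"
    and Mscale: "\<And>y c r. (y, c) \<in> M \<Longrightarrow> r > 0 \<Longrightarrow> (complex_of_real r *\<^sub>C y, r * c) \<in> M"
    and Mle: "\<And>y c. (y, c) \<in> M \<Longrightarrow> c \<le> q y"
  obtains q' where "sublin C q'" "\<And>x. x \<in> C \<Longrightarrow> q' x \<le> q x" "\<And>y c. (y, c) \<in> M \<Longrightarrow> q' (- y) \<le> - c"
proof -
  \<comment> \<open>The member (0, 0) of the cone gives \<open>q' \<le> q\<close>, and the
    hypothesis \<open>c \<le> q y\<close> keeps the infimum finite.\<close>
  define q' where "q' x = (if x \<in> C then (INF m\<in>M. q (x + fst m) - snd m) else 0)" for x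
  have qadd: "q (x + y) \<le> q x + q y" if "x \<in> C" "y \<in> C" for x y
    using q that by (auto simp: sublin_def)
  have qscale: "q (complex_of_real r *\<^sub>C x) = r * q x" if "x \<in> C" "r > 0" for x r
    using q that by (auto simp: sublin_def)
  have MC: "fst m \<in> C" if "m \<in> M" for m using M that by auto
  have low: "- q (- x) \<le> q (x + fst m) - snd m" if x: "x \<in> C" and m: "m \<in> M" for x m
  proof -
    have "snd m \<le> q (fst m)" using Mle[of "fst m" "snd m"] m by simp
    also have "\<dots> = q ((x + fst m) + (- x))" by simp
    also have "\<dots> \<le> q (x + fst m) + q (- x)"
      using x MC[OF m] C by (intro qadd complex_vec.subspace_add complex_vec.subspace_neg)
    finally show ?thesis by simp
  qed
  have bdd: "bdd_below ((\<lambda>m. q (x + fst m) - snd m) ` M)" if "x \<in> C" for x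
    using low[OF that] by (intro bdd_belowI2)
  have upper: "q' x \<le> q (x + fst m) - snd m" if "x \<in> C" "m \<in> M" for x m
    using that cINF_lower[OF bdd[OF that(1)] that(2)] by (simp add: q'_def)
  have greatest: "b \<le> q' x" if "x \<in> C" "\<And>m. m \<in> M \<Longrightarrow> b \<le> q (x + fst m) - snd m" for x b
    using that M0 by (auto simp: q'_def intro!: cINF_greatest)
  have add: "q' (x + y) \<le> q' x + q' y" if x: "x \<in> C" and y: "y \<in> C" for x y
  proof -
    have *: "q' (x + y) \<le> (q (x + fst m) - snd m) + (q (y + fst n) - snd n)" if m: "m \<in> M" and n: "n \<in> M" for m n
    proof -
      have "q' (x + y) \<le> q ((x + y) + (fst m + fst n)) - (snd m + snd n)"
        using upper[of "x + y" "(fst m + fst n, snd m + snd n)"] Madd[of "fst m" "snd m" "fst n" "snd n"]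
          m n complex_vec.subspace_add[OF C x y] by simp
      also have "(x + y) + (fst m + fst n) = (x + fst m) + (y + fst n)" by (simp add: ac_simps)
      also have "q \<dots> \<le> q (x + fst m) + q (y + fst n)"
        using x y MC m n C by (intro qadd complex_vec.subspace_add)
      finally show ?thesis by simp
    qed
    have "q' (x + y) - (q (x + fst m) - snd m) \<le> q' y" if "m \<in> M" for m
      using *[OF that] by (intro greatest[OF y]) (simp add: algebra_simps)
    then have "q' (x + y) - q' y \<le> q' x"
      by (intro greatest[OF x]) (simp add: algebra_simps)
    then show ?thesis by simp
  qed
  have scale_le: "q' (complex_of_real r *\<^sub>C x) \<le> r * q' x" if x: "x \<in> C" and r: "r > 0" for x r
  proof -
    have "q' (complex_of_real r *\<^sub>C x) / r \<le> q' x"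
    proof (rule greatest[OF x])
      fix m assume m: "m \<in> M"
      have "q' (complex_of_real r *\<^sub>C x) \<le> q (complex_of_real r *\<^sub>C x + complex_of_real r *\<^sub>C fst m) - r * snd m"
        using upper[of "complex_of_real r *\<^sub>C x" "(complex_of_real r *\<^sub>C fst m, r * snd m)"]
          Mscale[of "fst m" "snd m" r] m r complex_vec.subspace_scale[OF C x] by simp
      also have "\<dots> = r * (q (x + fst m) - snd m)"
        using qscale[of "x + fst m" r] r x MC[OF m] C
        by (simp add: scaleC_add_right complex_vec.subspace_add algebra_simps)
      finally show "q' (complex_of_real r *\<^sub>C x) / r \<le> q (x + fst m) - snd m"
        using r by (simp add: field_simps)
    qed
    then show ?thesis using r by (simp add: field_simps)
  qed
  have scale: "q' (complex_of_real r *\<^sub>C x) = r * q' x" if x: "x \<in> C" and r: "r > 0" for x r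
  proof (rule antisym[OF scale_le[OF x r]])
    have "q' (complex_of_real (1/r) *\<^sub>C (complex_of_real r *\<^sub>C x)) \<le> (1/r) * q' (complex_of_real r *\<^sub>C x)"
      using x r C by (intro scale_le complex_vec.subspace_scale) auto
    moreover have "complex_of_real (1/r) *\<^sub>C (complex_of_real r *\<^sub>C x) = x"
      using r by (simp add: scaleC_scaleC scaleC_one flip: of_real_mult)
    ultimately show "r * q' x \<le> q' (complex_of_real r *\<^sub>C x)"
      using r by (simp add: field_simps)
  qed
  show ?thesis
  proof
    show "sublin C q'" using add scale by (auto simp: sublin_def q'_def)
    show "q' x \<le> q x" if "x \<in> C" for x using upper[OF that M0] by simp
    show "q' (- y) \<le> - c" if "(y, c) \<in> M" for y c
      using upper[of "- y" "(y, c)"] that MC[OF that] C sublin_zero[OF C q]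
      by (simp add: complex_vec.subspace_neg)
  qed
qed

text \<open>Lowering \<open>q\<close> along the ray through y, with bound \<open>q y\<close> at y
  itself, must leave a minimal \<open>q\<close> unchanged. Hence \<open>q\<close> is odd, and an odd
  sublinear functional is additive.\<close>

lemma minimal_sublin_additive:
  fixes C :: "'a::complex_vec set"
  assumes C: "csubspace C" and q: "sublin C q"
    and min: "\<And>q'. sublin C q' \<Longrightarrow> (\<And>x. x \<in> C \<Longrightarrow> q' x \<le> q x) \<Longrightarrow> q' = q"
    and x: "x \<in> C" and y: "y \<in> C"
  shows "q (- y) = - q y" "q (x + y) = q x + q y"
proof -
  have neg: "q (- y) = - q y" if y: "y \<in> C" for y
  proof -
    define M where "M = {(complex_of_real r *\<^sub>C y, r * q y) | r. r \<ge> 0}"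
    obtain q' where q': "sublin C q'" "\<And>x. x \<in> C \<Longrightarrow> q' x \<le> q x" "\<And>y c. (y, c) \<in> M \<Longrightarrow> q' (- y) \<le> - c"
    proof (rule sublin_lower_along_cone[OF C q, of M])
      show "M \<subseteq> C \<times> UNIV" using y C by (auto simp: M_def complex_vec.subspace_scale)
      show "(0, 0) \<in> M" by (auto simp: M_def intro!: exI[of _ 0])
      show "(u + v, c + d) \<in> M" if uc: "(u, c) \<in> M" "(v, d) \<in> M" for u v c d
      proof -
        obtain r s where rs: "r \<ge> 0" "s \<ge> 0" "u = complex_of_real r *\<^sub>C y" "v = complex_of_real s *\<^sub>C y"
          "c = r * q y" "d = s * q y" using uc unfolding M_def by blast
        then show ?thesis
          unfolding M_def by (auto intro!: exI[of _ "r + s"] simp: scaleC_add_left algebra_simps)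
      qed
      show "(complex_of_real t *\<^sub>C u, t * c) \<in> M" if uc: "(u, c) \<in> M" "t > 0" for u c t
      proof -
        obtain r where "r \<ge> 0" "u = complex_of_real r *\<^sub>C y" "c = r * q y"
          using uc unfolding M_def by blast
        then show ?thesis
          using uc unfolding M_def by (auto intro!: exI[of _ "t * r"] simp: scaleC_scaleC)
      qed
      show "c \<le> q u" if uc: "(u, c) \<in> M" for u c
      proof -
        obtain r where r: "r \<ge> 0" "u = complex_of_real r *\<^sub>C y" "c = r * q y"
          using uc unfolding M_def by blast
        show ?thesis
        proof (cases "r = 0")
          case True
          then show ?thesis using r sublin_zero[OF C q] by simp
        next
          case False
          then show ?thesis using r q y by (auto simp: sublin_def)
        qed
      qed
    qed blast
    have "(y, q y) \<in> M" by (auto simp: M_def scaleC_one intro!: exI[of _ 1])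
    from q'(3)[OF this] have "q (- y) \<le> - q y" using min[OF q'(1,2)] by simp
    then show ?thesis using sublin_neg_bound[OF C q y] by simp
  qed
  show "q (- y) = - q y" by (rule neg[OF y])
  have "q x = q ((x + y) + (- y))" by simp
  also have "\<dots> \<le> q (x + y) + q (- y)"
    using q x y C by (simp only: sublin_def complex_vec.subspace_add complex_vec.subspace_neg)
  finally have "q x + q y \<le> q (x + y)" using neg[OF y] by simp
  moreover have "q (x + y) \<le> q x + q y" using q x y by (auto simp: sublin_def)
  ultimately show "q (x + y) = q x + q y" by simp
qed

text \<open>Zorn's lemma. The pointwise infimum of a chain is bounded below by
  \<open>- q (- x)\<close>, and it stays subadditive because of any two members of the chain one
  lies below the other.\<close>

lemma ex_minimal_sublin:
  fixes C :: "'a::complex_vec set"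
  assumes C: "csubspace C" and q: "sublin C q"
  obtains f where "sublin C f" "\<And>x. x \<in> C \<Longrightarrow> f x \<le> q x"
    "\<And>q'. sublin C q' \<Longrightarrow> (\<And>x. x \<in> C \<Longrightarrow> q' x \<le> f x) \<Longrightarrow> q' = f"
proof -
  define A where "A = {q'. sublin C q' \<and> (\<forall>x\<in>C. q' x \<le> q x)}"
  \<comment> \<open>The order is reversed, so that a maximal element in Zorn's lemma is a minimal
    functional.\<close>
  define P where "P = (\<lambda>a b::'a \<Rightarrow> real. \<forall>x. b x \<le> a x)"
  have "\<exists>m\<in>A. \<forall>a\<in>A. P m a \<longrightarrow> a = m"
  proof (rule predicate_Zorn)
    show "partial_order_on A (relation_of P A)"
      by (rule partial_order_on_relation_ofI) (auto simp: P_def fun_eq_iff intro: order_trans antisym)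
    fix Ch assume Ch: "Ch \<in> Chains (relation_of P A)"
    then have ChA: "Ch \<subseteq> A" and tot: "\<And>a b. a \<in> Ch \<Longrightarrow> b \<in> Ch \<Longrightarrow> P a b \<or> P b a"
      by (auto simp: Chains_def relation_of_def)
    show "\<exists>u\<in>A. \<forall>a\<in>Ch. P a u"
    proof (cases "Ch = {}")
      case True
      then show ?thesis using q by (auto simp: A_def)
    next
      case ne: False
      define u where "u x = (INF a\<in>Ch. a x)" for x
      have sub: "sublin C a" "\<And>x. x \<in> C \<Longrightarrow> a x \<le> q x" if "a \<in> Ch" for a
        using that ChA by (auto simp: A_def)
      have low: "- q (- x) \<le> a x" if x: "x \<in> C" and a: "a \<in> Ch" for x a
        using sublin_neg_bound[OF C sub(1)[OF a] x] sub(2)[OF a, of "- x"] complex_vec.subspace_neg[OF C x] by simp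
      have bdd: "bdd_below ((\<lambda>a. a x) ` Ch)" for x
      proof (cases "x \<in> C")
        case True
        then show ?thesis using low by (intro bdd_belowI2)
      next
        case False
        show ?thesis
        proof (rule bdd_belowI2[of _ 0])
          show "0 \<le> a x" if "a \<in> Ch" for a using sub(1)[OF that] False by (simp add: sublin_def)
        qed
      qed
      have upper: "u x \<le> a x" if "a \<in> Ch" for x a
        unfolding u_def by (rule cINF_lower[OF bdd that])
      have greatest: "b \<le> u x" if "\<And>a. a \<in> Ch \<Longrightarrow> b \<le> a x" for x b
        unfolding u_def using ne that by (rule cINF_greatest)
      have "sublin C u"
        unfolding sublin_def
      proof (intro conjI ballI allI impI)
        fix x y assume x: "x \<in> C" and y: "y \<in> C"
        have *: "u (x + y) \<le> a x + b y" if a: "a \<in> Ch" and b: "b \<in> Ch" for a b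
        proof -
          obtain c where c: "c \<in> Ch" "c x \<le> a x" "c y \<le> b y"
            using tot[OF a b] a b by (auto simp: P_def)
          have "u (x + y) \<le> c (x + y)" by (rule upper[OF c(1)])
          also have "\<dots> \<le> c x + c y" using sub(1)[OF c(1)] x y by (auto simp: sublin_def)
          finally show ?thesis using c by simp
        qed
        have "u (x + y) - a x \<le> u y" if "a \<in> Ch" for a
          using *[OF that] by (intro greatest) (simp add: algebra_simps)
        then have "u (x + y) - u y \<le> u x"
          by (intro greatest) (simp add: algebra_simps)
        then show "u (x + y) \<le> u x + u y" by simp
      next
        fix x and r :: real assume x: "x \<in> C" and r: "r > 0"
        have s: "a (complex_of_real r *\<^sub>C x) = r * a x" if "a \<in> Ch" for a
          using sub(1)[OF that] x r by (auto simp: sublin_def)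
        have "u (complex_of_real r *\<^sub>C x) / r \<le> u x"
        proof (rule greatest)
          fix a assume "a \<in> Ch"
          then show "u (complex_of_real r *\<^sub>C x) / r \<le> a x"
            using upper[of a "complex_of_real r *\<^sub>C x"] s[of a] r by (simp add: field_simps)
        qed
        moreover have "r * u x \<le> u (complex_of_real r *\<^sub>C x)"
        proof (rule greatest)
          fix a assume "a \<in> Ch"
          then show "r * u x \<le> a (complex_of_real r *\<^sub>C x)"
            using upper[of a x] s[of a] r by simp
        qed
        ultimately show "u (complex_of_real r *\<^sub>C x) = r * u x" using r by (simp add: field_simps)
      next
        fix x assume "x \<notin> C"
        then have "a x = 0" if "a \<in> Ch" for a using sub(1)[OF that] by (auto simp: sublin_def)
        then have "(\<lambda>a. a x) ` Ch = (\<lambda>a. 0) ` Ch" by (rule image_cong[OF refl])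
        then show "u x = 0" using ne by (simp add: u_def)
      qed
      moreover have "u x \<le> q x" if "x \<in> C" for x
      proof -
        obtain a where "a \<in> Ch" using ne by auto
        then show ?thesis using upper[of a x] sub(2)[of a x] that by simp
      qed
      ultimately have "u \<in> A" by (auto simp: A_def)
      then show ?thesis using upper by (auto simp: P_def)
    qed
  qed
  then obtain f where f: "f \<in> A" "\<And>a. a \<in> A \<Longrightarrow> P f a \<Longrightarrow> a = f" by blast
  show ?thesis
  proof
    show s: "sublin C f" "\<And>x. x \<in> C \<Longrightarrow> f x \<le> q x" using f by (auto simp: A_def)
    fix q' assume q': "sublin C q'" "\<And>x. x \<in> C \<Longrightarrow> q' x \<le> f x"
    have "P f q'" using q' s(1) unfolding P_def sublin_def by (metis order_refl)
    moreover have "q' \<in> A" using q' s by (fastforce simp: A_def)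
    ultimately show "q' = f" using f by blast
  qed
qed

text \<open>Extension and separation in one statement: \<open>p\<close> measures the distance of
  \<open>w\<close> from \<open>D\<close>. A minimal sublinear functional below a suitably lowered
  copy of \<open>p\<close> is real linear, and it is the real part of the required
  functional.\<close>

theorem hahn_banach:
  fixes C :: "'a::complex_vec set" and p :: "'a \<Rightarrow> real"
  assumes C: "csubspace C" and D: "csubspace D" "D \<subseteq> C"
    and padd: "\<And>x y. x \<in> C \<Longrightarrow> y \<in> C \<Longrightarrow> p (x + y) \<le> p x + p y"
    and pscale: "\<And>c x. x \<in> C \<Longrightarrow> p (c *\<^sub>C x) = cmod c * p x"
    and w: "w \<in> C" and dist: "\<And>d. d \<in> D \<Longrightarrow> 1 \<le> p (w + d)"
  obtains F :: "'a \<Rightarrow> complex" where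
    "\<And>x y. x \<in> C \<Longrightarrow> y \<in> C \<Longrightarrow> F (x + y) = F x + F y"
    "\<And>c x. x \<in> C \<Longrightarrow> F (c *\<^sub>C x) = c * F x"
    "\<And>x. x \<in> C \<Longrightarrow> cmod (F x) \<le> p x"
    "\<And>d. d \<in> D \<Longrightarrow> F d = 0"
    "1 \<le> Re (F w)"
    "\<And>x. x \<notin> C \<Longrightarrow> F x = 0"
proof -
  note sub = complex_vec.subspace_add complex_vec.subspace_scale complex_vec.subspace_neg complex_vec.subspace_0
  have p0: "0 \<le> p x" if x: "x \<in> C" for x
  proof -
    have "p 0 = 0" using pscale[OF x, of 0] by simp
    moreover have "p (- x) = p x" using pscale[OF x, of "-1"] by (simp add: complex_vec.scale_minus_left scaleC_one)
    ultimately show ?thesis using padd[OF x sub(3)[OF C x]] by simp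
  qed
  define q where "q x = (if x \<in> C then p x else 0)" for x
  have q: "sublin C q"
    using padd pscale C by (auto simp: sublin_def q_def sub)
  \<comment> \<open>The pair with d = 0 and r = 1 will force the value at \<open>w\<close> to be at
    least 1. The pairs with r = 0, taken for d and for -d, force the functional to vanish on
    \<open>D\<close>.\<close>
  define M where "M = {(d + complex_of_real r *\<^sub>C w, r) | d r. d \<in> D \<and> r \<ge> 0}"
  obtain q' where q': "sublin C q'" "\<And>x. x \<in> C \<Longrightarrow> q' x \<le> q x" "\<And>y c. (y, c) \<in> M \<Longrightarrow> q' (- y) \<le> - c"
  proof (rule sublin_lower_along_cone[OF C q, of M])
    show "M \<subseteq> C \<times> UNIV" using w C D by (auto simp: M_def sub)
    show "(0, 0) \<in> M" using D by (auto simp: M_def sub intro!: exI[of _ 0])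
    show "(u + v, c + d) \<in> M" if uc: "(u, c) \<in> M" "(v, d) \<in> M" for u v c d
    proof -
      obtain a b where "a \<in> D" "b \<in> D" "c \<ge> 0" "d \<ge> 0" "u = a + complex_of_real c *\<^sub>C w" "v = b + complex_of_real d *\<^sub>C w"
        using uc unfolding M_def by blast
      then have "u + v = (a + b) + complex_of_real (c + d) *\<^sub>C w" "a + b \<in> D" "c + d \<ge> 0"
        using D by (simp_all add: scaleC_add_left ac_simps sub)
      then show ?thesis unfolding M_def by blast
    qed
    show "(complex_of_real t *\<^sub>C u, t * c) \<in> M" if uc: "(u, c) \<in> M" "t > 0" for u c t
    proof -
      obtain a where "a \<in> D" "c \<ge> 0" "u = a + complex_of_real c *\<^sub>C w"
        using uc unfolding M_def by blast
      then have "complex_of_real t *\<^sub>C u = complex_of_real t *\<^sub>C a + complex_of_real (t * c) *\<^sub>C w"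
          "complex_of_real t *\<^sub>C a \<in> D" "t * c \<ge> 0"
        using uc D by (simp_all add: scaleC_add_right scaleC_scaleC sub)
      then show ?thesis unfolding M_def by blast
    qed
    show "c \<le> q u" if uc: "(u, c) \<in> M" for u c
    proof -
      obtain a where a: "a \<in> D" "c \<ge> 0" "u = a + complex_of_real c *\<^sub>C w"
        using uc unfolding M_def by blast
      have uC: "u \<in> C" using a D w C by (auto simp: sub)
      show ?thesis
      proof (cases "c = 0")
        case True
        then show ?thesis using p0[OF uC] uC by (simp add: q_def)
      next
        case False
        then have c: "c > 0" using a by simp
        define d where "d = complex_of_real (1/c) *\<^sub>C a"
        have d: "d \<in> D" using a D by (auto simp: d_def sub)
        have "u = complex_of_real c *\<^sub>C (w + d)"
          using c by (simp add: d_def a scaleC_add_right scaleC_scaleC scaleC_one flip: of_real_mult)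
        then have "p u = c * p (w + d)"
          using pscale[of "w + d" "complex_of_real c"] d D w C c by (auto simp: sub)
        then show ?thesis using dist[OF d] c uC by (simp add: q_def)
      qed
    qed
  qed blast
  obtain f where f: "sublin C f" "\<And>x. x \<in> C \<Longrightarrow> f x \<le> q' x"
    "\<And>q'. sublin C q' \<Longrightarrow> (\<And>x. x \<in> C \<Longrightarrow> q' x \<le> f x) \<Longrightarrow> q' = f"
    using ex_minimal_sublin[OF C q'(1)] by blast
  have fneg: "f (- x) = - f x" if "x \<in> C" for x
    using minimal_sublin_additive(1)[OF C f(1,3) that that] by blast
  have fadd: "f (x + y) = f x + f y" if "x \<in> C" "y \<in> C" for x y
    using minimal_sublin_additive(2)[OF C f(1,3) that] by blast
  have fscale: "f (complex_of_real r *\<^sub>C x) = r * f x" if x: "x \<in> C" for r x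
  proof -
    consider "r > 0" | "r = 0" | "r < 0" by linarith
    then show ?thesis
    proof cases
      case 1
      then show ?thesis using f(1) x by (auto simp: sublin_def)
    next
      case 2
      then show ?thesis using sublin_zero[OF C f(1)] by simp
    next
      case 3
      have "f (complex_of_real (- r) *\<^sub>C x) = - r * f x"
        using f(1) x 3 unfolding sublin_def by (metis neg_0_less_iff_less)
      moreover have "- (complex_of_real (- r) *\<^sub>C x) = complex_of_real r *\<^sub>C x"
        by (simp add: complex_vec.scale_minus_left)
      ultimately show ?thesis using fneg[OF sub(2)[OF C x, of "complex_of_real (- r)"]] by simp
    qed
  qed
  have fp: "f x \<le> p x" if "x \<in> C" for x
    using f(2)[OF that] q'(2)[OF that] that by (simp add: q_def)
  have fw: "1 \<le> f w"
  proof -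
    have "w = 0 + complex_of_real 1 *\<^sub>C w" "0 \<in> D" using D by (simp_all add: scaleC_one sub)
    then have "(w, 1) \<in> M" unfolding M_def by (metis (mono_tags, lifting) mem_Collect_eq zero_le_one)
    from q'(3)[OF this] have "f (- w) \<le> - 1" using f(2)[OF sub(3)[OF C w]] by simp
    then show ?thesis using fneg[OF w] by simp
  qed
  have fD: "f d = 0" if d: "d \<in> D" for d
  proof -
    have *: "f (- d) \<le> 0" if "d \<in> D" for d
    proof -
      have "d = d + complex_of_real 0 *\<^sub>C w" by simp
      then have "(d, 0) \<in> M" using that unfolding M_def by blast
      from q'(3)[OF this] show ?thesis using f(2)[of "- d"] sub(3)[OF C, of d] subsetD[OF D(2) that] by simp
    qed
    have dC: "d \<in> C" using d D by auto
    show ?thesis using *[OF d] *[OF sub(3)[OF D(1) d]] fneg[OF dC] by simp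
  qed
  define F where "F x = (if x \<in> C then Complex (f x) (- f (\<i> *\<^sub>C x)) else 0)" for x
  have Fadd: "F (x + y) = F x + F y" if "x \<in> C" "y \<in> C" for x y
    using that C by (simp add: F_def fadd sub scaleC_add_right complex_eq_iff)
  have Fscale: "F (c *\<^sub>C x) = c * F x" if x: "x \<in> C" for c x
  proof -
    have dec: "c *\<^sub>C x = complex_of_real (Re c) *\<^sub>C x + complex_of_real (Im c) *\<^sub>C (\<i> *\<^sub>C x)"
      by (subst complex_eq[of c]) (simp add: scaleC_add_left scaleC_scaleC mult.commute)
    have dec2: "\<i> *\<^sub>C c *\<^sub>C x = complex_of_real (Re c) *\<^sub>C (\<i> *\<^sub>C x) + complex_of_real (- Im c) *\<^sub>C x"
      unfolding scaleC_scaleC scaleC_add_left[symmetric]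
      by (rule arg_cong[where f = "\<lambda>c. c *\<^sub>C x"]) (simp add: complex_eq_iff)
    have ix: "\<i> *\<^sub>C x \<in> C" using C x by (rule sub)
    have "f (c *\<^sub>C x) = Re c * f x + Im c * f (\<i> *\<^sub>C x)"
      unfolding dec by (simp only: fadd[OF sub(2)[OF C x] sub(2)[OF C ix]] fscale[OF x] fscale[OF ix])
    moreover have "f (\<i> *\<^sub>C c *\<^sub>C x) = Re c * f (\<i> *\<^sub>C x) - Im c * f x"
      unfolding dec2 by (simp add: fadd[OF sub(2)[OF C ix] sub(2)[OF C x]] fscale[OF x] fscale[OF ix] del: complex_vec.scale_scale of_real_minus)
    ultimately show ?thesis
      using x C by (simp add: F_def sub complex_eq_iff)
  qed
  show ?thesis
  proof
    show "cmod (F x) \<le> p x" if x: "x \<in> C" for x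
    proof (cases "F x = 0")
      case True
      then show ?thesis using p0[OF x] by simp
    next
      case False
      define c where "c = cnj (F x) / cmod (F x)"
      have c: "cmod c = 1" using False by (simp add: c_def norm_divide)
      have "F (c *\<^sub>C x) = complex_of_real (cmod (F x))"
        using False by (simp add: Fscale[OF x] c_def mult.commute complex_norm_square[symmetric] power2_eq_square)
      then have "cmod (F x) = f (c *\<^sub>C x)"
        using sub(2)[OF C x] by (simp add: F_def complex_eq_iff)
      also have "\<dots> \<le> p (c *\<^sub>C x)" using fp sub(2)[OF C x] by blast
      also have "\<dots> = p x" using pscale[OF x] c by simp
      finally show ?thesis .
    qed
    show "F d = 0" if "d \<in> D" for d
      using fD[OF that] fD[OF sub(2)[OF D(1) that]] by (simp add: F_def complex_eq_iff)
    show "1 \<le> Re (F w)" using fw w by (simp add: F_def)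
    show "F x = 0" if "x \<notin> C" for x using that by (simp add: F_def)
  qed (use Fadd Fscale in auto)
qed

section \<open>Normed spaces and bounded operators\<close>


locale cnormed =
  fixes A :: "'a::complex_vec cnspace"
  assumes subspace: "csubspace (carr A)"
    and norm_ge0: "x \<in> carr A \<Longrightarrow> 0 \<le> nrm A x"
    and norm_triangle: "x \<in> carr A \<Longrightarrow> y \<in> carr A \<Longrightarrow> nrm A (x + y) \<le> nrm A x + nrm A y"
    and norm_scale: "x \<in> carr A \<Longrightarrow> nrm A (c *\<^sub>C x) = cmod c * nrm A x"
    and norm_zero_imp: "x \<in> carr A \<Longrightarrow> nrm A x = 0 \<Longrightarrow> x = 0"
begin

lemma mem_zero: "0 \<in> carr A"
  by (rule complex_vec.subspace_0[OF subspace])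

lemma mem_add: "x \<in> carr A \<Longrightarrow> y \<in> carr A \<Longrightarrow> x + y \<in> carr A"
  by (rule complex_vec.subspace_add[OF subspace])

lemma mem_diff: "x \<in> carr A \<Longrightarrow> y \<in> carr A \<Longrightarrow> x - y \<in> carr A"
  by (rule complex_vec.subspace_diff[OF subspace])

lemma mem_neg: "x \<in> carr A \<Longrightarrow> - x \<in> carr A"
  by (rule complex_vec.subspace_neg[OF subspace])

lemma mem_scale: "x \<in> carr A \<Longrightarrow> c *\<^sub>C x \<in> carr A"
  by (rule complex_vec.subspace_scale[OF subspace])

lemmas mem = mem_zero mem_add mem_diff mem_neg mem_scale

lemma norm_zero: "nrm A 0 = 0"
  using norm_scale[OF mem_zero, of 0] by simp

lemma norm_neg: "x \<in> carr A \<Longrightarrow> nrm A (- x) = nrm A x"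
  using norm_scale[of x "-1"] by (simp add: complex_vec.scale_minus_left)

lemma norm_minus_commute: "x \<in> carr A \<Longrightarrow> y \<in> carr A \<Longrightarrow> nrm A (x - y) = nrm A (y - x)"
  using norm_neg[OF mem_diff, of x y] by simp

lemma norm_triangle_diff: "x \<in> carr A \<Longrightarrow> y \<in> carr A \<Longrightarrow> nrm A (x - y) \<le> nrm A x + nrm A y"
  using norm_triangle[OF _ mem_neg, of x y] norm_neg[of y] by simp

lemma norm_diff_triangle:
  "x \<in> carr A \<Longrightarrow> y \<in> carr A \<Longrightarrow> z \<in> carr A \<Longrightarrow> nrm A (x - z) \<le> nrm A (x - y) + nrm A (y - z)"
  using norm_triangle[OF mem_diff mem_diff, of x y y z] by simp

lemma norm_le_diff: "x \<in> carr A \<Longrightarrow> y \<in> carr A \<Longrightarrow> nrm A x \<le> nrm A y + nrm A (x - y)"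
  using norm_triangle[OF _ mem_diff, of y x y] by simp

lemma Metric: "Metric_space (carr A) (ndist A)"
proof
  show "0 \<le> ndist A x y" for x y by (simp add: ndist_def norm_ge0 mem_diff)
  show "ndist A x y = ndist A y x" for x y by (simp add: ndist_def norm_minus_commute)
  show "ndist A x y = 0 \<longleftrightarrow> x = y" if "x \<in> carr A" "y \<in> carr A" for x y
    using that norm_zero_imp[OF mem_diff, of x y] by (auto simp: ndist_def norm_zero)
  show "ndist A x z \<le> ndist A x y + ndist A y z" if "x \<in> carr A" "y \<in> carr A" "z \<in> carr A" for x y z
    using that by (simp add: ndist_def norm_diff_triangle)
qed

lemma closedin_iff:
  "closedin (ntop A) J \<longleftrightarrow> J \<subseteq> carr A \<and> (\<forall>x\<in>carr A - J. \<exists>r>0. \<forall>y\<in>J. r \<le> nrm A (x - y))"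
proof -
  interpret Metric_space "carr A" "ndist A" by (rule Metric)
  have "disjnt J (mball x r) \<longleftrightarrow> (\<forall>y\<in>J. r \<le> nrm A (x - y))" if "J \<subseteq> carr A" "x \<in> carr A" for x r
    using that by (auto simp: disjnt_iff ndist_def subset_iff not_less)
  then show ?thesis unfolding ntop_def closedin_metric by auto
qed

lemma closedin_limit:
  assumes "closedin (ntop A) J" "x \<in> carr A" "\<And>e. e > 0 \<Longrightarrow> \<exists>y\<in>J. nrm A (x - y) < e"
  shows "x \<in> J"
  using assms unfolding closedin_iff by (meson DiffI not_less)

end

lemma cnormed_scalar: "cnormed scalar_space"
proof
  show "csubspace (carr scalar_space)" by (simp add: scalar_space_def)
qed (auto simp: scalar_space_def scaleC_complex_def norm_mult intro: norm_triangle_ineq)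

lemma bounded_opsI:
  assumes "\<And>x. x \<in> carr A \<Longrightarrow> T x \<in> carr B"
    "\<And>x y. x \<in> carr A \<Longrightarrow> y \<in> carr A \<Longrightarrow> T (x + y) = T x + T y"
    "\<And>c x. x \<in> carr A \<Longrightarrow> T (c *\<^sub>C x) = c *\<^sub>C T x"
    "\<And>x. x \<in> carr A \<Longrightarrow> nrm B (T x) \<le> K * nrm A x"
    "\<And>x. x \<notin> carr A \<Longrightarrow> T x = 0"
  shows "T \<in> bounded_ops A B"
  using assms unfolding bounded_ops_def by blast

lemma bounded_opsD:
  assumes "T \<in> bounded_ops A B"
  shows "x \<in> carr A \<Longrightarrow> T x \<in> carr B"
    "x \<in> carr A \<Longrightarrow> y \<in> carr A \<Longrightarrow> T (x + y) = T x + T y"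
    "x \<in> carr A \<Longrightarrow> T (c *\<^sub>C x) = c *\<^sub>C T x"
    "x \<notin> carr A \<Longrightarrow> T x = 0"
    "\<exists>K. \<forall>x\<in>carr A. nrm B (T x) \<le> K * nrm A x"
  using assms unfolding bounded_ops_def by blast+

lemma carr_op_space: "carr (op_space A B) = bounded_ops A B"
  by (simp add: op_space_def)

lemma nrm_op_space: "nrm (op_space A B) = op_norm A B"
  by (simp add: op_space_def)

locale cnormed_pair = A: cnormed A + B: cnormed B
  for A :: "'a::complex_vec cnspace" and B :: "'b::complex_vec cnspace"
begin

context
  fixes T assumes T: "T \<in> bounded_ops A B"
begin

lemma op_zero: "T 0 = 0"
  using bounded_opsD(3)[OF T A.mem_zero, of 0] by simp

lemma op_neg: "x \<in> carr A \<Longrightarrow> T (- x) = - T x"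
  using bounded_opsD(3)[OF T, of x "-1"] by (simp add: complex_vec.scale_minus_left)

lemma op_diff: "x \<in> carr A \<Longrightarrow> y \<in> carr A \<Longrightarrow> T (x - y) = T x - T y"
  using bounded_opsD(2)[OF T _ A.mem_neg, of x y] op_neg[of y] by simp

lemma op_bdd_above: "bdd_above ((\<lambda>x. nrm B (T x)) ` {x\<in>carr A. nrm A x \<le> 1})"
proof -
  obtain K where K: "\<And>x. x \<in> carr A \<Longrightarrow> nrm B (T x) \<le> K * nrm A x"
    using bounded_opsD(5)[OF T] by blast
  show ?thesis
  proof (rule bdd_aboveI2)
    fix x assume "x \<in> {x\<in>carr A. nrm A x \<le> 1}"
    then have x: "x \<in> carr A" "nrm A x \<le> 1" by auto
    have "nrm B (T x) \<le> K * nrm A x" by (rule K[OF x(1)])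
    also have "\<dots> \<le> \<bar>K\<bar> * nrm A x" using A.norm_ge0[OF x(1)] by (intro mult_right_mono) auto
    also have "\<dots> \<le> \<bar>K\<bar> * 1" using x by (intro mult_left_mono) auto
    finally show "nrm B (T x) \<le> \<bar>K\<bar>" by simp
  qed
qed

lemma op_norm_upper: "x \<in> carr A \<Longrightarrow> nrm A x \<le> 1 \<Longrightarrow> nrm B (T x) \<le> op_norm A B T"
  unfolding op_norm_def by (rule cSUP_upper[OF _ op_bdd_above]) simp

lemma op_norm_ge0: "0 \<le> op_norm A B T"
  using op_norm_upper[OF A.mem_zero] by (simp add: A.norm_zero op_zero B.norm_zero)

lemma op_norm_bound:
  assumes x: "x \<in> carr A"
  shows "nrm B (T x) \<le> op_norm A B T * nrm A x"
proof (cases "nrm A x = 0")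
  case True
  then have "x = 0" by (rule A.norm_zero_imp[OF x])
  then show ?thesis by (simp add: op_zero A.norm_zero B.norm_zero)
next
  case False
  then have p: "nrm A x > 0" using A.norm_ge0[OF x] by simp
  define c where "c = complex_of_real (1 / nrm A x)"
  have c: "cmod c = 1 / nrm A x" using p by (simp add: c_def norm_divide)
  have "nrm A (c *\<^sub>C x) = 1" using A.norm_scale[OF x, of c] c p by simp
  then have "nrm B (T (c *\<^sub>C x)) \<le> op_norm A B T"
    by (intro op_norm_upper A.mem_scale x) simp
  moreover have "nrm B (T (c *\<^sub>C x)) = nrm B (T x) / nrm A x"
    using B.norm_scale[OF bounded_opsD(1)[OF T x], of c] c bounded_opsD(3)[OF T x, of c] by simp
  ultimately show ?thesis using p by (simp add: field_simps)
qed

lemma op_norm_bound':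
  assumes "x \<in> carr A" "nrm A x \<le> c" "op_norm A B T \<le> K"
  shows "nrm B (T x) \<le> K * c"
proof -
  have "nrm B (T x) \<le> op_norm A B T * nrm A x" by (rule op_norm_bound[OF assms(1)])
  also have "\<dots> \<le> K * c"
    using assms op_norm_ge0 A.norm_ge0[OF assms(1)] by (intro mult_mono) auto
  finally show ?thesis .
qed

lemma op_norm_le:
  assumes "0 \<le> K" "\<And>x. x \<in> carr A \<Longrightarrow> nrm B (T x) \<le> K * nrm A x"
  shows "op_norm A B T \<le> K"
  unfolding op_norm_def
proof (rule cSUP_least)
  show "{x \<in> carr A. nrm A x \<le> 1} \<noteq> {}" using A.mem_zero by (auto simp: A.norm_zero intro!: exI[of _ 0])
  fix x assume "x \<in> {x \<in> carr A. nrm A x \<le> 1}"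
  then have x: "x \<in> carr A" "nrm A x \<le> 1" by auto
  have "nrm B (T x) \<le> K * nrm A x" by (rule assms(2)[OF x(1)])
  also have "\<dots> \<le> K * 1" using x assms(1) by (intro mult_left_mono)
  finally show "nrm B (T x) \<le> K" by simp
qed

lemma op_norm_le_ball:
  assumes "\<And>x. x \<in> carr A \<Longrightarrow> nrm A x \<le> 1 \<Longrightarrow> nrm B (T x) \<le> K"
  shows "op_norm A B T \<le> K"
  unfolding op_norm_def
proof (rule cSUP_least)
  show "{x \<in> carr A. nrm A x \<le> 1} \<noteq> {}" using A.mem_zero by (auto simp: A.norm_zero intro!: exI[of _ 0])
qed (use assms in auto)

lemma op_norming:
  assumes "e > 0"
  obtains x where "x \<in> carr A" "nrm A x \<le> 1" "op_norm A B T - e < nrm B (T x)"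
proof -
  have "\<not> (\<forall>x\<in>carr A. nrm A x \<le> 1 \<longrightarrow> nrm B (T x) \<le> op_norm A B T - e)"
    using op_norm_le_ball[of "op_norm A B T - e"] assms by auto
  then show ?thesis using that by force
qed

end

lemma bounded_ops_subspace: "csubspace (bounded_ops A B)"
proof (rule complex_vec.subspaceI)
  show "0 \<in> bounded_ops A B"
    by (rule bounded_opsI[where K = 0]) (auto simp: B.mem B.norm_zero)
next
  fix S T assume S: "S \<in> bounded_ops A B" and T: "T \<in> bounded_ops A B"
  show "S + T \<in> bounded_ops A B"
  proof (rule bounded_opsI[where K = "op_norm A B S + op_norm A B T"])
    fix x assume x: "x \<in> carr A"
    have "nrm B ((S + T) x) \<le> nrm B (S x) + nrm B (T x)"
      using bounded_opsD(1)[OF S x] bounded_opsD(1)[OF T x] by (simp add: B.norm_triangle)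
    then show "nrm B ((S + T) x) \<le> (op_norm A B S + op_norm A B T) * nrm A x"
      using op_norm_bound[OF S x] op_norm_bound[OF T x] by (simp add: algebra_simps)
  qed (use bounded_opsD[OF S] bounded_opsD[OF T] in \<open>simp_all add: B.mem scaleC_add_right\<close>)
next
  fix c T assume T: "T \<in> bounded_ops A B"
  show "c *\<^sub>C T \<in> bounded_ops A B"
  proof (rule bounded_opsI[where K = "cmod c * op_norm A B T"])
    fix x assume x: "x \<in> carr A"
    show "nrm B ((c *\<^sub>C T) x) \<le> cmod c * op_norm A B T * nrm A x"
      using op_norm_bound[OF T x] B.norm_scale[OF bounded_opsD(1)[OF T x], of c]
      by (simp add: scaleC_fun_def mult.assoc mult_left_mono)
  qed (use bounded_opsD[OF T] in \<open>simp_all add: scaleC_fun_def B.mem scaleC_add_right mult.commute\<close>)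
qed

lemma cnormed_op_space: "cnormed (op_space A B)"
proof
  show "csubspace (carr (op_space A B))" by (simp add: carr_op_space bounded_ops_subspace)
next
  fix T assume "T \<in> carr (op_space A B)"
  then show "0 \<le> nrm (op_space A B) T" by (simp add: carr_op_space nrm_op_space op_norm_ge0)
next
  fix S T assume "S \<in> carr (op_space A B)" "T \<in> carr (op_space A B)"
  then have S: "S \<in> bounded_ops A B" and T: "T \<in> bounded_ops A B" by (simp_all add: carr_op_space)
  have ST: "S + T \<in> bounded_ops A B" by (rule complex_vec.subspace_add[OF bounded_ops_subspace S T])
  have "op_norm A B (S + T) \<le> op_norm A B S + op_norm A B T"
  proof (rule op_norm_le_ball[OF ST])
    fix x assume x: "x \<in> carr A" "nrm A x \<le> 1"
    have "nrm B ((S + T) x) \<le> nrm B (S x) + nrm B (T x)"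
      using bounded_opsD(1)[OF S x(1)] bounded_opsD(1)[OF T x(1)] by (simp add: B.norm_triangle)
    then show "nrm B ((S + T) x) \<le> op_norm A B S + op_norm A B T"
      using op_norm_upper[OF S x] op_norm_upper[OF T x] by simp
  qed
  then show "nrm (op_space A B) (S + T) \<le> nrm (op_space A B) S + nrm (op_space A B) T"
    by (simp add: nrm_op_space)
next
  fix T c assume "T \<in> carr (op_space A B)"
  then have T: "T \<in> bounded_ops A B" by (simp add: carr_op_space)
  have le: "op_norm A B (c *\<^sub>C T) \<le> cmod c * op_norm A B T" if T: "T \<in> bounded_ops A B" for c T
  proof (rule op_norm_le_ball)
    show "c *\<^sub>C T \<in> bounded_ops A B" by (rule complex_vec.subspace_scale[OF bounded_ops_subspace T])
    fix x assume x: "x \<in> carr A" "nrm A x \<le> 1"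
    show "nrm B ((c *\<^sub>C T) x) \<le> cmod c * op_norm A B T"
      using op_norm_upper[OF T x] B.norm_scale[OF bounded_opsD(1)[OF T x(1)], of c]
      by (simp add: scaleC_fun_def mult_left_mono)
  qed
  have "op_norm A B (c *\<^sub>C T) = cmod c * op_norm A B T"
  proof (cases "c = 0")
    case True
    have "op_norm A B (c *\<^sub>C T) \<ge> 0"
      by (intro op_norm_ge0 complex_vec.subspace_scale[OF bounded_ops_subspace T])
    then show ?thesis using le[OF T, of c] True by simp
  next
    case False
    have "op_norm A B (inverse c *\<^sub>C c *\<^sub>C T) \<le> cmod (inverse c) * op_norm A B (c *\<^sub>C T)"
      by (intro le complex_vec.subspace_scale[OF bounded_ops_subspace T])
    moreover have "inverse c *\<^sub>C c *\<^sub>C T = T" using False by simp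
    ultimately have "cmod c * op_norm A B T \<le> op_norm A B (c *\<^sub>C T)"
      using False by (simp add: norm_inverse norm_divide field_simps)
    then show ?thesis using le[OF T, of c] by simp
  qed
  then show "nrm (op_space A B) (c *\<^sub>C T) = cmod c * nrm (op_space A B) T"
    by (simp add: nrm_op_space)
next
  fix T assume "T \<in> carr (op_space A B)" "nrm (op_space A B) T = 0"
  then have T: "T \<in> bounded_ops A B" "op_norm A B T = 0" by (simp_all add: carr_op_space nrm_op_space)
  have "T x = 0" for x
  proof (cases "x \<in> carr A")
    case True
    then have "nrm B (T x) = 0"
      using op_norm_bound[OF T(1) True] T(2) B.norm_ge0[OF bounded_opsD(1)[OF T(1) True]] by simp
    then show ?thesis by (rule B.norm_zero_imp[OF bounded_opsD(1)[OF T(1) True]])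
  next
    case False
    then show ?thesis by (rule bounded_opsD(4)[OF T(1)])
  qed
  then show "T = 0" by (simp add: fun_eq_iff)
qed

end

lemma op_comp:
  assumes "cnormed A" "cnormed B" "cnormed D"
    and S: "S \<in> bounded_ops B D" and T: "T \<in> bounded_ops A B"
  shows "(\<lambda>x. S (T x)) \<in> bounded_ops A D"
    "op_norm A D (\<lambda>x. S (T x)) \<le> op_norm B D S * op_norm A B T"
proof -
  interpret AB: cnormed_pair A B using assms by (simp add: cnormed_pair_def)
  interpret BD: cnormed_pair B D using assms by (simp add: cnormed_pair_def)
  interpret AD: cnormed_pair A D using assms by (simp add: cnormed_pair_def)
  have n: "nrm D (S (T x)) \<le> op_norm B D S * op_norm A B T * nrm A x" if x: "x \<in> carr A" for x
    using BD.op_norm_bound'[OF S bounded_opsD(1)[OF T x] AB.op_norm_bound[OF T x] order_refl]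
    by (simp add: mult.assoc)
  show *: "(\<lambda>x. S (T x)) \<in> bounded_ops A D"
    by (rule bounded_opsI[OF _ _ _ n])
      (use bounded_opsD[OF S] bounded_opsD[OF T] BD.op_zero[OF S] in auto)
  show "op_norm A D (\<lambda>x. S (T x)) \<le> op_norm B D S * op_norm A B T"
    by (rule AD.op_norm_le[OF * _ n]) (simp_all add: AB.op_norm_ge0[OF T] BD.op_norm_ge0[OF S])
qed

section \<open>The dual space: bounded functionals, norming vectors and separation\<close>

context cnormed
begin

lemma dual_pair: "cnormed_pair A scalar_space"
  by (rule cnormed_pair.intro[OF cnormed_axioms cnormed_scalar])

lemma cnormed_dual: "cnormed (dual_space A)"
  by (rule cnormed_pair.cnormed_op_space[OF dual_pair])

interpretation dual: cnormed_pair A scalar_space by (rule dual_pair)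

interpretation dualsp: cnormed "dual_space A" by (rule cnormed_dual)

lemma functional_add: "f \<in> carr (dual_space A) \<Longrightarrow> x \<in> carr A \<Longrightarrow> y \<in> carr A \<Longrightarrow> f (x + y) = f x + f y"
  by (simp add: carr_op_space bounded_opsD)

lemma functional_diff: "f \<in> carr (dual_space A) \<Longrightarrow> x \<in> carr A \<Longrightarrow> y \<in> carr A \<Longrightarrow> f (x - y) = f x - f y"
  by (simp add: carr_op_space dual.op_diff)

lemma functional_scale: "f \<in> carr (dual_space A) \<Longrightarrow> x \<in> carr A \<Longrightarrow> f (c *\<^sub>C x) = c * f x"
  by (simp add: carr_op_space bounded_opsD(3) scaleC_complex_def)

lemma functional_zero: "f \<in> carr (dual_space A) \<Longrightarrow> f 0 = 0"
  by (simp add: carr_op_space dual.op_zero)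

lemma functional_bound: "f \<in> carr (dual_space A) \<Longrightarrow> x \<in> carr A \<Longrightarrow> cmod (f x) \<le> nrm (dual_space A) f * nrm A x"
  using dual.op_norm_bound[of f x] by (simp add: carr_op_space nrm_op_space scalar_space_def)

lemma functional_bound':
  "f \<in> carr (dual_space A) \<Longrightarrow> x \<in> carr A \<Longrightarrow> nrm A x \<le> c \<Longrightarrow> cmod (f x) \<le> nrm (dual_space A) f * c"
  using dual.op_norm_bound'[of f x c "nrm (dual_space A) f"] by (simp add: carr_op_space nrm_op_space scalar_space_def)

lemma functionalI:
  assumes "\<And>x y. x \<in> carr A \<Longrightarrow> y \<in> carr A \<Longrightarrow> f (x + y) = f x + f y"
    "\<And>c x. x \<in> carr A \<Longrightarrow> f (c *\<^sub>C x) = c * f x"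
    "\<And>x. x \<in> carr A \<Longrightarrow> cmod (f x) \<le> K * nrm A x"
    "\<And>x. x \<notin> carr A \<Longrightarrow> f x = 0"
  shows "f \<in> carr (dual_space A)"
  unfolding carr_op_space
  by (rule bounded_opsI[where K = K]) (use assms in \<open>auto simp: scalar_space_def scaleC_complex_def\<close>)

text \<open>The vector is rotated until the value is real and nonnegative, so that near-maximal
  values of several functionals can be added without cancellation.\<close>

lemma functional_norming:
  assumes f: "f \<in> carr (dual_space A)" and e: "e > 0"
  obtains x where "x \<in> carr A" "nrm A x \<le> 1" "f x = complex_of_real (cmod (f x))"
    "nrm (dual_space A) f - e < cmod (f x)"
proof -
  obtain x where x: "x \<in> carr A" "nrm A x \<le> 1" "nrm (dual_space A) f - e < cmod (f x)"
    using dual.op_norming[of f e] f e by (auto simp: carr_op_space nrm_op_space scalar_space_def)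
  define c where "c = (if f x = 0 then 1 else cnj (f x) / cmod (f x))"
  have c: "cmod c = 1" by (simp add: c_def norm_divide)
  have "f (c *\<^sub>C x) = complex_of_real (cmod (f x))"
    by (simp add: functional_scale[OF f x(1)] c_def mult.commute complex_norm_square[symmetric] power2_eq_square)
  then show ?thesis
    using x c by (intro that[of "c *\<^sub>C x"]) (auto simp: mem norm_scale)
qed

text \<open>Dividing the norm by a lower bound of the distance from \<open>x\<close> to
  \<open>J\<close> normalises that distance to one, as the Hahn-Banach theorem requires.\<close>

lemma separate_closed_subspace:
  assumes J: "csubspace J" "closedin (ntop A) J" and x: "x \<in> carr A" "x \<notin> J"
  obtains f where "f \<in> annihilator A J" "f x \<noteq> 0"
proof -
  obtain r where r: "r > 0" "\<And>y. y \<in> J \<Longrightarrow> r \<le> nrm A (x - y)" and JA: "J \<subseteq> carr A"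
    using J(2) x unfolding closedin_iff by blast
  obtain F :: "'a \<Rightarrow> complex" where F:
    "\<And>x y. x \<in> carr A \<Longrightarrow> y \<in> carr A \<Longrightarrow> F (x + y) = F x + F y"
    "\<And>c x. x \<in> carr A \<Longrightarrow> F (c *\<^sub>C x) = c * F x"
    "\<And>x. x \<in> carr A \<Longrightarrow> cmod (F x) \<le> nrm A x / r"
    "\<And>d. d \<in> J \<Longrightarrow> F d = 0"
    "1 \<le> Re (F x)"
    "\<And>x. x \<notin> carr A \<Longrightarrow> F x = 0"
  proof (rule hahn_banach[OF subspace J(1) JA, where p = "\<lambda>x. nrm A x / r" and w = x])
    show "nrm A (x + y) / r \<le> nrm A x / r + nrm A y / r" if "x \<in> carr A" "y \<in> carr A" for x y
      using norm_triangle[OF that] r by (simp add: field_simps)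
    show "1 \<le> nrm A (x + d) / r" if "d \<in> J" for d
      using r(2)[OF complex_vec.subspace_neg[OF J(1) that]] r(1) by simp
  qed (use x norm_scale in auto)
  have "F \<in> carr (dual_space A)"
    by (rule functionalI[where K = "1/r"]) (use F in auto)
  moreover have "F x \<noteq> 0" using F(5) by (metis zero_complex.sel(1) not_one_le_zero)
  ultimately show ?thesis using that[of F] F(4) by (auto simp: annihilator_def)
qed

lemma annihilator_subspace: "csubspace (annihilator A J)"
proof (rule complex_vec.subspaceI)
  show "c *\<^sub>C f \<in> annihilator A J" if "f \<in> annihilator A J" for c f
    using that dualsp.mem_scale[of f c] by (auto simp: annihilator_def scaleC_fun_def scaleC_complex_def)
qed (auto simp: annihilator_def dualsp.mem)

end

section \<open>M-ideals\<close>


context cnormed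
begin

interpretation dualsp: cnormed "dual_space A" by (rule cnormed_dual)

lemma M_idealD:
  assumes "M_ideal A J"
  shows "J \<subseteq> carr A" "csubspace J" "closedin (ntop A) J"
  using assms by (auto simp: M_ideal_def)

lemma M_ideal_decomposition:
  assumes "M_ideal A J"
  obtains V where "csubspace V" "V \<subseteq> carr (dual_space A)" "annihilator A J \<inter> V = {0}"
    "\<And>f. f \<in> carr (dual_space A) \<Longrightarrow> \<exists>u\<in>annihilator A J. \<exists>v\<in>V. f = u + v"
    "\<And>u v. u \<in> annihilator A J \<Longrightarrow> v \<in> V \<Longrightarrow>
      nrm (dual_space A) (u + v) = nrm (dual_space A) u + nrm (dual_space A) v"
proof -
  obtain V where V: "V \<subseteq> carr (dual_space A)" "l1_direct_sum (dual_space A) (annihilator A J) V"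
    using assms by (auto simp: M_ideal_def)
  show ?thesis
    by (rule that[of V]) (use V in \<open>auto simp: l1_direct_sum_def\<close>)
qed

text \<open>If \<open>f\<close> annihilates \<open>J\<close> and \<open>g = f \<circ> \<Phi> = g0 + g1\<close> is the \<open>\<ell>\<^sub>1\<close>-decomposition, then
  \<open>\<parallel>f + t g\<parallel> + \<parallel>f - t g\<parallel> \<ge> 2 \<parallel>f\<parallel> + 2 t \<parallel>g1\<parallel>\<close>, so the smoothness condition forces \<open>g1 = 0\<close>.\<close>

lemma M_ideal_invariant:
  assumes M: "M_ideal A J"
    and \<Phi>: "\<And>x. x \<in> carr A \<Longrightarrow> \<Phi> x \<in> carr A"
      "\<And>x y. x \<in> carr A \<Longrightarrow> y \<in> carr A \<Longrightarrow> \<Phi> (x + y) = \<Phi> x + \<Phi> y"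
      "\<And>c x. x \<in> carr A \<Longrightarrow> \<Phi> (c *\<^sub>C x) = c *\<^sub>C \<Phi> x"
      "\<And>x. x \<in> carr A \<Longrightarrow> nrm A (\<Phi> x) \<le> K * nrm A x"
    and smooth: "\<And>\<eta>. \<eta> > 0 \<Longrightarrow> \<exists>t>0. \<forall>x\<in>carr A. \<forall>y\<in>carr A. nrm A x \<le> 1 \<longrightarrow> nrm A y \<le> 1 \<longrightarrow>
      nrm A (x + y + complex_of_real t *\<^sub>C \<Phi> (x - y)) \<le> 2 + \<eta> * t"
    and x: "x \<in> J"
  shows "\<Phi> x \<in> J"
proof (rule ccontr)
  assume nin: "\<Phi> x \<notin> J"
  note J = M_idealD[OF M]
  have xA: "x \<in> carr A" using x J(1) by auto
  obtain V where V: "csubspace V" "V \<subseteq> carr (dual_space A)" "annihilator A J \<inter> V = {0}"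
    "\<And>f. f \<in> carr (dual_space A) \<Longrightarrow> \<exists>u\<in>annihilator A J. \<exists>v\<in>V. f = u + v"
    "\<And>u v. u \<in> annihilator A J \<Longrightarrow> v \<in> V \<Longrightarrow>
      nrm (dual_space A) (u + v) = nrm (dual_space A) u + nrm (dual_space A) v"
    using M_ideal_decomposition[OF M] by blast
  let ?N = "nrm (dual_space A)"
  obtain f where f: "f \<in> annihilator A J" "f (\<Phi> x) \<noteq> 0"
    using separate_closed_subspace[OF J(2,3) \<Phi>(1)[OF xA] nin] by blast
  have fd: "f \<in> carr (dual_space A)" using f by (auto simp: annihilator_def)
  define g where "g y = (if y \<in> carr A then f (\<Phi> y) else 0)" for y
  have gd: "g \<in> carr (dual_space A)"
  proof (rule functionalI[where K = "?N f * K"])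
    fix y assume y: "y \<in> carr A"
    show "cmod (g y) \<le> ?N f * K * nrm A y"
      using functional_bound'[OF fd \<Phi>(1)[OF y] \<Phi>(4)[OF y]] y by (simp add: g_def mult.assoc)
  qed (use \<Phi> in \<open>simp_all add: g_def mem functional_add[OF fd] functional_scale[OF fd]\<close>)
  obtain u v where uv: "u \<in> annihilator A J" "v \<in> V" "g = u + v" using V(4)[OF gd] by blast
  have ud: "u \<in> carr (dual_space A)" and vd: "v \<in> carr (dual_space A)"
    using uv V(2) by (auto simp: annihilator_def)
  have "?N v \<le> \<eta> * ?N f / 2" if \<eta>: "\<eta> > 0" for \<eta>
  proof -
    obtain t where t: "t > 0" "\<And>x y. x \<in> carr A \<Longrightarrow> y \<in> carr A \<Longrightarrow> nrm A x \<le> 1 \<Longrightarrow> nrm A y \<le> 1 \<Longrightarrow>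
      nrm A (x + y + complex_of_real t *\<^sub>C \<Phi> (x - y)) \<le> 2 + \<eta> * t"
      using smooth[OF \<eta>] by blast
    define c where "c = complex_of_real t"
    have cg: "c *\<^sub>C g \<in> carr (dual_space A)" using gd by (simp add: dualsp.mem)
    \<comment> \<open>Vectors y and z that almost norm the two functionals are merged: the two
      values add up to the value of \<open>f\<close> at the vector bounded by the smoothness
      condition.\<close>
    have upper: "?N (f + c *\<^sub>C g) + ?N (f - c *\<^sub>C g) \<le> ?N f * (2 + \<eta> * t)"
    proof (rule field_le_epsilon)
      fix e :: real assume e: "e > 0"
      obtain y where y: "y \<in> carr A" "nrm A y \<le> 1"
        "(f + c *\<^sub>C g) y = complex_of_real (cmod ((f + c *\<^sub>C g) y))" "?N (f + c *\<^sub>C g) - e/2 < cmod ((f + c *\<^sub>C g) y)"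
        using functional_norming[OF dualsp.mem_add[OF fd cg], of "e/2"] e by auto
      obtain z where z: "z \<in> carr A" "nrm A z \<le> 1"
        "(f - c *\<^sub>C g) z = complex_of_real (cmod ((f - c *\<^sub>C g) z))" "?N (f - c *\<^sub>C g) - e/2 < cmod ((f - c *\<^sub>C g) z)"
        using functional_norming[OF dualsp.mem_diff[OF fd cg], of "e/2"] e by auto
      have yz: "y - z \<in> carr A" using y z by (simp add: mem)
      have \<Phi>d: "\<Phi> (y - z) = \<Phi> y - \<Phi> z"
        using \<Phi>(2)[OF y(1) mem_scale[OF z(1), of "-1"]] \<Phi>(3)[OF z(1), of "-1"]
        by (simp add: complex_vec.scale_minus_left)
      have eq: "(f + c *\<^sub>C g) y + (f - c *\<^sub>C g) z = f (y + z + c *\<^sub>C \<Phi> (y - z))"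
        using y z yz by (simp add: \<Phi>d functional_add[OF fd] functional_scale[OF fd] functional_diff[OF fd] mem \<Phi>(1)
            scaleC_fun_def scaleC_complex_def g_def complex_vec.scale_right_diff_distrib algebra_simps)
      have "cmod ((f + c *\<^sub>C g) y) + cmod ((f - c *\<^sub>C g) z) = cmod ((f + c *\<^sub>C g) y + (f - c *\<^sub>C g) z)"
        by (subst y(3), subst z(3)) (simp flip: of_real_add)
      also have "\<dots> = cmod (f (y + z + c *\<^sub>C \<Phi> (y - z)))" by (simp only: eq)
      also have "\<dots> \<le> ?N f * (2 + \<eta> * t)"
        using t(2)[OF y(1) z(1) y(2) z(2)] yz y z
        by (intro functional_bound'[OF fd]) (auto simp: c_def mem \<Phi>(1))
      finally show "?N (f + c *\<^sub>C g) + ?N (f - c *\<^sub>C g) \<le> ?N f * (2 + \<eta> * t) + e"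
        using y(4) z(4) by linarith
    qed
    have cu: "c *\<^sub>C u \<in> annihilator A J" "c *\<^sub>C v \<in> V" "- (c *\<^sub>C v) \<in> V"
      using uv V(1) annihilator_subspace by (auto simp: complex_vec.subspace_scale complex_vec.subspace_neg)
    have cud: "c *\<^sub>C u \<in> carr (dual_space A)" "c *\<^sub>C v \<in> carr (dual_space A)" using ud vd by (auto simp: dualsp.mem)
    have nv: "?N (c *\<^sub>C v) = t * ?N v" using t(1) dualsp.norm_scale[OF vd, of c] by (simp add: c_def)
    have "?N (f + c *\<^sub>C g) = ?N ((f + c *\<^sub>C u) + c *\<^sub>C v)" by (simp add: uv(3) scaleC_add_right add.assoc)
    also have "\<dots> = ?N (f + c *\<^sub>C u) + t * ?N v"
      using V(5)[OF complex_vec.subspace_add[OF annihilator_subspace f(1) cu(1)] cu(2)] nv by simp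
    finally have 1: "?N (f + c *\<^sub>C g) = ?N (f + c *\<^sub>C u) + t * ?N v" .
    have "?N (f - c *\<^sub>C g) = ?N ((f - c *\<^sub>C u) + - (c *\<^sub>C v))" by (simp add: uv(3) scaleC_add_right algebra_simps)
    also have "\<dots> = ?N (f - c *\<^sub>C u) + t * ?N v"
      using V(5)[OF complex_vec.subspace_diff[OF annihilator_subspace f(1) cu(1)] cu(3)] nv dualsp.norm_neg[OF cud(2)] by simp
    finally have 2: "?N (f - c *\<^sub>C g) = ?N (f - c *\<^sub>C u) + t * ?N v" .
    \<comment> \<open>The parts of f + t g and f - t g inside the annihilator still average to
      \<open>f\<close>, so their norms together are at least twice that of \<open>f\<close>. What
      remains of the upper bound has to pay for the two \<open>V\<close>-parts.\<close>
    have "2 * ?N f = ?N ((f + c *\<^sub>C u) + (f - c *\<^sub>C u))"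
    proof -
      have "(f + c *\<^sub>C u) + (f - c *\<^sub>C u) = 2 *\<^sub>C f"
        by (simp add: scaleC_fun_def scaleC_complex_def fun_eq_iff)
      then show ?thesis using dualsp.norm_scale[OF fd, of 2] by simp
    qed
    also have "\<dots> \<le> ?N (f + c *\<^sub>C u) + ?N (f - c *\<^sub>C u)"
      using fd cud by (intro dualsp.norm_triangle dualsp.mem_add dualsp.mem_diff)
    finally have "2 * (t * ?N v) \<le> ?N f * (\<eta> * t)"
      using upper 1 2 by (simp add: algebra_simps)
    then have "t * (2 * ?N v) \<le> t * (?N f * \<eta>)" by (simp add: ac_simps)
    then show ?thesis using t(1) by (simp add: ac_simps)
  qed
  note small = this
  have "?N v \<le> 0"
  proof (rule field_le_epsilon)
    fix e :: real assume e: "e > 0"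
    have "e / (?N f + 1) > 0" using e dualsp.norm_ge0[OF fd] by simp
    from small[OF this] have "?N v \<le> (?N f / (?N f + 1)) * e / 2" by (simp add: ac_simps)
    also have "\<dots> \<le> 1 * e / 2"
      using e dualsp.norm_ge0[OF fd] by (intro divide_right_mono mult_right_mono) auto
    finally show "?N v \<le> 0 + e" using e by simp
  qed
  then have "v = 0" using dualsp.norm_ge0[OF vd] by (intro dualsp.norm_zero_imp[OF vd]) simp
  then have "g x = 0" using uv x by (simp add: annihilator_def)
  then show False using f(2) xA by (simp add: g_def)
qed

text \<open>A functional on pairs that separates \<open>(y + j, y - j)\<close> from the diagonal of \<open>J\<close> has two components whose
  sum annihilates \<open>J\<close>, so that their \<open>V\<close>-parts cancel each other.\<close>

lemma M_ideal_two_ball: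
  assumes M: "M_ideal A J" and j: "j \<in> J" "nrm A j \<le> 1" and y: "y \<in> carr A" "nrm A y \<le> 1" and e: "e > 0"
  obtains k where "k \<in> J" "nrm A (y + k + j) \<le> 1 + e" "nrm A (y + k - j) \<le> 1 + e"
proof (rule ccontr)
  assume "\<not> thesis"
  then have no: "\<And>k. k \<in> J \<Longrightarrow> 1 + e < max (nrm A (y + k + j)) (nrm A (y + k - j))"
    using that by (meson max.strict_coboundedI1 max.strict_coboundedI2 not_less less_max_iff_disj)
  note J = M_idealD[OF M]
  have jA: "j \<in> carr A" using j J(1) by auto
  obtain V where V: "csubspace V" "V \<subseteq> carr (dual_space A)" "annihilator A J \<inter> V = {0}"
    "\<And>f. f \<in> carr (dual_space A) \<Longrightarrow> \<exists>u\<in>annihilator A J. \<exists>v\<in>V. f = u + v"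
    "\<And>u v. u \<in> annihilator A J \<Longrightarrow> v \<in> V \<Longrightarrow>
      nrm (dual_space A) (u + v) = nrm (dual_space A) u + nrm (dual_space A) v"
    using M_ideal_decomposition[OF M] by blast
  let ?N = "nrm (dual_space A)"
  \<comment> \<open>Pairs are encoded as functions on \<open>bool\<close>, so that the pointwise
    operations make them a complex vector space. \<open>D\<close> is the diagonal copy of
    \<open>J\<close>.\<close>
  define C where "C = {h :: bool \<Rightarrow> 'a. \<forall>b. h b \<in> carr A}"
  define D where "D = {(\<lambda>b::bool. k) | k. k \<in> J}"
  \<comment> \<open>Division by \<open>1 + e\<close> turns the assumed failure of the two-ball
    property into distance at least one between \<open>w\<close> and \<open>D\<close>.\<close>
  define p where "p h = max (nrm A (h True)) (nrm A (h False)) / (1 + e)" for h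
  define w where "w b = (if b then y + j else y - j)" for b
  obtain F where F:
    "\<And>g h. g \<in> C \<Longrightarrow> h \<in> C \<Longrightarrow> F (g + h) = F g + F h"
    "\<And>c h. h \<in> C \<Longrightarrow> F (c *\<^sub>C h) = c * F h"
    "\<And>h. h \<in> C \<Longrightarrow> cmod (F h) \<le> p h"
    "\<And>d. d \<in> D \<Longrightarrow> F d = 0"
    "1 \<le> Re (F w)"
    "\<And>h. h \<notin> C \<Longrightarrow> F h = 0"
  proof (rule hahn_banach[of C D p w])
    show "csubspace C" by (rule complex_vec.subspaceI) (auto simp: C_def mem scaleC_fun_def)
    show "csubspace D"
    proof (rule complex_vec.subspaceI)
      show "0 \<in> D" using complex_vec.subspace_0[OF J(2)] by (auto simp: D_def zero_fun_def)
      show "a + b \<in> D" if "a \<in> D" "b \<in> D" for a b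
        using that complex_vec.subspace_add[OF J(2)] by (auto simp: D_def plus_fun_def)
      show "c *\<^sub>C a \<in> D" if "a \<in> D" for c a
        using that complex_vec.subspace_scale[OF J(2)] by (auto simp: D_def scaleC_fun_def)
    qed
    show "D \<subseteq> C" using J(1) by (auto simp: C_def D_def)
    show "p (g + h) \<le> p g + p h" if "g \<in> C" "h \<in> C" for g h
    proof -
      have "nrm A (g b + h b) \<le> nrm A (g b) + nrm A (h b)" for b
        using that by (intro norm_triangle) (auto simp: C_def)
      from this[of True] this[of False]
      have "max (nrm A ((g + h) True)) (nrm A ((g + h) False))
        \<le> max (nrm A (g True)) (nrm A (g False)) + max (nrm A (h True)) (nrm A (h False))"
        by (simp add: max_def)
      then show ?thesis
        using e by (simp add: p_def divide_right_mono flip: add_divide_distrib)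
    qed
    show "p (c *\<^sub>C h) = cmod c * p h" if "h \<in> C" for c h
      using that e by (simp add: p_def C_def scaleC_fun_def norm_scale max_mult_distrib_left)
    show "w \<in> C" using y jA by (auto simp: C_def w_def mem)
    show "1 \<le> p (w + d)" if d: "d \<in> D" for d
    proof -
      obtain k where k: "k \<in> J" "d = (\<lambda>b. k)" using d by (auto simp: D_def)
      have "(w + d) True = y + k + j" "(w + d) False = y + k - j" by (simp_all add: w_def k algebra_simps)
      then have "1 + e < max (nrm A ((w + d) True)) (nrm A ((w + d) False))"
        using no[OF k(1)] by (simp only:)
      then show ?thesis using e by (simp add: p_def)
    qed
  qed blast
  define g where "g b x = (if x \<in> carr A then F (\<lambda>b'. if b' = b then x else 0) else 0)" for b x
  have inC: "(\<lambda>b'. if b' = b then x else 0) \<in> C" if "x \<in> carr A" for b and x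
    using that by (auto simp: C_def mem)
  have split: "F h = g True (h True) + g False (h False)" if h: "h \<in> C" for h
  proof -
    have "h = (\<lambda>b'. if b' = True then h True else 0) + (\<lambda>b'. if b' = False then h False else 0)"
      by (auto simp: fun_eq_iff)
    then have "F h = F (\<lambda>b'. if b' = True then h True else 0) + F (\<lambda>b'. if b' = False then h False else 0)"
      using F(1)[OF inC inC, of "h True" "h False" True False] h by (simp add: C_def)
    then show ?thesis using h by (simp add: g_def C_def)
  qed
  have gd: "g b \<in> carr (dual_space A)" for b
  proof (rule functionalI[where K = "1 / (1 + e)"])
    show "g b (x + z) = g b x + g b z" if "x \<in> carr A" "z \<in> carr A" for x z
    proof -
      have "(\<lambda>b'. if b' = b then x + z else 0) = (\<lambda>b'. if b' = b then x else 0) + (\<lambda>b'. if b' = b then z else 0)"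
        by (auto simp: fun_eq_iff)
      then show ?thesis using F(1)[OF inC[OF that(1)] inC[OF that(2)]] that by (simp add: g_def mem)
    qed
    show "g b (c *\<^sub>C x) = c * g b x" if "x \<in> carr A" for c x
    proof -
      have "(\<lambda>b'. if b' = b then c *\<^sub>C x else 0) = c *\<^sub>C (\<lambda>b'. if b' = b then x else 0)"
        by (auto simp: fun_eq_iff scaleC_fun_def)
      then show ?thesis using F(2)[OF inC[OF that]] that by (simp add: g_def mem)
    qed
    show "cmod (g b x) \<le> 1 / (1 + e) * nrm A x" if "x \<in> carr A" for x
      using F(3)[OF inC[OF that, of b]] that norm_ge0[OF that]
      by (cases b) (auto simp: g_def p_def norm_zero)
  qed (simp add: g_def)
  \<comment> \<open>The dual of a maximum norm is the sum of the dual norms of the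
    components.\<close>
  have norms: "?N (g True) + ?N (g False) \<le> 1 / (1 + e)"
  proof (rule field_le_epsilon)
    fix d :: real assume d: "d > 0"
    obtain x where x: "x \<in> carr A" "nrm A x \<le> 1" "g True x = complex_of_real (cmod (g True x))"
      "?N (g True) - d/2 < cmod (g True x)" using functional_norming[OF gd, of "d/2" True] d by auto
    obtain z where z: "z \<in> carr A" "nrm A z \<le> 1" "g False z = complex_of_real (cmod (g False z))"
      "?N (g False) - d/2 < cmod (g False z)" using functional_norming[OF gd, of "d/2" False] d by auto
    define h where "h b = (if b then x else z)" for b
    have h: "h \<in> C" using x z by (auto simp: h_def C_def)
    have "cmod (g True x) + cmod (g False z) = cmod (g True x + g False z)"
      by (subst x(3), subst z(3)) (simp flip: of_real_add)
    also have "\<dots> = cmod (F h)" using split[OF h] by (simp add: h_def)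
    also have "\<dots> \<le> p h" by (rule F(3)[OF h])
    also have "\<dots> \<le> 1 / (1 + e)" using x z e by (simp add: p_def h_def divide_right_mono)
    finally show "?N (g True) + ?N (g False) \<le> 1 / (1 + e) + d" using x(4) z(4) by linarith
  qed
  obtain u v where uv: "\<And>b. u b \<in> annihilator A J" "\<And>b. v b \<in> V" "\<And>b. g b = u b + v b"
    using V(4)[OF gd] by metis
  have ud: "u b \<in> carr (dual_space A)" and vd: "v b \<in> carr (dual_space A)" for b
    using uv V(2) by (auto simp: annihilator_def)
  have "g True + g False \<in> annihilator A J"
  proof -
    have "(g True + g False) k = 0" if "k \<in> J" for k
    proof -
      have "(\<lambda>b. k) \<in> D" "(\<lambda>b. k) \<in> C" using that J(1) by (auto simp: D_def C_def)
      then show ?thesis using split[of "\<lambda>b. k"] F(4) by simp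
    qed
    then show ?thesis using gd by (auto simp: annihilator_def dualsp.mem)
  qed
  then have "(g True + g False) - (u True + u False) \<in> annihilator A J"
    by (rule complex_vec.subspace_diff[OF annihilator_subspace _
          complex_vec.subspace_add[OF annihilator_subspace uv(1) uv(1)]])
  moreover have vv: "(g True + g False) - (u True + u False) = v True + v False"
    by (simp add: uv(3))
  moreover have "v True + v False \<in> V" using uv(2) V(1) by (intro complex_vec.subspace_add)
  ultimately have "v True + v False = 0" using V(3) by auto
  then have v0: "v True y + v False y = 0" by (simp add: fun_eq_iff)
  have uj: "u b j = 0" for b using uv(1)[of b] j by (auto simp: annihilator_def)
  have wC: "w \<in> C" using y jA by (auto simp: C_def w_def mem)
  \<comment> \<open>At \<open>y\<close> the \<open>V\<close>-parts cancel, at \<open>j\<close> the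
    annihilator parts vanish. Each remaining part is evaluated at a single vector of the unit ball,
    and additivity of the norms reassembles the parts to the norms of \<open>g True\<close> and
    \<open>g False\<close>, whose sum is less than one.\<close>
  have "F w = g True (y + j) + g False (y - j)" using split[OF wC] by (simp add: w_def)
  also have "\<dots> = (u True y + u False y) + (v True j - v False j)"
    using v0 uj y jA
    by (simp add: uv(3) functional_add[OF ud] functional_add[OF vd] functional_diff[OF ud] functional_diff[OF vd] algebra_simps)
  finally have Fw: "F w = (u True y + u False y) + (v True j - v False j)" .
  have "1 \<le> cmod (F w)" using F(5) complex_Re_le_cmod[of "F w"] by linarith
  also have "\<dots> \<le> cmod (u True y) + cmod (u False y) + (cmod (v True j) + cmod (v False j))"
    unfolding Fw by (intro order_trans[OF norm_triangle_ineq] add_mono norm_triangle_ineq norm_triangle_ineq4)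
  also have "\<dots> \<le> (?N (u True) + ?N (v True)) + (?N (u False) + ?N (v False))"
    using functional_bound'[OF ud[of True] y] functional_bound'[OF ud[of False] y]
      functional_bound'[OF vd[of True] jA j(2)] functional_bound'[OF vd[of False] jA j(2)] by simp
  also have "\<dots> = ?N (g True) + ?N (g False)"
    using V(5)[OF uv(1,2)] by (simp add: uv(3))
  also have "\<dots> \<le> 1 / (1 + e)" by (rule norms)
  also have "\<dots> < 1" using e by simp
  finally show False by simp
qed

end

section \<open>Smoothness and norming pairings of sequence spaces\<close>


locale lp_sum_space =
  fixes p :: real and E :: "nat \<Rightarrow> 'a::complex_vec cnspace"
  assumes p: "1 < p" and E: "\<And>n. cnormed (E n)"
begin

abbreviation "X \<equiv> lp_sum p E"

lemma carr_iff: "x \<in> carr X \<longleftrightarrow> (\<forall>n. x n \<in> carr (E n)) \<and> summable (\<lambda>n. nrm (E n) (x n) powr p)"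
  by (simp add: lp_sum_def)

lemma nrm_eq: "nrm X x = (\<Sum>n. nrm (E n) (x n) powr p) powr (1 / p)"
  by (simp add: lp_sum_def)

lemma comp_mem: "x \<in> carr X \<Longrightarrow> x n \<in> carr (E n)"
  by (simp add: carr_iff)

lemma comp_ge0: "x \<in> carr X \<Longrightarrow> 0 \<le> nrm (E n) (x n)"
  using cnormed.norm_ge0[OF E comp_mem] .

lemma summable_comp: "x \<in> carr X \<Longrightarrow> summable (\<lambda>n. nrm (E n) (x n) powr p)"
  by (simp add: carr_iff)

lemma nrm_ge0: "0 \<le> nrm X x"
  by (simp add: nrm_eq)

lemma nrm_powr: "x \<in> carr X \<Longrightarrow> nrm X x powr p = (\<Sum>n. nrm (E n) (x n) powr p)"
  using p by (simp add: nrm_eq powr_powr suminf_nonneg carr_iff)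

lemma sum_le_nrm_powr:
  assumes "x \<in> carr X" "finite F"
  shows "(\<Sum>n\<in>F. nrm (E n) (x n) powr p) \<le> nrm X x powr p"
  unfolding nrm_powr[OF assms(1)] by (rule sum_le_suminf[OF summable_comp[OF assms(1)] assms(2)]) simp

lemma sum_root_le_nrm:
  assumes "x \<in> carr X" "finite F"
  shows "(\<Sum>n\<in>F. nrm (E n) (x n) powr p) powr (1/p) \<le> nrm X x"
proof -
  have "(\<Sum>n\<in>F. nrm (E n) (x n) powr p) powr (1/p) \<le> (nrm X x powr p) powr (1/p)"
    using sum_le_nrm_powr[OF assms] p by (intro powr_mono2) (auto simp: sum_nonneg)
  then show ?thesis using p nrm_ge0 by (simp add: powr_powr)
qed

lemma comp_le_nrm: "x \<in> carr X \<Longrightarrow> nrm (E n) (x n) \<le> nrm X x"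
  using sum_root_le_nrm[of x "{n}"] p comp_ge0[of x n] by (simp add: powr_powr)

lemma memI:
  assumes "\<And>n. x n \<in> carr (E n)" "0 \<le> K" "\<And>N. (\<Sum>n<N. nrm (E n) (x n) powr p) \<le> K powr p"
  shows "x \<in> carr X" "nrm X x \<le> K"
proof -
  have s: "summable (\<lambda>n. nrm (E n) (x n) powr p)"
    by (rule summableI_nonneg_bounded[OF _ assms(3)]) simp
  then show "x \<in> carr X" using assms by (simp add: carr_iff)
  have "(\<Sum>n. nrm (E n) (x n) powr p) \<le> K powr p" by (rule suminf_le_const[OF s assms(3)])
  then have "nrm X x \<le> (K powr p) powr (1/p)"
    unfolding nrm_eq using p s by (intro powr_mono2) (auto simp: suminf_nonneg)
  then show "nrm X x \<le> K" using p assms(2) by (simp add: powr_powr)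
qed

lemma mem_mono:
  assumes x: "x \<in> carr X" and y: "\<And>n. y n \<in> carr (E n)" and le: "\<And>n. nrm (E n) (y n) \<le> nrm (E n) (x n)"
  shows "y \<in> carr X" "nrm X y \<le> nrm X x"
proof -
  have "(\<Sum>n<N. nrm (E n) (y n) powr p) \<le> nrm X x powr p" for N
  proof -
    have "(\<Sum>n<N. nrm (E n) (y n) powr p) \<le> (\<Sum>n<N. nrm (E n) (x n) powr p)"
      using le p cnormed.norm_ge0[OF E y] by (intro sum_mono powr_mono2) auto
    then show ?thesis using sum_le_nrm_powr[OF x, of "{..<N}"] by simp
  qed
  from memI[OF y nrm_ge0 this] show "y \<in> carr X" "nrm X y \<le> nrm X x" by auto
qed

lemma mem_add_triangle:
  assumes x: "x \<in> carr X" and y: "y \<in> carr X"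
  shows "x + y \<in> carr X" "nrm X (x + y) \<le> nrm X x + nrm X y"
proof -
  have mem: "(x + y) n \<in> carr (E n)" for n
    using comp_mem[OF x, of n] comp_mem[OF y, of n] by (simp add: cnormed.mem_add[OF E])
  have le: "(\<Sum>n<N. nrm (E n) ((x + y) n) powr p) \<le> (nrm X x + nrm X y) powr p" for N
  proof -
    have "(\<Sum>n<N. nrm (E n) ((x + y) n) powr p) \<le> (\<Sum>n<N. (nrm (E n) (x n) + nrm (E n) (y n)) powr p)"
      using p cnormed.norm_triangle[OF E comp_mem[OF x] comp_mem[OF y]] cnormed.norm_ge0[OF E mem]
      by (intro sum_mono powr_mono2) auto
    also have "\<dots> \<le> ((\<Sum>n<N. nrm (E n) (x n) powr p) powr (1/p) + (\<Sum>n<N. nrm (E n) (y n) powr p) powr (1/p)) powr p"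
      using p comp_ge0[OF x] comp_ge0[OF y] by (intro minkowski_sum) auto
    also have "\<dots> \<le> (nrm X x + nrm X y) powr p"
      using p sum_root_le_nrm[OF x, of "{..<N}"] sum_root_le_nrm[OF y, of "{..<N}"]
      by (intro powr_mono2 add_mono) auto
    finally show ?thesis .
  qed
  show "x + y \<in> carr X" "nrm X (x + y) \<le> nrm X x + nrm X y"
    by (rule memI[OF mem _ le], simp add: nrm_ge0)+
qed

lemma mem_scale_norm:
  assumes x: "x \<in> carr X"
  shows "c *\<^sub>C x \<in> carr X" "nrm X (c *\<^sub>C x) = cmod c * nrm X x"
proof -
  have eq: "nrm (E n) ((c *\<^sub>C x) n) powr p = cmod c powr p * nrm (E n) (x n) powr p" for n
    using cnormed.norm_scale[OF E comp_mem[OF x], of n c] comp_ge0[OF x, of n]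
    by (simp add: scaleC_fun_def powr_mult)
  show *: "c *\<^sub>C x \<in> carr X"
    using x by (simp add: carr_iff eq summable_mult) (simp add: scaleC_fun_def cnormed.mem_scale[OF E])
  have "nrm X (c *\<^sub>C x) = (cmod c powr p * (\<Sum>n. nrm (E n) (x n) powr p)) powr (1/p)"
    unfolding nrm_eq eq using suminf_mult[OF summable_comp[OF x]] by simp
  also have "\<dots> = cmod c * nrm X x"
    using p suminf_nonneg[OF summable_comp[OF x]] by (simp add: nrm_eq powr_mult powr_powr)
  finally show "nrm X (c *\<^sub>C x) = cmod c * nrm X x" .
qed

lemma cnormed_X: "cnormed X"
proof
  have "0 \<in> carr X"
    using p by (simp add: carr_iff cnormed.mem_zero[OF E] cnormed.norm_zero[OF E])
  then show "csubspace (carr X)"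
    by (intro complex_vec.subspaceI mem_add_triangle mem_scale_norm)
  show "x = 0" if x: "x \<in> carr X" and 0: "nrm X x = 0" for x
  proof -
    have "x n = 0" for n
      using comp_le_nrm[OF x, of n] comp_ge0[OF x, of n] 0 by (intro cnormed.norm_zero_imp[OF E comp_mem[OF x]]) simp
    then show ?thesis by (simp add: fun_eq_iff)
  qed
qed (auto simp: nrm_ge0 mem_add_triangle mem_scale_norm)

end

text \<open>Uniform smoothness of power type r in two-point form. The averaging exponent s is kept
  as a parameter because the estimate passes to an l_p-sum when s is the exponent of that
  sum.\<close>

definition smooth_space :: "'a::complex_vec cnspace \<Rightarrow> real \<Rightarrow> real \<Rightarrow> real \<Rightarrow> bool"
  where "smooth_space A s r C \<longleftrightarrow> (\<forall>x\<in>carr A. \<forall>y\<in>carr A.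
    (nrm A (x + y) powr s + nrm A (x - y) powr s) / 2 \<le> (nrm A x powr r + C * nrm A y powr r) powr (s/r))"

text \<open>The triangle inequality bounds the difference of the norms of x + y and x - y by twice
  the norm of y, which reduces the claim to a statement about numbers.\<close>

lemma smooth_space_exponent:
  assumes A: "cnormed A" and st: "s > 1" "t > 1" "r > 1" and C: "C \<ge> 0"
    and D: "D \<ge> 0" "\<And>a b::complex. (cmod (a + b) powr t + cmod (a - b) powr t) / 2
           \<le> (cmod a powr r + D * cmod b powr r) powr (t/r)"
    and sm: "smooth_space A s r C"
  shows "smooth_space A t r (C + D)"
  unfolding smooth_space_def
proof (intro ballI)
  interpret cnormed A by (rule A)
  fix x y assume x: "x \<in> carr A" and y: "y \<in> carr A"
  have xy: "x + y \<in> carr A" "x - y \<in> carr A" using x y by (auto simp: mem)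
  have d: "x + y - (x - y) = 2 *\<^sub>C y"
    using scaleC_add_left[of 1 1 y] by (simp add: scaleC_one)
  have "nrm A (2 *\<^sub>C y) = 2 * nrm A y" using norm_scale[OF y, of 2] by simp
  then have "\<bar>nrm A (x + y) - nrm A (x - y)\<bar> \<le> 2 * nrm A y"
    using norm_le_diff[OF xy] norm_le_diff[OF xy(2,1)] norm_minus_commute[OF xy] unfolding d by simp
  then show "(nrm A (x + y) powr t + nrm A (x - y) powr t) / 2 \<le> (nrm A x powr r + (C + D) * nrm A y powr r) powr (t / r)"
    using sm x y xy by (intro smooth_exponent_change[OF st C D]) (auto simp: smooth_space_def norm_ge0)
qed

lemma (in lp_sum_space) smooth_lp_sum:
  assumes r: "0 < r" "r \<le> p" and C: "C \<ge> 0" and sm: "\<And>n. smooth_space (E n) p r C"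
  shows "smooth_space X p r C"
  unfolding smooth_space_def
proof (intro ballI)
  interpret X: cnormed X by (rule cnormed_X)
  fix x y assume x: "x \<in> carr X" and y: "y \<in> carr X"
  let ?a = "\<lambda>n. nrm (E n) ((x + y) n) powr p" and ?b = "\<lambda>n. nrm (E n) ((x - y) n) powr p"
  let ?R = "(nrm X x powr r + C * nrm X y powr r) powr (p / r)"
  have s: "summable ?a" "summable ?b"
    by (rule summable_comp[OF X.mem_add[OF x y]], rule summable_comp[OF X.mem_diff[OF x y]])
  then have s2: "summable (\<lambda>n. (?a n + ?b n) / 2)" by (intro summable_divide summable_add)
  have "(\<Sum>n<N. (?a n + ?b n) / 2) \<le> ?R" for N
  proof -
    have "(\<Sum>n<N. (?a n + ?b n) / 2) \<le> (((\<Sum>n<N. nrm (E n) (x n) powr p) powr (1/p)) powr r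
        + C * ((\<Sum>n<N. nrm (E n) (y n) powr p) powr (1/p)) powr r) powr (p/r)"
      using sm comp_mem[OF x] comp_mem[OF y] comp_ge0[OF x] comp_ge0[OF y]
      by (intro smooth_sum[OF r C]) (auto simp: smooth_space_def)
    also have "\<dots> \<le> ?R"
      using r C p sum_root_le_nrm[OF x, of "{..<N}"] sum_root_le_nrm[OF y, of "{..<N}"]
      by (intro powr_mono2 add_mono mult_left_mono) auto
    finally show ?thesis .
  qed
  then have "(\<Sum>n. (?a n + ?b n) / 2) \<le> ?R" by (rule suminf_le_const[OF s2])
  then show "(nrm X (x + y) powr p + nrm X (x - y) powr p) / 2 \<le> ?R"
    using s x y by (simp add: nrm_powr X.mem suminf_divide suminf_add summable_add)
qed

text \<open>Since r > 1, the error \<open>C * t powr r\<close> is of smaller order than t; this is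
  uniform smoothness in the form used for operators.\<close>

lemma smooth_space_sum_le:
  assumes A: "cnormed A" and s: "s > 1" and r: "r > 1" and C: "C \<ge> 0" and sm: "smooth_space A s r C" and \<eta>: "\<eta> > 0"
  obtains t where "t > 0" "\<And>x y. x \<in> carr A \<Longrightarrow> y \<in> carr A \<Longrightarrow> nrm A x \<le> 1 \<Longrightarrow> nrm A y \<le> 1 \<Longrightarrow>
    nrm A (x + complex_of_real t *\<^sub>C y) + nrm A (x - complex_of_real t *\<^sub>C y) \<le> 2 + \<eta> * t"
proof -
  interpret cnormed A by (rule A)
  \<comment> \<open>Chosen so that \<open>C * t powr r\<close> is at most
    \<open>\<eta> * t / 2\<close>. The summand 1 keeps the denominator positive when
    \<open>C\<close> is zero.\<close>
  define t where "t = (\<eta> / (2 * C + 1)) powr (1 / (r - 1))"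
  have t: "t > 0" using \<eta> C by (simp add: t_def)
  have "t powr (r - 1) = \<eta> / (2 * C + 1)" using r \<eta> C by (simp add: t_def powr_powr)
  then have tr: "t powr r = t * (\<eta> / (2 * C + 1))"
    using t powr_add[of t 1 "r - 1"] by simp
  have "nrm A (x + complex_of_real t *\<^sub>C y) + nrm A (x - complex_of_real t *\<^sub>C y) \<le> 2 + \<eta> * t"
    if x: "x \<in> carr A" "nrm A x \<le> 1" and y: "y \<in> carr A" "nrm A y \<le> 1" for x y
  proof -
    define z where "z = complex_of_real t *\<^sub>C y"
    have z: "z \<in> carr A" using y by (simp add: z_def mem)
    have "nrm A z = t * nrm A y" using norm_scale[OF y(1), of "complex_of_real t"] t by (simp add: z_def)
    then have nz: "nrm A z \<le> t" "0 \<le> nrm A z" using y t norm_ge0[OF z] by auto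
    have nn: "0 \<le> nrm A (x + z)" "0 \<le> nrm A (x - z)" using x z by (auto intro!: norm_ge0 mem)
    have "(nrm A (x + z) + nrm A (x - z)) / 2 \<le> ((nrm A (x + z) powr s + nrm A (x - z) powr s) / 2) powr (1/s)"
      using power_mean_two[of 1 s "nrm A (x + z)" "nrm A (x - z)"] s nn by simp
    also have "\<dots> \<le> ((nrm A x powr r + C * nrm A z powr r) powr (s/r)) powr (1/s)"
      using sm x z s by (intro powr_mono2) (auto simp: smooth_space_def)
    also have "\<dots> = (nrm A x powr r + C * nrm A z powr r) powr (1/r)" using s by (simp add: powr_powr)
    also have "\<dots> \<le> (1 powr r + C * t powr r) powr (1/r)"
      using r C x nz t norm_ge0[OF x(1)] by (intro powr_mono2 add_mono mult_left_mono) auto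
    also have "\<dots> \<le> (1 powr r + C * t powr r) powr 1"
      using r C t by (intro powr_mono) auto
    also have "\<dots> = 1 + C * t powr r" using C by simp
    also have "\<dots> \<le> 1 + \<eta> * t / 2"
    proof -
      have "2 * C * t * \<eta> \<le> (2 * C + 1) * t * \<eta>" using t \<eta> by (intro mult_right_mono) auto
      then show ?thesis using C by (simp add: tr field_simps)
    qed
    finally show ?thesis by (simp add: z_def)
  qed
  with t that show ?thesis by blast
qed

text \<open>A substitute for the dual space: all that duality requires is a contractive bilinear
  form for which the unit ball of \<open>A'\<close> attains the norm of every vector of
  \<open>A\<close>. No description of the full dual is involved.\<close>

definition norming_pairing :: "'b::complex_vec cnspace \<Rightarrow> 'a::complex_vec cnspace \<Rightarrow> ('b \<Rightarrow> 'a \<Rightarrow> complex) \<Rightarrow> bool"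
  where "norming_pairing A' A B \<longleftrightarrow>
    (\<forall>y\<in>carr A'. \<forall>z\<in>carr A'. \<forall>x\<in>carr A. B (y + z) x = B y x + B z x) \<and>
    (\<forall>y\<in>carr A'. \<forall>x\<in>carr A. \<forall>w\<in>carr A. B y (x + w) = B y x + B y w) \<and>
    (\<forall>c. \<forall>y\<in>carr A'. \<forall>x\<in>carr A. B (c *\<^sub>C y) x = c * B y x) \<and>
    (\<forall>c. \<forall>y\<in>carr A'. \<forall>x\<in>carr A. B y (c *\<^sub>C x) = c * B y x) \<and>
    (\<forall>y\<in>carr A'. \<forall>x\<in>carr A. cmod (B y x) \<le> nrm A' y * nrm A x) \<and>
    (\<forall>x\<in>carr A. \<exists>y\<in>carr A'. nrm A' y \<le> 1 \<and> B y x = complex_of_real (nrm A x))"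

lemma norming_pairingD:
  assumes "norming_pairing A' A B"
  shows "y \<in> carr A' \<Longrightarrow> z \<in> carr A' \<Longrightarrow> x \<in> carr A \<Longrightarrow> B (y + z) x = B y x + B z x"
    "y \<in> carr A' \<Longrightarrow> x \<in> carr A \<Longrightarrow> w \<in> carr A \<Longrightarrow> B y (x + w) = B y x + B y w"
    "y \<in> carr A' \<Longrightarrow> x \<in> carr A \<Longrightarrow> B (c *\<^sub>C y) x = c * B y x"
    "y \<in> carr A' \<Longrightarrow> x \<in> carr A \<Longrightarrow> B y (c *\<^sub>C x) = c * B y x"
    "y \<in> carr A' \<Longrightarrow> x \<in> carr A \<Longrightarrow> cmod (B y x) \<le> nrm A' y * nrm A x"
    "x \<in> carr A \<Longrightarrow> \<exists>y\<in>carr A'. nrm A' y \<le> 1 \<and> B y x = complex_of_real (nrm A x)"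
  using assms unfolding norming_pairing_def by auto

text \<open>The classical duality of smoothness and convexity. If y and z norm u + v and u - v, the
  left side equals the pairing of y + t z with u plus that of y - t z with v, and smoothness bounds
  the two norms.\<close>

lemma convex_of_smooth_pairing:
  assumes A: "cnormed A" and A': "cnormed A'" and B: "norming_pairing A' A B"
    and t: "\<And>y z. y \<in> carr A' \<Longrightarrow> z \<in> carr A' \<Longrightarrow> nrm A' y \<le> 1 \<Longrightarrow> nrm A' z \<le> 1 \<Longrightarrow>
      nrm A' (y + complex_of_real t *\<^sub>C z) + nrm A' (y - complex_of_real t *\<^sub>C z) \<le> K"
    and u: "u \<in> carr A" "nrm A u \<le> 1" and v: "v \<in> carr A" "nrm A v \<le> 1"
  shows "nrm A (u + v) + t * nrm A (u - v) \<le> K"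
proof -
  interpret A: cnormed A by (rule A)
  interpret A': cnormed A' by (rule A')
  note BD = norming_pairingD[OF B]
  have uv: "u + v \<in> carr A" "u - v \<in> carr A" using u v by (auto simp: A.mem)
  obtain y where y: "y \<in> carr A'" "nrm A' y \<le> 1" "B y (u + v) = complex_of_real (nrm A (u + v))"
    using BD(6)[OF uv(1)] by blast
  obtain z where z: "z \<in> carr A'" "nrm A' z \<le> 1" "B z (u - v) = complex_of_real (nrm A (u - v))"
    using BD(6)[OF uv(2)] by blast
  let ?c = "complex_of_real t"
  have cz: "?c *\<^sub>C z \<in> carr A'" "- (?c *\<^sub>C z) \<in> carr A'" using z by (auto simp: A'.mem)
  have Bd: "B z (u - v) = B z u - B z v"
    using BD(2)[OF z(1) u(1) A.mem_neg[OF v(1)]] BD(4)[OF z(1) v(1), of "-1"] by simp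
  have Bd2: "B (y - ?c *\<^sub>C z) v = B y v - ?c * B z v"
    using BD(1)[OF y(1) cz(2) v(1)] BD(3)[OF cz(1) v(1), of "-1"] BD(3)[OF z(1) v(1), of ?c] by simp
  have "complex_of_real (nrm A (u + v) + t * nrm A (u - v)) = B y (u + v) + ?c * B z (u - v)"
    using y z by simp
  also have "\<dots> = B (y + ?c *\<^sub>C z) u + B (y - ?c *\<^sub>C z) v"
    unfolding BD(1)[OF y(1) cz(1) u(1)] BD(2)[OF y(1) u(1) v(1)] BD(3)[OF z(1) u(1)] Bd Bd2
    by (simp add: algebra_simps)
  finally have eq: "complex_of_real (nrm A (u + v) + t * nrm A (u - v)) = B (y + ?c *\<^sub>C z) u + B (y - ?c *\<^sub>C z) v" .
  have m: "y + ?c *\<^sub>C z \<in> carr A'" "y - ?c *\<^sub>C z \<in> carr A'" using y cz by (auto simp: A'.mem)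
  have "nrm A (u + v) + t * nrm A (u - v) \<le> cmod (complex_of_real (nrm A (u + v) + t * nrm A (u - v)))"
    by (simp only: norm_of_real abs_ge_self)
  also have "\<dots> \<le> cmod (B (y + ?c *\<^sub>C z) u) + cmod (B (y - ?c *\<^sub>C z) v)"
    unfolding eq by (rule norm_triangle_ineq)
  also have "\<dots> \<le> nrm A' (y + ?c *\<^sub>C z) * nrm A u + nrm A' (y - ?c *\<^sub>C z) * nrm A v"
    using m u v by (intro add_mono BD(5))
  also have "\<dots> \<le> nrm A' (y + ?c *\<^sub>C z) * 1 + nrm A' (y - ?c *\<^sub>C z) * 1"
    using m u v by (intro add_mono mult_left_mono A'.norm_ge0)
  also have "\<dots> \<le> K" using t[OF y(1) z(1) y(2) z(2)] by simp
  finally show ?thesis .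
qed

text \<open>Hoelder's inequality gives convergence and contractivity; the norming vector scales
  norming vectors of the components by the extremal sequence for Hoelder's inequality.\<close>

lemma norming_pairing_lp_sum:
  assumes E: "lp_sum_space p E" and E': "lp_sum_space p' E'" and pp: "1/p' + 1/p = 1"
    and B: "\<And>n. norming_pairing (E' n) (E n) (B n)"
  shows "norming_pairing (lp_sum p' E') (lp_sum p E) (\<lambda>y x. \<Sum>n. B n (y n) (x n))"
proof -
  interpret X: lp_sum_space p E by (rule E)
  interpret Y: lp_sum_space p' E' by (rule E')
  note BD = norming_pairingD[OF B]
  have part: "(\<Sum>n<N. cmod (B n (y n) (x n))) \<le> nrm Y.X y * nrm X.X x" if y: "y \<in> carr Y.X" and x: "x \<in> carr X.X" for x y N
  proof -
    have "(\<Sum>n<N. cmod (B n (y n) (x n))) \<le> (\<Sum>n<N. nrm (E' n) (y n) * nrm (E n) (x n))"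
      using X.comp_mem[OF x] Y.comp_mem[OF y] by (intro sum_mono BD(5))
    also have "\<dots> \<le> (\<Sum>n<N. nrm (E' n) (y n) powr p') powr (1/p') * (\<Sum>n<N. nrm (E n) (x n) powr p) powr (1/p)"
      using X.comp_ge0[OF x] Y.comp_ge0[OF y] X.p Y.p pp by (intro holder_sum) auto
    also have "\<dots> \<le> nrm Y.X y * nrm X.X x"
      using X.sum_root_le_nrm[OF x] Y.sum_root_le_nrm[OF y] Y.nrm_ge0 by (intro mult_mono) auto
    finally show ?thesis .
  qed
  have sn: "summable (\<lambda>n. cmod (B n (y n) (x n)))" if "y \<in> carr Y.X" "x \<in> carr X.X" for x y
    by (rule summableI_nonneg_bounded[OF _ part[OF that]]) simp
  have s: "summable (\<lambda>n. B n (y n) (x n))" if "y \<in> carr Y.X" "x \<in> carr X.X" for x y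
    using sn[OF that] by (rule summable_norm_cancel)
  show ?thesis
    unfolding norming_pairing_def
  proof (intro conjI ballI allI)
    fix y z x assume y: "y \<in> carr Y.X" and z: "z \<in> carr Y.X" and x: "x \<in> carr X.X"
    show "(\<Sum>n. B n ((y + z) n) (x n)) = (\<Sum>n. B n (y n) (x n)) + (\<Sum>n. B n (z n) (x n))"
      using suminf_add[OF s[OF y x] s[OF z x]] BD(1)[OF Y.comp_mem[OF y] Y.comp_mem[OF z] X.comp_mem[OF x]] by simp
  next
    fix y x w assume y: "y \<in> carr Y.X" and x: "x \<in> carr X.X" and w: "w \<in> carr X.X"
    show "(\<Sum>n. B n (y n) ((x + w) n)) = (\<Sum>n. B n (y n) (x n)) + (\<Sum>n. B n (y n) (w n))"
      using suminf_add[OF s[OF y x] s[OF y w]] BD(2)[OF Y.comp_mem[OF y] X.comp_mem[OF x] X.comp_mem[OF w]] by simp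
  next
    fix c y x assume y: "y \<in> carr Y.X" and x: "x \<in> carr X.X"
    show "(\<Sum>n. B n ((c *\<^sub>C y) n) (x n)) = c * (\<Sum>n. B n (y n) (x n))"
      using suminf_mult[OF s[OF y x], of c] BD(3)[OF Y.comp_mem[OF y] X.comp_mem[OF x], of _ c] by (simp add: scaleC_fun_def)
    show "(\<Sum>n. B n (y n) ((c *\<^sub>C x) n)) = c * (\<Sum>n. B n (y n) (x n))"
      using suminf_mult[OF s[OF y x], of c] BD(4)[OF Y.comp_mem[OF y] X.comp_mem[OF x], of _ c] by (simp add: scaleC_fun_def)
  next
    fix y x assume y: "y \<in> carr Y.X" and x: "x \<in> carr X.X"
    have "cmod (\<Sum>n. B n (y n) (x n)) \<le> (\<Sum>n. cmod (B n (y n) (x n)))"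
      by (rule summable_norm[OF sn[OF y x]])
    also have "\<dots> \<le> nrm Y.X y * nrm X.X x" by (rule suminf_le_const[OF sn[OF y x] part[OF y x]])
    finally show "cmod (\<Sum>n. B n (y n) (x n)) \<le> nrm Y.X y * nrm X.X x" .
  next
    fix x assume x: "x \<in> carr X.X"
    define N where "N = nrm X.X x"
    have N0: "N \<ge> 0" by (simp add: N_def X.nrm_ge0)
    obtain z where z: "\<And>n. z n \<in> carr (E' n)" "\<And>n. nrm (E' n) (z n) \<le> 1"
      "\<And>n. B n (z n) (x n) = complex_of_real (nrm (E n) (x n))"
      using BD(6)[OF X.comp_mem[OF x]] by metis
    \<comment> \<open>The extremal weights: by (p - 1) p' = p their p'-th powers sum to one. If
      \<open>N\<close> is zero, division by zero makes all weights zero, and the zero vector is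
      norming.\<close>
    define a where "a n = nrm (E n) (x n) powr (p - 1) / N powr (p - 1)" for n
    have a0: "a n \<ge> 0" for n by (simp add: a_def)
    define y where "y n = complex_of_real (a n) *\<^sub>C z n" for n
    have e1: "(p - 1) * p' = p" using pp X.p Y.p by (simp add: field_simps)
    have ap: "a n powr p' = nrm (E n) (x n) powr p / N powr p" for n
      using N0 by (simp add: a_def powr_divide powr_powr e1)
    have yE: "y n \<in> carr (E' n)" for n by (simp add: y_def cnormed.mem_scale[OF Y.E z(1)])
    have ny: "nrm (E' n) (y n) \<le> a n" for n
      using cnormed.norm_scale[OF Y.E z(1), of n "complex_of_real (a n)"] z(2)[of n] a0[of n]
      by (simp add: y_def mult_left_le)
    have le: "(\<Sum>n<M. nrm (E' n) (y n) powr p') \<le> 1 powr p'" for M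
    proof -
      have "(\<Sum>n<M. nrm (E' n) (y n) powr p') \<le> (\<Sum>n<M. a n powr p')"
        using ny Y.p cnormed.norm_ge0[OF Y.E yE] by (intro sum_mono powr_mono2) auto
      also have "\<dots> = (\<Sum>n<M. nrm (E n) (x n) powr p) / N powr p"
        by (simp add: ap sum_divide_distrib)
      also have "\<dots> \<le> 1"
        using X.sum_le_nrm_powr[OF x, of "{..<M}"] by (auto simp: N_def divide_le_eq_1)
      finally show ?thesis by simp
    qed
    have y: "y \<in> carr Y.X" "nrm Y.X y \<le> 1" using Y.memI[OF yE _ le] by auto
    have "B n (y n) (x n) = complex_of_real (nrm (E n) (x n) powr p / N powr (p - 1))" for n
    proof -
      have "B n (y n) (x n) = complex_of_real (a n * nrm (E n) (x n))"
        using BD(3)[OF z(1) X.comp_mem[OF x], of n "complex_of_real (a n)"] by (simp add: y_def z(3))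
      also have "a n * nrm (E n) (x n) = nrm (E n) (x n) powr p / N powr (p - 1)"
        using X.comp_ge0[OF x, of n] powr_add[of "nrm (E n) (x n)" "p - 1" 1] by (simp add: a_def)
      finally show ?thesis .
    qed
    then have "(\<Sum>n. B n (y n) (x n)) = (\<Sum>n. complex_of_real (nrm (E n) (x n) powr p / N powr (p - 1)))" by simp
    also have "\<dots> = complex_of_real (\<Sum>n. nrm (E n) (x n) powr p / N powr (p - 1))"
      by (rule suminf_of_real[symmetric, OF summable_divide[OF X.summable_comp[OF x]]])
    also have "(\<Sum>n. nrm (E n) (x n) powr p / N powr (p - 1)) = N powr p / N powr (p - 1)"
      using suminf_divide[OF X.summable_comp[OF x]] X.nrm_powr[OF x] by (simp add: N_def)
    also have "\<dots> = N"
      using N0 powr_diff[of N p "p - 1"] by (cases "N = 0") auto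
    finally have "(\<Sum>n. B n (y n) (x n)) = complex_of_real (nrm X.X x)" by (simp add: N_def)
    then show "\<exists>y\<in>carr Y.X. nrm Y.X y \<le> 1 \<and> (\<Sum>n. B n (y n) (x n)) = complex_of_real (nrm X.X x)"
      using y by blast
  qed
qed


text \<open>The norm of \<open>lq_fin\<close> is a finite sum, that of the corresponding
  \<open>lp_sum\<close> a series; they agree on the carrier only. This lemma and the following ones
  transfer properties between such presentations.\<close>

lemma cnormed_cong:
  assumes "cnormed A'" "carr A = carr A'" "\<And>x. x \<in> carr A' \<Longrightarrow> nrm A x = nrm A' x"
  shows "cnormed A"
proof -
  interpret cnormed A' by (rule assms(1))
  show ?thesis
  proof
    show "csubspace (carr A)" by (simp add: assms(2) subspace)
  qed (auto simp: assms(2,3) mem norm_ge0 norm_triangle norm_scale intro: norm_zero_imp)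
qed

lemma smooth_space_cong:
  assumes "cnormed A'" "carr A = carr A'" "\<And>x. x \<in> carr A' \<Longrightarrow> nrm A x = nrm A' x" "smooth_space A' s r C"
  shows "smooth_space A s r C"
  using assms(4) unfolding smooth_space_def assms(2)
  by (simp add: assms(3) cnormed.mem_add[OF assms(1)] cnormed.mem_diff[OF assms(1)])

lemma norming_pairing_cong:
  assumes "carr A = carr D" "\<And>x. x \<in> carr D \<Longrightarrow> nrm A x = nrm D x"
    "carr A' = carr D'" "\<And>x. x \<in> carr D' \<Longrightarrow> nrm A' x = nrm D' x" "norming_pairing D' D B"
  shows "norming_pairing A' A B"
  using assms(5) unfolding norming_pairing_def assms(1,3)
  by (simp add: assms(2,4))

text \<open>Completeness phrased by norms, which passes componentwise to l_p-sums. Its metric form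
  is needed to identify relatively compact with totally bounded sets.\<close>

definition cseq_complete :: "'a::complex_vec cnspace \<Rightarrow> bool"
  where "cseq_complete A \<longleftrightarrow> (\<forall>\<sigma> :: nat \<Rightarrow> 'a. (\<forall>k. \<sigma> k \<in> carr A) \<longrightarrow>
    (\<forall>e>0. \<exists>N. \<forall>m\<ge>N. \<forall>k\<ge>N. nrm A (\<sigma> m - \<sigma> k) < e) \<longrightarrow>
    (\<exists>x\<in>carr A. \<forall>e>0. \<exists>N. \<forall>k\<ge>N. nrm A (\<sigma> k - x) < e))"

lemma cseq_complete_cong:
  assumes "cnormed A'" "carr A = carr A'" "\<And>x. x \<in> carr A' \<Longrightarrow> nrm A x = nrm A' x" "cseq_complete A'"
  shows "cseq_complete A"
  unfolding cseq_complete_def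
proof (intro allI impI)
  fix \<sigma> :: "nat \<Rightarrow> 'a"
  assume \<sigma>: "\<forall>k. \<sigma> k \<in> carr A" and c: "\<forall>e>0. \<exists>N. \<forall>m\<ge>N. \<forall>k\<ge>N. nrm A (\<sigma> m - \<sigma> k) < e"
  have s: "\<forall>k. \<sigma> k \<in> carr A'" using \<sigma> by (simp add: assms(2))
  have d: "nrm A (\<sigma> m - y) = nrm A' (\<sigma> m - y)" if "y \<in> carr A'" for m y
    using s that by (simp add: assms(3) cnormed.mem_diff[OF assms(1)])
  have "\<forall>e>0. \<exists>N. \<forall>m\<ge>N. \<forall>k\<ge>N. nrm A' (\<sigma> m - \<sigma> k) < e" using c s by (simp add: d)
  then obtain x where "x \<in> carr A'" "\<forall>e>0. \<exists>N. \<forall>k\<ge>N. nrm A' (\<sigma> k - x) < e"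
    using assms(4) s unfolding cseq_complete_def by blast
  then show "\<exists>x\<in>carr A. \<forall>e>0. \<exists>N. \<forall>k\<ge>N. nrm A (\<sigma> k - x) < e"
    by (intro bexI[of _ x]) (simp_all add: d assms(2))
qed

lemma cseq_complete_mcomplete:
  assumes "cnormed A" "cseq_complete A"
  shows "Metric_space.mcomplete (carr A) (ndist A)"
proof -
  interpret cnormed A by (rule assms(1))
  interpret Metric_space "carr A" "ndist A" by (rule Metric)
  show ?thesis
    unfolding mcomplete_def
  proof (intro allI impI)
    fix \<sigma> assume "MCauchy \<sigma>"
    then have s: "\<forall>k. \<sigma> k \<in> carr A" and c: "\<forall>e>0. \<exists>N. \<forall>m k. N \<le> m \<longrightarrow> N \<le> k \<longrightarrow> ndist A (\<sigma> m) (\<sigma> k) < e"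
      by (auto simp: MCauchy_def)
    have "\<forall>e>0. \<exists>N. \<forall>m\<ge>N. \<forall>k\<ge>N. nrm A (\<sigma> m - \<sigma> k) < e"
      using c s by (simp add: ndist_def)
    then obtain x where "x \<in> carr A" "\<forall>e>0. \<exists>N. \<forall>k\<ge>N. nrm A (\<sigma> k - x) < e"
      using assms(2) s unfolding cseq_complete_def by blast
    then show "\<exists>x. limitin mtopology \<sigma> x sequentially"
      using s by (intro exI[of _ x]) (simp add: limit_metric_sequentially ndist_def)
  qed
qed

lemma (in lp_sum_space) cseq_complete_lp_sum:
  assumes "\<And>n. cseq_complete (E n)"
  shows "cseq_complete X"
  unfolding cseq_complete_def
proof (intro allI impI)
  interpret X: cnormed X by (rule cnormed_X)
  fix \<sigma> :: "nat \<Rightarrow> nat \<Rightarrow> 'a"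
  assume s: "\<forall>k. \<sigma> k \<in> carr X" and c: "\<forall>e>0. \<exists>N. \<forall>m\<ge>N. \<forall>k\<ge>N. nrm X (\<sigma> m - \<sigma> k) < e"
  have "\<exists>z\<in>carr (E n). \<forall>e>0. \<exists>N. \<forall>k\<ge>N. nrm (E n) (\<sigma> k n - z) < e" for n
  proof -
    have le: "nrm (E n) (\<sigma> m n - \<sigma> k n) \<le> nrm X (\<sigma> m - \<sigma> k)" for m k
      using comp_le_nrm[of "\<sigma> m - \<sigma> k" n] s by (simp add: X.mem_diff)
    have "\<forall>e>0. \<exists>N. \<forall>m\<ge>N. \<forall>k\<ge>N. nrm (E n) (\<sigma> m n - \<sigma> k n) < e"
      using c le by (meson le_less_trans)
    moreover have "\<forall>k. \<sigma> k n \<in> carr (E n)" using s comp_mem by blast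
    ultimately show ?thesis
      using assms[of n] unfolding cseq_complete_def by (elim allE[of _ "\<lambda>k. \<sigma> k n"]) simp
  qed
  then obtain x where xE: "\<And>n. x n \<in> carr (E n)"
    and xl: "\<And>n. \<forall>e>0. \<exists>N. \<forall>k\<ge>N. nrm (E n) (\<sigma> k n - x n) < e" by metis
  \<comment> \<open>For each finite number of components the Cauchy estimate survives the limit in
    \<open>m\<close>, with a bound that does not depend on the number of components.\<close>
  have main: "\<sigma> k - x \<in> carr X \<and> nrm X (\<sigma> k - x) \<le> e"
    if e: "e > 0" and N: "\<forall>m\<ge>N. \<forall>k\<ge>N. nrm X (\<sigma> m - \<sigma> k) < e" and k: "k \<ge> N" for e k N
  proof -
    have mem: "(\<sigma> k - x) n \<in> carr (E n)" for n
      using s xE comp_mem by (simp add: cnormed.mem_diff[OF E])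
    have bnd: "(\<Sum>n<M. nrm (E n) ((\<sigma> k - x) n) powr p) \<le> e powr p" for M
    proof (rule LIMSEQ_le_const2)
      have "(\<lambda>m. nrm (E n) (\<sigma> k n - \<sigma> m n)) \<longlonglongrightarrow> nrm (E n) (\<sigma> k n - x n)" for n
      proof (rule LIMSEQ_I)
        fix d :: real assume "d > 0"
        then obtain L where L: "\<forall>m\<ge>L. nrm (E n) (\<sigma> m n - x n) < d" using xl by blast
        interpret En: cnormed "E n" by (rule E)
        have sE: "\<sigma> m n \<in> carr (E n)" for m using s comp_mem by blast
        have "\<bar>nrm (E n) (\<sigma> k n - \<sigma> m n) - nrm (E n) (\<sigma> k n - x n)\<bar> \<le> nrm (E n) (\<sigma> m n - x n)" for m
          using En.norm_diff_triangle[of "\<sigma> k n" "x n" "\<sigma> m n"] En.norm_diff_triangle[of "\<sigma> k n" "\<sigma> m n" "x n"]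
            En.norm_minus_commute[of "\<sigma> m n" "x n"] sE xE by auto
        then show "\<exists>L. \<forall>m\<ge>L. norm (nrm (E n) (\<sigma> k n - \<sigma> m n) - nrm (E n) (\<sigma> k n - x n)) < d"
          using L by (auto intro!: exI[of _ L] intro: le_less_trans)
      qed
      then have "(\<lambda>m. \<Sum>n<M. nrm (E n) (\<sigma> k n - \<sigma> m n) powr p) \<longlonglongrightarrow> (\<Sum>n<M. nrm (E n) (\<sigma> k n - x n) powr p)"
        using p by (intro tendsto_sum tendsto_powr2 tendsto_const)
          (auto intro!: cnormed.norm_ge0[OF E] cnormed.mem_diff[OF E] comp_mem s[rule_format] simp: eventually_sequentially)
      then show "(\<lambda>m. \<Sum>n<M. nrm (E n) (\<sigma> k n - \<sigma> m n) powr p) \<longlonglongrightarrow> (\<Sum>n<M. nrm (E n) ((\<sigma> k - x) n) powr p)"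
        by simp
      have "(\<Sum>n<M. nrm (E n) (\<sigma> k n - \<sigma> m n) powr p) \<le> e powr p" if m: "m \<ge> N" for m
      proof -
        have "(\<Sum>n<M. nrm (E n) ((\<sigma> k - \<sigma> m) n) powr p) \<le> nrm X (\<sigma> k - \<sigma> m) powr p"
          using s by (intro sum_le_nrm_powr X.mem_diff) auto
        also have "\<dots> \<le> e powr p"
          using N k m p nrm_ge0 by (intro powr_mono2) (auto intro: less_imp_le)
        finally show ?thesis by simp
      qed
      then show "\<exists>N. \<forall>m\<ge>N. (\<Sum>n<M. nrm (E n) (\<sigma> k n - \<sigma> m n) powr p) \<le> e powr p" by blast
    qed
    show ?thesis by (intro conjI; rule memI[OF mem _ bnd]; use e in simp)
  qed
  obtain N1 where N1: "\<forall>m\<ge>N1. \<forall>k\<ge>N1. nrm X (\<sigma> m - \<sigma> k) < 1" using c by (meson zero_less_one)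
  have "\<sigma> N1 - x \<in> carr X" using main[OF zero_less_one N1 order_refl] by blast
  then have "\<sigma> N1 - (\<sigma> N1 - x) \<in> carr X" by (rule X.mem_diff[OF s[rule_format]])
  then have xX: "x \<in> carr X" by simp
  show "\<exists>x\<in>carr X. \<forall>e>0. \<exists>N. \<forall>k\<ge>N. nrm X (\<sigma> k - x) < e"
  proof (intro bexI[OF _ xX] allI impI)
    fix e :: real assume e: "e > 0"
    then obtain N where N: "\<forall>m\<ge>N. \<forall>k\<ge>N. nrm X (\<sigma> m - \<sigma> k) < e/2" using c half_gt_zero by blast
    show "\<exists>N. \<forall>k\<ge>N. nrm X (\<sigma> k - x) < e"
    proof (intro exI allI impI)
      fix k assume "k \<ge> N"
      then show "nrm X (\<sigma> k - x) < e" using main[OF _ N] e by fastforce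
    qed
  qed
qed

text \<open>\<open>\<ell>\<^sub>q\<^sup>n\<close> is the \<open>\<ell>\<^sub>q\<close>-sum of \<open>n\<close> copies of the scalars and of infinitely many zero spaces.\<close>

definition lq_comp :: "nat \<Rightarrow> nat \<Rightarrow> complex cnspace"
  where "lq_comp n i = \<lparr>carr = (if i < n then UNIV else {0}), nrm = cmod\<rparr>"

lemma lq_comp_simps [simp]: "nrm (lq_comp n i) = cmod" "carr (lq_comp n i) = (if i < n then UNIV else {0})"
  by (simp_all add: lq_comp_def)

lemma cnormed_lq_comp: "cnormed (lq_comp n i)"
  by standard (auto simp: scaleC_complex_def norm_mult norm_triangle_ineq)

lemma lp_sum_space_lq_comp: "1 < q \<Longrightarrow> lp_sum_space q (lq_comp n)"
  by (simp add: lp_sum_space_def cnormed_lq_comp)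

lemma lq_fin_eq:
  shows "carr (lq_fin q n) = carr (lp_sum q (lq_comp n))"
    and "x \<in> carr (lp_sum q (lq_comp n)) \<Longrightarrow> nrm (lq_fin q n) x = nrm (lp_sum q (lq_comp n)) x"
proof -
  have fin: "(\<lambda>i. cmod (x i) powr q) sums (\<Sum>i<n. cmod (x i) powr q)" if "\<forall>i\<ge>n. x i = 0" for x :: "nat \<Rightarrow> complex"
    using that by (intro sums_finite) auto
  have mem: "x \<in> carr (lp_sum q (lq_comp n)) \<longleftrightarrow> (\<forall>i\<ge>n. x i = 0)" for x
  proof
    assume "x \<in> carr (lp_sum q (lq_comp n))"
    then have "\<And>i. x i \<in> carr (lq_comp n i)" by (simp add: lp_sum_def)
    then have "\<And>i. x i \<in> (if i < n then UNIV else {0})" by simp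
    then show "\<forall>i\<ge>n. x i = 0" by (metis leD singletonD)
  next
    assume "\<forall>i\<ge>n. x i = 0"
    then show "x \<in> carr (lp_sum q (lq_comp n))"
      using sums_summable[OF fin] by (auto simp: lp_sum_def)
  qed
  show "carr (lq_fin q n) = carr (lp_sum q (lq_comp n))"
    using mem by (auto simp: lq_fin_def)
  show "x \<in> carr (lp_sum q (lq_comp n)) \<Longrightarrow> nrm (lq_fin q n) x = nrm (lp_sum q (lq_comp n)) x"
    using mem[of x] sums_unique[OF fin, of x] by (simp add: lq_fin_def lp_sum_def)
qed

lemma cnormed_lq_fin: "1 < q \<Longrightarrow> cnormed (lq_fin q n)"
  by (rule cnormed_cong[OF lp_sum_space.cnormed_X[OF lp_sum_space_lq_comp] lq_fin_eq])

lemma lp_sum_space_lq_fin: "1 < p \<Longrightarrow> 1 < q \<Longrightarrow> lp_sum_space p (\<lambda>n. lq_fin q (Suc n))"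
  by (simp add: lp_sum_space_def cnormed_lq_fin)

lemma cseq_complete_lq_fin:
  assumes q: "1 < q"
  shows "cseq_complete (lq_fin q n)"
proof (rule cseq_complete_cong[OF lp_sum_space.cnormed_X[OF lp_sum_space_lq_comp[OF q]] lq_fin_eq])
  have "cseq_complete (lq_comp n i)" for i
    unfolding cseq_complete_def
  proof (intro allI impI)
    fix \<sigma> :: "nat \<Rightarrow> complex"
    assume s: "\<forall>k. \<sigma> k \<in> carr (lq_comp n i)" and c: "\<forall>e>0. \<exists>N. \<forall>m\<ge>N. \<forall>k\<ge>N. nrm (lq_comp n i) (\<sigma> m - \<sigma> k) < e"
    have "Cauchy \<sigma>" by (rule CauchyI) (use c in simp)
    then obtain z where z: "\<sigma> \<longlonglongrightarrow> z" by (auto simp: Cauchy_convergent_iff convergent_def)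
    have "z \<in> carr (lq_comp n i)"
    proof (cases "i < n")
      case False
      then have "\<sigma> = (\<lambda>k. 0)" using s by auto
      then show ?thesis using z by (simp add: LIMSEQ_const_iff)
    qed simp
    moreover have "\<forall>e>0. \<exists>N. \<forall>k\<ge>N. nrm (lq_comp n i) (\<sigma> k - z) < e"
      using LIMSEQ_D[OF z] by simp
    ultimately show "\<exists>x\<in>carr (lq_comp n i). \<forall>e>0. \<exists>N. \<forall>k\<ge>N. nrm (lq_comp n i) (\<sigma> k - x) < e" by blast
  qed
  then show "cseq_complete (lp_sum q (lq_comp n))"
    by (rule lp_sum_space.cseq_complete_lp_sum[OF lp_sum_space_lq_comp[OF q]])
qed

text \<open>The blocks are smooth with averaging exponent q, the outer sum asks for p, so the
  averaging exponent is changed in between. The type r must not exceed p and q because of the sums,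
  nor 2 because of the scalars.\<close>

lemma smooth_lp_lq_sum:
  assumes p: "1 < p" and q: "1 < q"
  obtains r C where "1 < r" "0 \<le> C" "smooth_space (lp_lq_sum p q) p r C"
proof -
  define r where "r = min (min p q) 2"
  have r: "1 < r" "r \<le> p" "r \<le> q" "r \<le> 2" using p q by (auto simp: r_def)
  obtain C where C: "C \<ge> 0" "\<And>a b::complex. (cmod (a + b) powr q + cmod (a - b) powr q) / 2
           \<le> (cmod a powr r + C * cmod b powr r) powr (q/r)"
    using complex_smooth[OF q r(1,4)] by blast
  obtain D where D: "D \<ge> 0" "\<And>a b::complex. (cmod (a + b) powr p + cmod (a - b) powr p) / 2
           \<le> (cmod a powr r + D * cmod b powr r) powr (p/r)"
    using complex_smooth[OF p r(1,4)] by blast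
  have "smooth_space (lq_comp n i) q r C" for n i
    using C(2) by (simp add: smooth_space_def)
  then have sm: "smooth_space (lp_sum q (lq_comp n)) q r C" for n
    using r C by (intro lp_sum_space.smooth_lp_sum[OF lp_sum_space_lq_comp[OF q]]) auto
  have "smooth_space (lq_fin q n) q r C" for n
    by (rule smooth_space_cong[OF lp_sum_space.cnormed_X[OF lp_sum_space_lq_comp[OF q]] lq_fin_eq sm])
  then have "smooth_space (lq_fin q n) p r (C + D)" for n
    by (rule smooth_space_exponent[OF cnormed_lq_fin[OF q] q p r(1) C(1) D])
  then have "smooth_space (lp_lq_sum p q) p r (C + D)"
    unfolding lp_lq_sum_def
    using r C D by (intro lp_sum_space.smooth_lp_sum[OF lp_sum_space_lq_fin[OF p q]]) auto
  then show ?thesis using that[of r "C + D"] r C D by simp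
qed

text \<open>The pairing is the sum of products of coordinates, obtained by applying the l_p-sum
  construction to the blocks and then to their sum. The conjugate space is again of the form
  \<open>lp_lq_sum\<close>.\<close>

lemma norming_pairing_lp_lq_sum:
  assumes p: "1 < p" "1 < p'" "1/p' + 1/p = 1" and q: "1 < q" "1 < q'" "1/q' + 1/q = 1"
  obtains B where "norming_pairing (lp_lq_sum p' q') (lp_lq_sum p q) B"
proof -
  have np: "norming_pairing (lq_comp n i) (lq_comp n i) (\<lambda>y x. y * x)" for n i
  proof -
    have "\<exists>y\<in>carr (lq_comp n i). cmod y \<le> 1 \<and> y * x = complex_of_real (cmod x)" if "x \<in> carr (lq_comp n i)" for x
    proof (cases "x = 0")
      case True
      then show ?thesis by (intro bexI[of _ 0]) auto
    next
      case False
      then have "i < n" using that by (auto split: if_splits)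
      then show ?thesis
        using False by (intro bexI[of _ "cnj x / cmod x"])
          (auto simp: norm_divide mult.commute complex_norm_square[symmetric] power2_eq_square)
    qed
    then show ?thesis
      unfolding norming_pairing_def
      by (auto simp: distrib_left distrib_right scaleC_complex_def norm_mult simp del: lq_comp_simps(2))
  qed
  have np2: "norming_pairing (lp_sum q' (lq_comp n)) (lp_sum q (lq_comp n)) (\<lambda>y x. \<Sum>i. y i * x i)" for n
    by (rule norming_pairing_lp_sum[OF lp_sum_space_lq_comp[OF q(1)] lp_sum_space_lq_comp[OF q(2)] q(3) np])
  have np3: "norming_pairing (lq_fin q' n) (lq_fin q n) (\<lambda>y x. \<Sum>i. y i * x i)" for n
    by (rule norming_pairing_cong[OF lq_fin_eq lq_fin_eq np2])
  have "norming_pairing (lp_lq_sum p' q') (lp_lq_sum p q) (\<lambda>y x. \<Sum>n. \<Sum>i. y n i * x n i)"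
    unfolding lp_lq_sum_def
    by (rule norming_pairing_lp_sum[OF lp_sum_space_lq_fin[OF p(1) q(1)] lp_sum_space_lq_fin[OF p(2) q(2)] p(3) np3])
  then show ?thesis by (rule that)
qed

lemma cnormed_lp_lq_sum: "1 < p \<Longrightarrow> 1 < q \<Longrightarrow> cnormed (lp_lq_sum p q)"
  unfolding lp_lq_sum_def by (rule lp_sum_space.cnormed_X[OF lp_sum_space_lq_fin])

lemma lp_lq_sum_uniformly_smooth:
  assumes "1 < p" "1 < q" "\<eta> > 0"
  obtains t where "t > 0" "\<And>x y. x \<in> carr (lp_lq_sum p q) \<Longrightarrow> y \<in> carr (lp_lq_sum p q) \<Longrightarrow>
    nrm (lp_lq_sum p q) x \<le> 1 \<Longrightarrow> nrm (lp_lq_sum p q) y \<le> 1 \<Longrightarrow>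
    nrm (lp_lq_sum p q) (x + complex_of_real t *\<^sub>C y) + nrm (lp_lq_sum p q) (x - complex_of_real t *\<^sub>C y) \<le> 2 + \<eta> * t"
proof -
  obtain r C where "1 < r" "0 \<le> C" "smooth_space (lp_lq_sum p q) p r C"
    using smooth_lp_lq_sum assms by blast
  then show ?thesis
    using smooth_space_sum_le[OF cnormed_lp_lq_sum assms(1), of p q r C \<eta>] assms that by blast
qed

lemma lp_lq_sum_uniformly_convex:
  assumes p: "1 < p" and q: "1 < q" and \<eta>: "\<eta> > 0"
  obtains t where "t > 0" "\<And>u v. u \<in> carr (lp_lq_sum p q) \<Longrightarrow> v \<in> carr (lp_lq_sum p q) \<Longrightarrow>
    nrm (lp_lq_sum p q) u \<le> 1 \<Longrightarrow> nrm (lp_lq_sum p q) v \<le> 1 \<Longrightarrow>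
    nrm (lp_lq_sum p q) (u + v) + t * nrm (lp_lq_sum p q) (u - v) \<le> 2 + \<eta> * t"
proof -
  define p' where "p' = p / (p - 1)"
  define q' where "q' = q / (q - 1)"
  have p': "1 < p'" "1/p' + 1/p = 1" using p by (auto simp: p'_def field_simps)
  have q': "1 < q'" "1/q' + 1/q = 1" using q by (auto simp: q'_def field_simps)
  obtain B where B: "norming_pairing (lp_lq_sum p' q') (lp_lq_sum p q) B"
    using norming_pairing_lp_lq_sum[OF p p' q q'] by blast
  obtain t where t: "t > 0" "\<And>x y. x \<in> carr (lp_lq_sum p' q') \<Longrightarrow> y \<in> carr (lp_lq_sum p' q') \<Longrightarrow>
    nrm (lp_lq_sum p' q') x \<le> 1 \<Longrightarrow> nrm (lp_lq_sum p' q') y \<le> 1 \<Longrightarrow>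
    nrm (lp_lq_sum p' q') (x + complex_of_real t *\<^sub>C y) + nrm (lp_lq_sum p' q') (x - complex_of_real t *\<^sub>C y) \<le> 2 + \<eta> * t"
    using lp_lq_sum_uniformly_smooth[OF p'(1) q'(1) \<eta>] by blast
  show ?thesis
    by (rule that[OF t(1) convex_of_smooth_pairing[OF cnormed_lp_lq_sum[OF p q] cnormed_lp_lq_sum[OF p'(1) q'(1)] B t(2)]])
qed

section \<open>The space and its coordinate projections\<close>


lemma scaleC_fun_apply: "(c *\<^sub>C f) x = c *\<^sub>C f x"
  by (simp add: scaleC_fun_def)

text \<open>Plain composition of functions respects the encoding of operators: off the carrier the
  inner operator takes the value 0, which the outer one maps to 0.\<close>

abbreviation opcomp :: "('b \<Rightarrow> 'c) \<Rightarrow> ('a \<Rightarrow> 'b) \<Rightarrow> 'a \<Rightarrow> 'c"  (infixl "\<odot>" 70)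
  where "S \<odot> T \<equiv> S \<circ> T"

locale lp_lq =
  fixes p q :: real
  assumes p: "1 < p" and q: "1 < q"

sublocale lp_lq \<subseteq> L: lp_sum_space p "\<lambda>n. lq_fin q (Suc n)"
  rewrites "lp_sum p (\<lambda>n. lq_fin q (Suc n)) = lp_lq_sum p q"
  by (rule lp_sum_space_lq_fin[OF p q]) (simp add: lp_lq_sum_def)

sublocale lp_lq \<subseteq> X: cnormed "lp_lq_sum p q"
  by (rule cnormed_lp_lq_sum[OF p q])

sublocale lp_lq \<subseteq> XX: cnormed_pair "lp_lq_sum p q" "lp_lq_sum p q"
  by unfold_locales

sublocale lp_lq \<subseteq> Y: cnormed "endo_space (lp_lq_sum p q)"
  by (rule XX.cnormed_op_space)

context lp_lq
begin

section \<open>Blocks, coordinates and the algebra of operators\<close>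

abbreviation "X \<equiv> lp_lq_sum p q"
abbreviation "CX \<equiv> carr X"
abbreviation "nX \<equiv> nrm X"
abbreviation "bn n \<equiv> nrm (lq_fin q (Suc n))"
abbreviation "BO \<equiv> bounded_ops X X"
abbreviation "nO \<equiv> op_norm X X"
abbreviation "Y \<equiv> endo_space X"

lemma carr_Y [simp]: "carr Y = BO" and nrm_Y [simp]: "nrm Y = nO"
  by (simp_all add: carr_op_space nrm_op_space)

lemma block_mem_iff: "z \<in> carr (lq_fin q (Suc n)) \<longleftrightarrow> (\<forall>i>n. z i = 0)"
  by (auto simp: lq_fin_def)

lemma block_powr: "bn n z powr q = (\<Sum>i\<le>n. cmod (z i) powr q)"
  using q by (simp add: lq_fin_def powr_powr sum_nonneg lessThan_Suc_atMost)

lemma block_ge0: "0 \<le> bn n z"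
  by (simp add: lq_fin_def)

lemma block_mono:
  assumes "\<And>i. i \<le> n \<Longrightarrow> cmod (z i) \<le> cmod (w i)"
  shows "bn n z \<le> bn n w"
proof -
  have "(\<Sum>i<Suc n. cmod (z i) powr q) \<le> (\<Sum>i<Suc n. cmod (w i) powr q)"
    using assms q by (intro sum_mono powr_mono2) auto
  then show ?thesis
    using q by (simp add: lq_fin_def powr_mono2 sum_nonneg del: sum.lessThan_Suc)
qed

lemma block_zero [simp]: "bn n 0 = 0" "bn n (\<lambda>i. 0) = 0"
  by (simp_all add: lq_fin_def)

lemma coord_le_block: "i \<le> n \<Longrightarrow> cmod (z i) \<le> bn n z"
proof -
  assume i: "i \<le> n"
  have "cmod (z i) powr q \<le> bn n z powr q"
    unfolding block_powr using i by (intro member_le_sum) auto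
  then have "(cmod (z i) powr q) powr (1/q) \<le> (bn n z powr q) powr (1/q)"
    using q by (metis less_le_trans less_imp_le powr_ge_zero powr_mono2 zero_le_divide_1_iff zero_le_one order_trans)
  moreover have "(cmod (z i) powr q) powr (1/q) = cmod (z i)" "(bn n z powr q) powr (1/q) = bn n z"
    using q block_ge0[of n z] by (simp_all add: powr_powr)
  ultimately show ?thesis by (simp only:)
qed

lemma coord_zero: "x \<in> CX \<Longrightarrow> n < i \<Longrightarrow> x n i = 0"
  using L.comp_mem[of x n] by (simp add: block_mem_iff)

lemma coord_le: "x \<in> CX \<Longrightarrow> cmod (x n i) \<le> nX x"
  using coord_le_block[of i n "x n"] L.comp_le_nrm[of x n] coord_zero[of x n i] L.nrm_ge0[of x]
  by (cases "i \<le> n") auto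

lemma op_mem: "T \<in> BO \<Longrightarrow> T x \<in> CX"
  using bounded_opsD(1,4)[of T X X x] X.mem_zero by metis

lemma BO_comp:
  assumes "S \<in> BO" "T \<in> BO"
  shows "S \<odot> T \<in> BO" "nO (S \<odot> T) \<le> nO S * nO T"
  using op_comp[OF X.cnormed_axioms X.cnormed_axioms X.cnormed_axioms assms] by (simp_all add: comp_def)

lemma BO_comp_le:
  assumes "S \<in> BO" "T \<in> BO" "nO S \<le> a" "nO T \<le> b"
  shows "nO (S \<odot> T) \<le> a * b"
  using BO_comp(2)[OF assms(1,2)] XX.op_norm_ge0[OF assms(1)] XX.op_norm_ge0[OF assms(2)] assms(3,4)
  by (meson mult_mono order_trans)

lemma BO_add: "S \<in> BO \<Longrightarrow> T \<in> BO \<Longrightarrow> S + T \<in> BO"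
  and BO_diff: "S \<in> BO \<Longrightarrow> T \<in> BO \<Longrightarrow> S - T \<in> BO"
  and BO_scale: "S \<in> BO \<Longrightarrow> c *\<^sub>C S \<in> BO"
  and BO_zero: "0 \<in> BO"
  using Y.mem by auto

lemma nO_triangle: "S \<in> BO \<Longrightarrow> T \<in> BO \<Longrightarrow> nO (S + T) \<le> nO S + nO T"
  using Y.norm_triangle[of S T] by simp

lemma nO_scale: "S \<in> BO \<Longrightarrow> nO (c *\<^sub>C S) = cmod c * nO S"
  using Y.norm_scale[of S c] by simp

lemma comp_add_right: "S \<in> BO \<Longrightarrow> T \<in> BO \<Longrightarrow> U \<in> BO \<Longrightarrow> S \<odot> (T + U) = S \<odot> T + S \<odot> U"
  by (rule ext) (simp add: bounded_opsD(2)[of S X X] op_mem)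

lemma comp_diff_right: "S \<in> BO \<Longrightarrow> T \<in> BO \<Longrightarrow> U \<in> BO \<Longrightarrow> S \<odot> (T - U) = S \<odot> T - S \<odot> U"
  by (rule ext) (simp add: XX.op_diff[of S] op_mem)

lemma comp_scale_right: "S \<in> BO \<Longrightarrow> T \<in> BO \<Longrightarrow> S \<odot> (c *\<^sub>C T) = c *\<^sub>C (S \<odot> T)"
  by (rule ext) (simp add: scaleC_fun_apply bounded_opsD(3)[of S X X] op_mem)

lemma comp_add_left: "(S + T) \<odot> U = S \<odot> U + T \<odot> U"
  by (rule ext) simp

lemma comp_diff_left: "(S - T) \<odot> U = S \<odot> U - T \<odot> U"
  by (rule ext) simp

text \<open>Diagonal operators with bounded entries are contractions for any p and q. Coordinate
  projections, sign changes and phases are all of this kind.\<close>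

definition mult :: "(nat \<Rightarrow> nat \<Rightarrow> complex) \<Rightarrow> (nat \<Rightarrow> nat \<Rightarrow> complex) \<Rightarrow> nat \<Rightarrow> nat \<Rightarrow> complex"
  where "mult a x = (if x \<in> CX then (\<lambda>n i. a n i * x n i) else 0)"

lemma mult_apply: "x \<in> CX \<Longrightarrow> mult a x n i = a n i * x n i"
  by (simp add: mult_def)

lemma mult_op:
  assumes a: "\<And>n i. cmod (a n i) \<le> 1"
  shows "mult a \<in> BO" "nO (mult a) \<le> 1"
proof -
  have mem: "mult a x \<in> CX" "nX (mult a x) \<le> nX x" if x: "x \<in> CX" for x
  proof -
    have 1: "mult a x n \<in> carr (lq_fin q (Suc n))" for n
      using coord_zero[OF x] by (simp add: block_mem_iff mult_apply[OF x])
    have 2: "bn n (mult a x n) \<le> bn n (x n)" for n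
      using a by (intro block_mono) (simp add: mult_apply[OF x] norm_mult mult_left_le_one_le)
    show "mult a x \<in> CX" "nX (mult a x) \<le> nX x" using L.mem_mono[OF x 1 2] by auto
  qed
  show *: "mult a \<in> BO"
  proof (rule bounded_opsI[where K = 1])
    show "mult a (x + y) = mult a x + mult a y" if "x \<in> CX" "y \<in> CX" for x y
      using that X.mem_add[OF that] by (simp add: mult_def fun_eq_iff distrib_left)
    show "mult a (c *\<^sub>C x) = c *\<^sub>C mult a x" if "x \<in> CX" for x c
      using that X.mem_scale[OF that] by (simp add: mult_def fun_eq_iff scaleC_fun_def scaleC_complex_def)
  qed (use mem in \<open>auto simp: mult_def\<close>)
  show "nO (mult a) \<le> 1" by (rule XX.op_norm_le[OF *]) (use mem in auto)
qed

lemma mult_norm_le: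
  assumes "\<And>n i. cmod (a n i) \<le> 1" "x \<in> CX"
  shows "nX (mult a x) \<le> nX x"
  using XX.op_norm_bound'[OF mult_op(1) assms(2) order_refl mult_op(2), of a] assms(1) by simp

text \<open>Indexing by sets of pairs (block, coordinate) covers projections onto blocks, first
  coordinates and single coordinates at once, and composition becomes intersection.
  \<open>pr UNIV\<close> is the identity operator in the present encoding, unlike \<open>id\<close>,
  as it vanishes off the carrier.\<close>

definition pr :: "(nat \<times> nat) set \<Rightarrow> (nat \<Rightarrow> nat \<Rightarrow> complex) \<Rightarrow> nat \<Rightarrow> nat \<Rightarrow> complex"
  where "pr S = mult (\<lambda>n i. if (n, i) \<in> S then 1 else 0)"

lemma pr_op: "pr S \<in> BO" "nO (pr S) \<le> 1"
  unfolding pr_def by (rule mult_op, simp)+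

lemma pr_mem: "pr S x \<in> CX"
  by (rule op_mem[OF pr_op(1)])

lemma pr_norm_le: "x \<in> CX \<Longrightarrow> nX (pr S x) \<le> nX x"
  unfolding pr_def by (rule mult_norm_le) auto

lemma pr_apply: "x \<in> CX \<Longrightarrow> pr S x n i = (if (n, i) \<in> S then x n i else 0)"
  by (simp add: pr_def mult_apply)

lemma pr_outside: "x \<notin> CX \<Longrightarrow> pr S x = 0"
  by (rule bounded_opsD(4)[OF pr_op(1)])

lemma pr_pr: "pr S (pr T x) = pr (S \<inter> T) x"
  by (cases "x \<in> CX") (auto simp: fun_eq_iff pr_apply pr_mem pr_outside X.mem_zero)

lemma pr_comp: "pr S \<odot> pr T = pr (S \<inter> T)"
  by (simp add: fun_eq_iff[of "_ \<odot> _"] pr_pr)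

lemma pr_add: "S \<inter> T = {} \<Longrightarrow> pr S + pr T = pr (S \<union> T)"
proof -
  assume "S \<inter> T = {}"
  then have "pr S x + pr T x = pr (S \<union> T) x" for x
    by (cases "x \<in> CX") (auto simp: fun_eq_iff pr_apply pr_outside)
  then show ?thesis by (simp add: fun_eq_iff[of "_ + _"])
qed

lemma pr_split: "x \<in> CX \<Longrightarrow> x = pr S x + pr (- S) x"
  by (auto simp: fun_eq_iff pr_apply)

lemma pr_UNIV_comp: "T \<in> BO \<Longrightarrow> pr UNIV \<odot> T = T" "T \<in> BO \<Longrightarrow> T \<odot> pr UNIV = T"
proof -
  have id: "pr UNIV x = x" if "x \<in> CX" for x using that by (auto simp: fun_eq_iff pr_apply)
  show "T \<in> BO \<Longrightarrow> pr UNIV \<odot> T = T"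
    by (simp add: fun_eq_iff[of "_ \<odot> _"] id op_mem)
  assume T: "T \<in> BO"
  have "T (pr UNIV x) = T x" for x
    by (cases "x \<in> CX") (simp_all add: id pr_outside XX.op_zero[OF T] bounded_opsD(4)[OF T])
  then show "T \<odot> pr UNIV = T" by (simp add: fun_eq_iff[of "_ \<odot> _"])
qed

definition ee :: "nat \<Rightarrow> nat \<Rightarrow> nat \<Rightarrow> nat \<Rightarrow> complex"
  where "ee n i = (\<lambda>m j. if m = n \<and> j = i then 1 else 0)"

lemma ee_block: "i \<le> n \<Longrightarrow> bn m (ee n i m) = (if m = n then 1 else 0)"
proof -
  assume i: "i \<le> n"
  have "(\<Sum>j<Suc n. cmod (if j = i then 1 else 0) powr q) = (\<Sum>j<Suc n. if j = i then 1 else 0)"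
    by (rule sum.cong) auto
  then show ?thesis
    using i by (auto simp: lq_fin_def ee_def)
qed

lemma ee_mem: "i \<le> n \<Longrightarrow> ee n i \<in> CX" and ee_norm: "i \<le> n \<Longrightarrow> nX (ee n i) = 1"
proof -
  assume i: "i \<le> n"
  have 1: "ee n i m \<in> carr (lq_fin q (Suc m))" for m using i by (auto simp: block_mem_iff ee_def)
  have 2: "(\<Sum>m<M. bn m (ee n i m) powr p) \<le> 1 powr p" for M
    using i by (simp add: ee_block if_distrib[of "\<lambda>x. x powr p"] cong: if_cong)
  show m: "ee n i \<in> CX" by (rule L.memI(1)[OF 1 _ 2]) simp
  have "nX (ee n i) \<le> 1" by (rule L.memI(2)[OF 1 _ 2]) simp
  then show "nX (ee n i) = 1" using coord_le[OF m, of n i] by (simp add: ee_def)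
qed

lemma pr_single: "x \<in> CX \<Longrightarrow> i \<le> n \<Longrightarrow> pr {(n, i)} x = x n i *\<^sub>C ee n i"
  by (auto simp: fun_eq_iff pr_apply ee_def scaleC_fun_def scaleC_complex_def)

lemma pr_single_zero: "n < i \<Longrightarrow> pr {(n, i)} x = 0"
  by (cases "x \<in> CX") (auto simp: fun_eq_iff pr_apply pr_outside coord_zero)

lemma pr_insert: "c \<notin> S \<Longrightarrow> pr (insert c S) x = pr {c} x + pr S x"
  using fun_cong[OF pr_add[of "{c}" S], of x] by simp

lemma pr_empty: "pr {} x = 0"
  by (cases "x \<in> CX") (auto simp: fun_eq_iff pr_apply pr_outside)

lemma pr_finite_norm_le:
  assumes "finite S" "x \<in> CX"
  shows "nX (pr S x) \<le> (\<Sum>(n,i)\<in>S. cmod (x n i))"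
  using assms(1)
proof induction
  case empty
  show ?case by (simp only: pr_empty X.norm_zero sum.empty order_refl)
next
  case (insert c S)
  obtain n i where c: "c = (n, i)" by force
  have "nX (pr {c} x) \<le> cmod (x n i)"
    by (cases "i \<le> n") (auto simp: c pr_single[OF assms(2)] pr_single_zero X.norm_scale ee_mem ee_norm X.norm_zero)
  moreover have "nX (pr (insert c S) x) \<le> nX (pr {c} x) + nX (pr S x)"
    by (subst pr_insert[OF insert(2)]) (rule X.norm_triangle[OF pr_mem pr_mem])
  ultimately show ?case using insert by (simp add: c)
qed

text \<open>The coordinates of the first \<open>N\<close> blocks that can be nonzero. The set is
  finite, in contrast to \<open>{..<N} \<times> UNIV\<close>, which yields the same
  projection.\<close>

definition cells :: "nat \<Rightarrow> (nat \<times> nat) set"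
  where "cells N = Sigma {..<N} (\<lambda>n. {..n})"

lemma finite_cells: "finite (cells N)"
  by (simp add: cells_def)

abbreviation Q :: "nat set \<Rightarrow> (nat \<Rightarrow> nat \<Rightarrow> complex) \<Rightarrow> nat \<Rightarrow> nat \<Rightarrow> complex"
  where "Q G \<equiv> pr (G \<times> UNIV)"

lemma pr_cells: "pr (cells N) = Q {..<N}"
proof -
  have "pr (cells N) x = Q {..<N} x" for x
    by (cases "x \<in> CX") (auto simp: fun_eq_iff pr_apply pr_outside cells_def coord_zero)
  then show ?thesis by blast
qed

lemma Q_block: "x \<in> CX \<Longrightarrow> Q G x n = (if n \<in> G then x n else 0)"
  by (auto simp: fun_eq_iff pr_apply)

lemma Q_compl: "Q (- G) = pr (- (G \<times> UNIV))"
  by (rule arg_cong[where f = pr]) auto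

lemma Q_split: "x \<in> CX \<Longrightarrow> x = Q G x + Q (- G) x"
  unfolding Q_compl by (rule pr_split)

text \<open>All combinations of operators on disjoint groups of blocks rest on this additivity. The
  blocks have to be disjoint as a whole, since within a block the exponent is q.\<close>

lemma norm_powr_add:
  assumes x: "x \<in> CX" and y: "y \<in> CX" and d: "\<And>n. x n = 0 \<or> y n = 0"
  shows "nX (x + y) powr p = nX x powr p + nX y powr p"
proof -
  have "bn n ((x + y) n) powr p = bn n (x n) powr p + bn n (y n) powr p" for n
    using d[of n] by auto
  then show ?thesis
    using suminf_add[OF L.summable_comp[OF x] L.summable_comp[OF y]]
    by (simp add: L.nrm_powr[OF x] L.nrm_powr[OF y] L.nrm_powr[OF X.mem_add[OF x y]])
qed

lemma norm_powr_split: "x \<in> CX \<Longrightarrow> nX x powr p = nX (Q G x) powr p + nX (Q (- G) x) powr p"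
  using norm_powr_add[of "Q G x" "Q (- G) x"] Q_split[of x G] by (simp add: pr_mem Q_block)

lemma tail_tendsto_0:
  assumes x: "x \<in> CX" and e: "e > 0"
  obtains N where "\<And>n. n \<ge> N \<Longrightarrow> nX (Q {n..} x) \<le> e"
proof -
  let ?f = "\<lambda>n. bn n (x n) powr p"
  have s: "summable ?f" by (rule L.summable_comp[OF x])
  obtain N where N: "\<And>n. n \<ge> N \<Longrightarrow> norm (\<Sum>i. ?f (i + n)) < e powr p"
    using suminf_exist_split[OF _ s, of "e powr p"] e by auto
  have "nX (Q {n..} x) \<le> e" if n: "n \<ge> N" for n
  proof (rule L.memI(2))
    show "Q {n..} x m \<in> carr (lq_fin q (Suc m))" for m by (rule L.comp_mem[OF pr_mem])
    show "(\<Sum>m<M. bn m (Q {n..} x m) powr p) \<le> e powr p" for M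
    proof -
      have "(\<Sum>m<M. bn m (Q {n..} x m) powr p) \<le> (\<Sum>m<M + n. bn m (Q {n..} x m) powr p)"
        by (intro sum_mono2) auto
      also have "\<dots> = (\<Sum>m\<in>{n..<M + n}. ?f m)"
        using x by (intro sum.mono_neutral_cong_right) (auto simp: Q_block)
      also have "\<dots> = (\<Sum>i<M. ?f (i + n))"
        using sum.shift_bounds_nat_ivl[of ?f 0 n M] by (simp add: atLeast0LessThan)
      also have "\<dots> \<le> (\<Sum>i. ?f (i + n))"
        using s by (intro sum_le_suminf) (auto intro: summable_ignore_initial_segment)
      also have "\<dots> \<le> e powr p" using N[OF n] by simp
      finally show ?thesis .
    qed
  qed (use e in simp)
  then show ?thesis by (rule that)
qed

lemma norm_Q_antimono: "x \<in> CX \<Longrightarrow> G \<subseteq> H \<Longrightarrow> nX (Q G x) \<le> nX (Q H x)"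
  using pr_norm_le[OF pr_mem, of "G \<times> UNIV" "H \<times> UNIV" x]
  by (simp add: pr_pr Sigma_Int_distrib1[symmetric] Int_absorb2)

end

section \<open>Tails of operators and ideals\<close>


context lp_lq
begin

text \<open>On finitely many coordinates \<open>T\<close> is determined by the images of finitely
  many unit vectors, each of which has vanishing tails.\<close>

lemma comp_pr_finite_tail:
  assumes "finite S" and T: "T \<in> BO" and e: "e > 0"
  shows "\<exists>M0. \<forall>M\<ge>M0. nO (Q {M..} \<odot> (T \<odot> pr S)) \<le> e"
  using assms(1) e
proof (induction arbitrary: e)
  case empty
  have eq: "Q {M..} \<odot> (T \<odot> pr {}) = 0" for M
    by (rule ext) (simp add: pr_empty XX.op_zero[OF T] XX.op_zero[OF pr_op(1)])
  have "nO 0 = 0" using Y.norm_zero by simp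
  then have "nO (Q {M..} \<odot> (T \<odot> pr {})) \<le> e" for M using empty by (simp only: eq)
  then show ?case by blast
next
  case (insert c S)
  obtain n i where c: "c = (n, i)" by force
  obtain M1 where M1: "\<And>M. M \<ge> M1 \<Longrightarrow> nO (Q {M..} \<odot> (T \<odot> pr S)) \<le> e/2"
    using insert.IH[OF half_gt_zero[OF insert.prems]] by blast
  obtain M2 where M2: "\<And>M. M \<ge> M2 \<Longrightarrow> nX (Q {M..} (T (ee n i))) \<le> e/2"
    using tail_tendsto_0[OF op_mem[OF T], of "e/2" "ee n i"] insert.prems by auto
  have "nO (Q {M..} \<odot> (T \<odot> pr (insert c S))) \<le> e" if M: "M \<ge> max M1 M2" for M
  proof (rule XX.op_norm_le)
    show "Q {M..} \<odot> (T \<odot> pr (insert c S)) \<in> BO" using T by (intro BO_comp pr_op)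
    fix x assume x: "x \<in> CX"
    have B: "Q {M..} \<odot> (T \<odot> pr S) \<in> BO" using T by (intro BO_comp pr_op)
    have 1: "nX (Q {M..} (T (pr {c} x))) \<le> e/2 * nX x"
    proof (cases "i \<le> n")
      case True
      have "T (pr {c} x) = x n i *\<^sub>C T (ee n i)"
        by (simp only: c pr_single[OF x True] bounded_opsD(3)[OF T ee_mem[OF True]])
      then have "nX (Q {M..} (T (pr {c} x))) = cmod (x n i) * nX (Q {M..} (T (ee n i)))"
        by (simp only: bounded_opsD(3)[OF pr_op(1) op_mem[OF T]] X.norm_scale[OF pr_mem])
      also have "\<dots> \<le> nX x * (e/2)"
        using coord_le[OF x] M2[of M] M by (intro mult_mono L.nrm_ge0) auto
      finally show ?thesis by (simp add: mult.commute)
    next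
      case False
      then show ?thesis
        using insert.prems L.nrm_ge0[of x]
        by (simp add: c pr_single_zero XX.op_zero[OF T] XX.op_zero[OF pr_op(1)] X.norm_zero)
    qed
    have 2: "nX (Q {M..} (T (pr S x))) \<le> e/2 * nX x"
      using XX.op_norm_bound'[OF B x order_refl M1[of M]] M by simp
    have "(Q {M..} \<odot> (T \<odot> pr (insert c S))) x = Q {M..} (T (pr {c} x)) + Q {M..} (T (pr S x))"
      by (simp only: o_apply pr_insert[OF insert.hyps(2)] bounded_opsD(2)[OF T pr_mem pr_mem]
          bounded_opsD(2)[OF pr_op(1) op_mem[OF T] op_mem[OF T]])
    then have "nX ((Q {M..} \<odot> (T \<odot> pr (insert c S))) x) \<le> nX (Q {M..} (T (pr {c} x))) + nX (Q {M..} (T (pr S x)))"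
      by (simp only: X.norm_triangle[OF pr_mem pr_mem])
    also have "\<dots> \<le> e * nX x" using 1 2 by simp
    finally show "nX ((Q {M..} \<odot> (T \<odot> pr (insert c S))) x) \<le> e * nX x" .
  qed (use insert.prems in simp)
  then show ?case by blast
qed

text \<open>Adding a block far out to a vector that almost norms \<open>f\<close> costs only \<open>t\<^sup>p\<close> in the norm,
  while \<open>f\<close> would gain a multiple of \<open>t\<close>.\<close>

lemma functional_tail:
  assumes f: "f \<in> carr (dual_space X)" and e: "e > 0"
  shows "\<exists>M0. \<forall>M\<ge>M0. \<forall>x\<in>CX. nX x \<le> 1 \<longrightarrow> cmod (f (Q {M..} x)) \<le> e"
proof -
  define F where "F = nrm (dual_space X) f"
  have F0: "F \<ge> 0" using cnormed.norm_ge0[OF X.cnormed_dual f] by (simp add: F_def)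
  \<comment> \<open>Balanced so that the loss in the norm costs at most t e / 2. Together with
    \<open>2 * d = t * e / 2\<close> from the approximation of a norming vector this leaves exactly
    \<open>t * e\<close>.\<close>
  define t where "t = (e / (2 * (F + 1))) powr (1 / (p - 1))"
  have t: "t > 0" using e F0 by (simp add: t_def)
  have "t powr (p - 1) = e / (2 * (F + 1))" using p e F0 by (simp add: t_def powr_powr)
  then have tp: "t powr p = t * (e / (2 * (F + 1)))" using t powr_add[of t 1 "p - 1"] by simp
  define d where "d = t * e / 4"
  have d: "d > 0" using t e by (simp add: d_def)
  obtain x0 where x0: "x0 \<in> CX" "nX x0 \<le> 1" "f x0 = complex_of_real (cmod (f x0))" "F - d < cmod (f x0)"
    using X.functional_norming[OF f d] by (auto simp: F_def)
  obtain M0 where M0: "\<And>M. M \<ge> M0 \<Longrightarrow> nX (Q {M..} x0) \<le> d / (F + 1)"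
    using tail_tendsto_0[OF x0(1), of "d / (F + 1)"] d F0 by auto
  define z where "z = Q {..<M0} x0"
  have z: "z \<in> CX" "nX z \<le> 1"
    using x0 pr_norm_le[OF x0(1), of "{..<M0} \<times> UNIV"] by (auto simp: z_def pr_mem)
  have fz: "F - 2 * d \<le> Re (f z)"
  proof -
    have "x0 = z + Q {M0..} x0" using Q_split[OF x0(1), of "{..<M0}"] by (simp add: z_def Compl_lessThan)
    then have "f x0 = f z + f (Q {M0..} x0)"
      using X.functional_add[OF f z(1) pr_mem] by metis
    moreover have "cmod (f (Q {M0..} x0)) \<le> F * (d / (F + 1))"
      unfolding F_def by (rule X.functional_bound'[OF f pr_mem]) (use M0 in \<open>simp add: F_def\<close>)
    moreover have "F * (d / (F + 1)) \<le> d" using F0 d by (simp add: field_simps)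
    moreover have "Re (f (Q {M0..} x0)) \<le> cmod (f (Q {M0..} x0))" by (rule complex_Re_le_cmod)
    moreover have "Re (f x0) = cmod (f x0)" by (subst x0(3)) simp
    ultimately show ?thesis using x0(4) by simp
  qed
  have "cmod (f (Q {M..} x)) \<le> e" if M: "M \<ge> M0" and x: "x \<in> CX" "nX x \<le> 1" for M x
  proof -
    define y where "y = Q {M..} x"
    have y: "y \<in> CX" "nX y \<le> 1" using x pr_norm_le[OF x(1), of "{M..} \<times> UNIV"] by (auto simp: y_def pr_mem)
    define c where "c = (if f y = 0 then 1 else cnj (f y) / cmod (f y))"
    have c: "cmod c = 1" by (simp add: c_def norm_divide)
    have fcy: "c * f y = complex_of_real (cmod (f y))"
      by (simp add: c_def mult.commute complex_norm_square[symmetric] power2_eq_square)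
    define w where "w = (complex_of_real t * c) *\<^sub>C y"
    have w: "w \<in> CX" using y by (simp add: w_def X.mem_scale)
    have "nX w = t * nX y" using X.norm_scale[OF y(1), of "complex_of_real t * c"] c t by (simp add: w_def norm_mult)
    then have nw: "nX w \<le> t" using y t by simp
    have "z n = 0 \<or> w n = 0" for n
      using M Q_block[OF x0(1), of "{..<M0}" n] Q_block[OF x(1), of "{M..}" n]
      by (auto simp: z_def w_def y_def scaleC_fun_apply)
    then have "nX (z + w) powr p = nX z powr p + nX w powr p" by (rule norm_powr_add[OF z(1) w])
    also have "\<dots> \<le> 1 powr p + t powr p"
      using z nw p L.nrm_ge0 by (intro add_mono powr_mono2) auto
    finally have "(nX (z + w) powr p) powr (1/p) \<le> (1 + t powr p) powr (1/p)"
      using p by (intro powr_mono2) auto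
    then have "nX (z + w) \<le> (1 + t powr p) powr (1/p)"
      using p L.nrm_ge0 by (simp add: powr_powr)
    also have "\<dots> \<le> (1 + t powr p) powr 1" using p by (intro powr_mono) auto
    finally have nzw: "nX (z + w) \<le> 1 + t powr p" by simp
    have "f (z + w) = f z + complex_of_real (t * cmod (f y))"
      using X.functional_add[OF f z(1) w] X.functional_scale[OF f y(1), of "complex_of_real t * c"] fcy
      by (simp add: w_def mult.assoc)
    then have "Re (f z) + t * cmod (f y) = Re (f (z + w))" by simp
    also have "\<dots> \<le> cmod (f (z + w))" by (rule complex_Re_le_cmod)
    also have "\<dots> \<le> F * (1 + t powr p)"
      unfolding F_def by (rule X.functional_bound'[OF f X.mem_add[OF z(1) w] nzw])
    finally have "t * cmod (f y) \<le> 2 * d + F * t powr p" using fz by (simp add: algebra_simps)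
    also have "F * t powr p \<le> t * (e / 2)"
    proof -
      have "F * (e / (2 * (F + 1))) \<le> e / 2" using F0 e by (simp add: field_simps)
      then have "t * (F * (e / (2 * (F + 1)))) \<le> t * (e / 2)" using t by (intro mult_left_mono) auto
      then show ?thesis by (simp add: tp mult.left_commute)
    qed
    finally have "t * cmod (f y) \<le> t * e" by (simp add: d_def mult.commute)
    then show ?thesis using t by (simp add: y_def)
  qed
  then show ?thesis by blast
qed

lemma coord_functional:
  assumes T: "T \<in> BO"
  shows "(\<lambda>x. T x n i) \<in> carr (dual_space X)"
proof (rule X.functionalI[where K = "nO T"])
  show "T (x + y) n i = T x n i + T y n i" if "x \<in> CX" "y \<in> CX" for x y
    by (simp add: bounded_opsD(2)[OF T that])
  show "T (c *\<^sub>C x) n i = c * T x n i" if "x \<in> CX" for c x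
    by (simp add: bounded_opsD(3)[OF T that] scaleC_fun_apply scaleC_complex_def)
  show "cmod (T x n i) \<le> nO T * nX x" if "x \<in> CX" for x
    using coord_le[OF op_mem[OF T], of x n i] XX.op_norm_bound[OF T that] by simp
  show "T x n i = 0" if "x \<notin> CX" for x using bounded_opsD(4)[OF T that] by simp
qed

text \<open>The row counterpart of \<open>comp_pr_finite_tail\<close>: each coordinate of
  \<open>T\<close> is a bounded functional, and functionals have small tails because p > 1.\<close>

lemma pr_finite_comp_tail:
  assumes S: "finite S" and T: "T \<in> BO" and e: "e > 0"
  shows "\<exists>M0. \<forall>M\<ge>M0. nO (pr S \<odot> (T \<odot> Q {M..})) \<le> e"
proof -
  define d where "d = e / (real (card S) + 1)"
  have d: "d > 0" using e by (simp add: d_def add_nonneg_pos)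
  have "\<exists>M0. \<forall>M\<ge>M0. \<forall>x\<in>CX. nX x \<le> 1 \<longrightarrow> cmod (T (Q {M..} x) (fst c) (snd c)) \<le> d" for c
    by (rule functional_tail[OF coord_functional[OF T] d])
  then obtain m where m: "\<And>c M x. M \<ge> m c \<Longrightarrow> x \<in> CX \<Longrightarrow> nX x \<le> 1 \<Longrightarrow> cmod (T (Q {M..} x) (fst c) (snd c)) \<le> d"
    by metis
  \<comment> \<open>The sum of the thresholds dominates each of them and is defined for an empty set
    as well.\<close>
  have "nO (pr S \<odot> (T \<odot> Q {M..})) \<le> e" if M: "M \<ge> sum m S" for M
  proof (rule XX.op_norm_le_ball)
    show "pr S \<odot> (T \<odot> Q {M..}) \<in> BO" using T by (intro BO_comp pr_op)
    fix x assume x: "x \<in> CX" "nX x \<le> 1"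
    have "nX ((pr S \<odot> (T \<odot> Q {M..})) x) \<le> (\<Sum>(n,i)\<in>S. cmod (T (Q {M..} x) n i))"
      using pr_finite_norm_le[OF S op_mem[OF T]] by simp
    also have "\<dots> \<le> (\<Sum>c\<in>S. d)"
    proof (rule sum_mono)
      fix c assume c: "c \<in> S"
      have "m c \<le> sum m S" by (rule member_le_sum[OF c _ S]) simp
      then show "(case c of (n, i) \<Rightarrow> cmod (T (Q {M..} x) n i)) \<le> d"
        using m[of c M x] M x by (cases c) simp
    qed
    also have "\<dots> \<le> e" using e by (simp add: d_def field_simps)
    finally show "nX ((pr S \<odot> (T \<odot> Q {M..})) x) \<le> e" .
  qed
  then show ?thesis by blast
qed

lemma cseq_complete_X: "cseq_complete X"
  using L.cseq_complete_lp_sum cseq_complete_lq_fin[OF q] by blast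

text \<open>Compactness of the closure is total boundedness, by completeness. The elements of a
  finite net have uniformly small tails. Conversely, a diagonal subsequence of images converges in
  every coordinate; heads are controlled by finitely many coordinates, tails by hypothesis, so the
  subsequence is Cauchy.\<close>

lemma compact_iff:
  assumes T: "T \<in> BO"
  shows "T \<in> compact_ops X \<longleftrightarrow> (\<forall>e>0. \<exists>M0. \<forall>M\<ge>M0. nO (Q {M..} \<odot> T) \<le> e)"
proof -
  interpret M: Metric_space CX "ndist X" by (rule X.Metric)
  let ?S = "T ` {x \<in> CX. nX x \<le> 1}"
  have SC: "?S \<subseteq> CX" using op_mem[OF T] by auto
  have tb: "T \<in> compact_ops X \<longleftrightarrow> M.mtotally_bounded ?S"
    using T SC M.mtotally_bounded_eq_compact_closure_of[OF cseq_complete_mcomplete[OF X.cnormed_axioms cseq_complete_X], of ?S]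
    by (simp add: compact_ops_def ntop_def)
  show ?thesis
    unfolding tb
  proof (intro iffI allI impI)
    fix e :: real assume tb: "M.mtotally_bounded ?S" and e: "e > 0"
    have "e/2 > 0" using e by simp
    have "\<exists>K. finite K \<and> K \<subseteq> ?S \<and> ?S \<subseteq> (\<Union>x\<in>K. M.mball x (e/2))"
      by (rule tb[unfolded M.mtotally_bounded_def, rule_format, OF \<open>e/2 > 0\<close>])
    then obtain K where K: "finite K" "K \<subseteq> ?S" "?S \<subseteq> (\<Union>x\<in>K. M.mball x (e/2))"
      by (elim exE conjE)
    have "\<exists>N. \<forall>n\<ge>N. nX (Q {n..} k) \<le> e/2" if k: "k \<in> K" for k
    proof -
      have "k \<in> CX" using k K(2) SC by auto
      then obtain N where "\<And>n. n \<ge> N \<Longrightarrow> nX (Q {n..} k) \<le> e/2"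
        using tail_tendsto_0[OF _ \<open>e/2 > 0\<close>] by blast
      then show ?thesis by blast
    qed
    then obtain N where N: "\<And>k n. k \<in> K \<Longrightarrow> n \<ge> N k \<Longrightarrow> nX (Q {n..} k) \<le> e/2" by metis
    have "nO (Q {M..} \<odot> T) \<le> e" if M: "M \<ge> sum N K" for M
    proof (rule XX.op_norm_le_ball[OF BO_comp(1)[OF pr_op(1) T]])
      fix x assume x: "x \<in> CX" "nX x \<le> 1"
      then have "T x \<in> ?S" by auto
      then obtain k where k: "k \<in> K" "T x \<in> M.mball k (e/2)" using K(3) by blast
      have kC: "k \<in> CX" using k K SC by auto
      have TC: "T x \<in> CX" by (rule op_mem[OF T])
      have "nX (k - T x) < e/2" using k(2) kC TC by (simp add: ndist_def)
      then have d: "nX (Q {M..} (T x - k)) \<le> e/2"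
        using pr_norm_le[OF X.mem_diff[OF TC kC], of "{M..} \<times> UNIV"] X.norm_minus_commute[OF kC TC] by simp
      have "N k \<le> sum N K" by (rule member_le_sum[OF k(1) _ K(1)]) simp
      then have "nX (Q {M..} k) \<le> e/2" using N[OF k(1)] M by simp
      moreover have "nX (Q {M..} (T x)) \<le> nX (Q {M..} k) + nX (Q {M..} (T x - k))"
        unfolding XX.op_diff[OF pr_op(1) TC kC] by (rule X.norm_le_diff[OF pr_mem pr_mem])
      ultimately show "nX ((Q {M..} \<odot> T) x) \<le> e" using d by simp
    qed
    then show "\<exists>M0. \<forall>M\<ge>M0. nO (Q {M..} \<odot> T) \<le> e" by blast
  next
    assume R: "\<forall>e>0. \<exists>M0. \<forall>M\<ge>M0. nO (Q {M..} \<odot> T) \<le> e"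
    show "M.mtotally_bounded ?S"
      unfolding M.mtotally_bounded_sequentially
    proof (intro conjI SC allI impI)
      fix \<sigma> :: "nat \<Rightarrow> nat \<Rightarrow> nat \<Rightarrow> complex" assume \<sigma>: "range \<sigma> \<subseteq> ?S"
      have sC: "\<sigma> k \<in> CX" for k using \<sigma> SC by auto
      have pre: "\<exists>x\<in>CX. nX x \<le> 1 \<and> \<sigma> k = T x" for k
      proof -
        have "\<sigma> k \<in> ?S" using \<sigma> by (rule subsetD) simp
        then show ?thesis by (auto simp only: image_iff mem_Collect_eq)
      qed
      have bnd: "norm (\<sigma> k (fst c) (snd c)) \<le> nO T" for k c
      proof -
        obtain x where x: "x \<in> CX" "nX x \<le> 1" "\<sigma> k = T x" using pre[of k] by (elim bexE conjE)
        show ?thesis using coord_le[OF sC, of k] XX.op_norm_upper[OF T x(1,2)] x(3) by (metis order_trans)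
      qed
      obtain r where r: "strict_mono r" and lim: "\<And>c::nat \<times> nat. \<exists>l. (\<lambda>k. \<sigma> (r k) (fst c) (snd c)) \<longlonglongrightarrow> l"
      proof (rule function_convergent_subsequence[of "UNIV :: (nat \<times> nat) set" "\<lambda>k c. \<sigma> k (fst c) (snd c)" "nO T"])
        show "countable (UNIV :: (nat \<times> nat) set)" by simp
        show "norm (\<sigma> k (fst c) (snd c)) \<le> nO T" for k c by (rule bnd)
      qed (rule that, assumption, simp)
      have "M.MCauchy (\<sigma> \<circ> r)"
        unfolding M.MCauchy_def
      proof (intro conjI allI impI)
        show "range (\<sigma> \<circ> r) \<subseteq> CX" using sC by auto
        fix e :: real assume e: "e > 0"
        have e4: "e/4 > 0" using e by simp
        obtain M where M: "nO (Q {M..} \<odot> T) \<le> e/4" using R[rule_format, OF e4] by blast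
        have tail: "nX (Q {M..} (\<sigma> k)) \<le> e/4" for k
        proof -
          obtain x where x: "x \<in> CX" "nX x \<le> 1" "\<sigma> k = T x" using pre[of k] by (elim bexE conjE)
          show ?thesis using XX.op_norm_bound'[OF BO_comp(1)[OF pr_op(1) T] x(1,2) M] x(3) by simp
        qed
        define g where "g k l = (\<Sum>c\<in>cells M. cmod (\<sigma> (r k) (fst c) (snd c) - \<sigma> (r l) (fst c) (snd c)))" for k l
        have "\<exists>N. \<forall>k\<ge>N. \<forall>l\<ge>N. cmod (\<sigma> (r k) (fst c) (snd c) - \<sigma> (r l) (fst c) (snd c)) < e / (2 * (real (card (cells M)) + 1))" for c
        proof -
          have "Cauchy (\<lambda>k. \<sigma> (r k) (fst c) (snd c))" using lim[of c] by (auto simp: Cauchy_convergent_iff convergent_def)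
          moreover have "0 < e / (2 * (real (card (cells M)) + 1))" using e by (simp add: add_nonneg_pos)
          ultimately show ?thesis by (rule CauchyD)
        qed
        then obtain N where N: "\<And>c k l. k \<ge> N c \<Longrightarrow> l \<ge> N c \<Longrightarrow>
          cmod (\<sigma> (r k) (fst c) (snd c) - \<sigma> (r l) (fst c) (snd c)) < e / (2 * (real (card (cells M)) + 1))" by metis
        show "\<exists>N. \<forall>k l. N \<le> k \<longrightarrow> N \<le> l \<longrightarrow> ndist X ((\<sigma> \<circ> r) k) ((\<sigma> \<circ> r) l) < e"
        proof (intro exI allI impI)
          fix k l assume kl: "sum N (cells M) \<le> k" "sum N (cells M) \<le> l"
          define z where "z = \<sigma> (r k) - \<sigma> (r l)"
          have z: "z \<in> CX" using sC by (auto simp: z_def X.mem_diff)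
          have "nX (Q {..<M} z) \<le> (\<Sum>(n,i)\<in>cells M. cmod (z n i))"
            unfolding pr_cells[symmetric] by (rule pr_finite_norm_le[OF finite_cells z])
          also have "\<dots> \<le> (\<Sum>c\<in>cells M. e / (2 * (real (card (cells M)) + 1)))"
          proof (rule sum_mono)
            fix c assume c: "c \<in> cells M"
            have "N c \<le> sum N (cells M)" by (rule member_le_sum[OF c _ finite_cells]) simp
            then show "(case c of (n, i) \<Rightarrow> cmod (z n i)) \<le> e / (2 * (real (card (cells M)) + 1))"
              using N[of c k l] kl by (cases c) (simp add: z_def)
          qed
          also have "\<dots> < e / 2" using e by (simp add: field_simps)
          finally have 1: "nX (Q {..<M} z) < e / 2" .
          have 2: "nX (Q {M..} z) \<le> e / 2"
            unfolding z_def XX.op_diff[OF pr_op(1) sC sC]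
            using X.norm_triangle_diff[OF pr_mem pr_mem, of "{M..} \<times> UNIV" "\<sigma> (r k)" "{M..} \<times> UNIV" "\<sigma> (r l)"]
              tail[of "r k"] tail[of "r l"] by linarith
          have "z = Q {..<M} z + Q {M..} z" using Q_split[OF z, of "{..<M}"] by (simp add: Compl_lessThan)
          then have "nX z \<le> nX (Q {..<M} z) + nX (Q {M..} z)"
            using X.norm_triangle[OF pr_mem pr_mem] by metis
          then show "ndist X ((\<sigma> \<circ> r) k) ((\<sigma> \<circ> r) l) < e"
            using 1 2 sC by (simp add: ndist_def z_def)
        qed
      qed
      then show "\<exists>r. strict_mono r \<and> M.MCauchy (\<sigma> \<circ> r)" using r by blast
    qed
  qed
qed

text \<open>For contractions the smoothness condition of \<open>Y.M_ideal_invariant\<close> is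
  checked pointwise. Left multiplication leads to u + v and u - v with u = S x and v = T x, a case
  for uniform convexity; right multiplication leads to S (x + t A x) + T (x - t A x), a case for
  uniform smoothness.\<close>

lemma M_ideal_two_sided:
  assumes M: "M_ideal Y J" and A: "A \<in> BO" and T: "T \<in> J"
  shows "A \<odot> T \<in> J" "T \<odot> A \<in> J"
proof -
  note J = Y.M_idealD[OF M]
  have TB: "T \<in> BO" using T J(1) by auto
  have ball: "A \<odot> T \<in> J \<and> T \<odot> A \<in> J" if A: "A \<in> BO" "nO A \<le> 1" for A
  proof
    show "A \<odot> T \<in> J"
    proof (rule Y.M_ideal_invariant[OF M _ _ _ _ _ T, where \<Phi> = "\<lambda>S. A \<odot> S" and K = 1])
      fix \<eta> :: real assume "\<eta> > 0"
      then obtain t where t: "t > 0" "\<And>u v. u \<in> CX \<Longrightarrow> v \<in> CX \<Longrightarrow> nX u \<le> 1 \<Longrightarrow> nX v \<le> 1 \<Longrightarrow>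
          nX (u + v) + t * nX (u - v) \<le> 2 + \<eta> * t"
        using lp_lq_sum_uniformly_convex[OF p q] by blast
      have "nO (S + T + complex_of_real t *\<^sub>C (A \<odot> (S - T))) \<le> 2 + \<eta> * t"
        if S: "S \<in> BO" "nO S \<le> 1" and T: "T \<in> BO" "nO T \<le> 1" for S T
      proof (rule XX.op_norm_le_ball)
        show "S + T + complex_of_real t *\<^sub>C (A \<odot> (S - T)) \<in> BO"
          using S T A by (intro BO_add BO_scale BO_comp BO_diff)
        fix x assume x: "x \<in> CX" "nX x \<le> 1"
        have u: "S x \<in> CX" "nX (S x) \<le> 1" using op_mem[OF S(1)] XX.op_norm_upper[OF S(1) x] S(2) by auto
        have v: "T x \<in> CX" "nX (T x) \<le> 1" using op_mem[OF T(1)] XX.op_norm_upper[OF T(1) x] T(2) by auto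
        have m: "S x + T x \<in> CX" "S x - T x \<in> CX" "A (S x - T x) \<in> CX" "complex_of_real t *\<^sub>C A (S x - T x) \<in> CX"
          using u v op_mem[OF A(1)] by (auto intro: X.mem)
        have W: "(S + T + complex_of_real t *\<^sub>C (A \<odot> (S - T))) x = (S x + T x) + complex_of_real t *\<^sub>C A (S x - T x)"
          by (simp add: scaleC_fun_apply[of _ "A \<odot> (S - T)"])
        have "nX (complex_of_real t *\<^sub>C A (S x - T x)) = t * nX (A (S x - T x))"
          using X.norm_scale[OF m(3), of "complex_of_real t"] t(1) by simp
        also have "\<dots> \<le> t * nX (S x - T x)"
          using XX.op_norm_bound'[OF A(1) m(2) order_refl A(2)] t(1) by (intro mult_left_mono) simp_all
        finally show "nX ((S + T + complex_of_real t *\<^sub>C (A \<odot> (S - T))) x) \<le> 2 + \<eta> * t"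
          unfolding W using t(2)[OF u(1) v(1) u(2) v(2)] X.norm_triangle[OF m(1,4)] by linarith
      qed
      then show "\<exists>t>0. \<forall>x\<in>carr Y. \<forall>y\<in>carr Y. nrm Y x \<le> 1 \<longrightarrow> nrm Y y \<le> 1 \<longrightarrow>
          nrm Y (x + y + complex_of_real t *\<^sub>C (A \<odot> (x - y))) \<le> 2 + \<eta> * t"
        using t(1) by auto
    next
      show "nrm Y (A \<odot> S) \<le> 1 * nrm Y S" if "S \<in> carr Y" for S
        using BO_comp_le[OF A(1) _ A(2) order_refl, of S] that by simp
    qed (use A in \<open>simp_all add: BO_comp comp_add_right comp_scale_right\<close>)
    show "T \<odot> A \<in> J"
    proof (rule Y.M_ideal_invariant[OF M _ _ _ _ _ T, where \<Phi> = "\<lambda>S. S \<odot> A" and K = 1])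
      fix \<eta> :: real assume "\<eta> > 0"
      then obtain t where t: "t > 0" "\<And>x y. x \<in> CX \<Longrightarrow> y \<in> CX \<Longrightarrow> nX x \<le> 1 \<Longrightarrow> nX y \<le> 1 \<Longrightarrow>
          nX (x + complex_of_real t *\<^sub>C y) + nX (x - complex_of_real t *\<^sub>C y) \<le> 2 + \<eta> * t"
        using lp_lq_sum_uniformly_smooth[OF p q] by blast
      have "nO (S + T + complex_of_real t *\<^sub>C ((S - T) \<odot> A)) \<le> 2 + \<eta> * t"
        if S: "S \<in> BO" "nO S \<le> 1" and T: "T \<in> BO" "nO T \<le> 1" for S T
      proof (rule XX.op_norm_le_ball)
        show "S + T + complex_of_real t *\<^sub>C ((S - T) \<odot> A) \<in> BO"
          using S T A by (intro BO_add BO_scale BO_comp BO_diff)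
        fix x assume x: "x \<in> CX" "nX x \<le> 1"
        define y where "y = A x"
        have y: "y \<in> CX" "nX y \<le> 1" using op_mem[OF A(1)] XX.op_norm_upper[OF A(1) x] A(2) by (auto simp: y_def)
        let ?c = "complex_of_real t"
        have cy: "?c *\<^sub>C y \<in> CX" using y by (simp add: X.mem)
        have m: "x + ?c *\<^sub>C y \<in> CX" "x - ?c *\<^sub>C y \<in> CX" using x cy by (auto intro: X.mem)
        have sc: "U (?c *\<^sub>C y) = ?c *\<^sub>C U y" if "U \<in> BO" for U by (rule bounded_opsD(3)[OF that y(1)])
        have "(S + T + ?c *\<^sub>C ((S - T) \<odot> A)) x = S x + T x + ?c *\<^sub>C (S y - T y)"
          by (simp add: scaleC_fun_apply[of _ "(S - T) \<odot> A"] y_def)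
        also have "\<dots> = S (x + ?c *\<^sub>C y) + T (x - ?c *\<^sub>C y)"
          unfolding bounded_opsD(2)[OF S(1) x(1) cy] XX.op_diff[OF T(1) x(1) cy] sc[OF S(1)] sc[OF T(1)]
          by (simp add: complex_vec.scale_right_diff_distrib)
        finally have "nX ((S + T + ?c *\<^sub>C ((S - T) \<odot> A)) x) \<le> nX (S (x + ?c *\<^sub>C y)) + nX (T (x - ?c *\<^sub>C y))"
          by (simp only: X.norm_triangle[OF op_mem[OF S(1)] op_mem[OF T(1)]])
        also have "\<dots> \<le> nX (x + ?c *\<^sub>C y) + nX (x - ?c *\<^sub>C y)"
          using XX.op_norm_bound'[OF S(1) m(1) order_refl S(2)] XX.op_norm_bound'[OF T(1) m(2) order_refl T(2)] by simp
        also have "\<dots> \<le> 2 + \<eta> * t" by (rule t(2)[OF x(1) y(1) x(2) y(2)])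
        finally show "nX ((S + T + ?c *\<^sub>C ((S - T) \<odot> A)) x) \<le> 2 + \<eta> * t" .
      qed
      then show "\<exists>t>0. \<forall>x\<in>carr Y. \<forall>y\<in>carr Y. nrm Y x \<le> 1 \<longrightarrow> nrm Y y \<le> 1 \<longrightarrow>
          nrm Y (x + y + complex_of_real t *\<^sub>C ((x - y) \<odot> A)) \<le> 2 + \<eta> * t"
        using t(1) by auto
    next
      show "nrm Y (S \<odot> A) \<le> 1 * nrm Y S" if "S \<in> carr Y" for S
        using BO_comp_le[OF _ A(1) order_refl A(2), of S] that by simp
      show "(c *\<^sub>C S) \<odot> A = c *\<^sub>C (S \<odot> A)" for c S
        by (rule ext) (simp add: scaleC_fun_apply[of _ S] scaleC_fun_apply[of _ "S \<odot> A"])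
    qed (use A in \<open>simp_all add: BO_comp comp_add_left\<close>)
  qed
  define c where "c = nO A + 1"
  have c: "c > 0" using XX.op_norm_ge0[OF A] by (simp add: c_def)
  define A' where "A' = complex_of_real (1/c) *\<^sub>C A"
  have A'B: "A' \<in> BO" using A by (simp add: A'_def BO_scale)
  have "nO A' = (1/c) * nO A"
    unfolding A'_def nO_scale[OF A] norm_of_real using c by simp
  then have "nO A' \<le> 1" using c by (simp add: c_def)
  then have b: "A' \<odot> T \<in> J" "T \<odot> A' \<in> J" using ball[OF A'B] by auto
  have cA: "complex_of_real c *\<^sub>C A' = A" using c by (simp add: A'_def flip: of_real_mult)
  have "(complex_of_real c *\<^sub>C A') \<odot> T = complex_of_real c *\<^sub>C (A' \<odot> T)"
    by (rule ext) (simp add: scaleC_fun_apply[of _ A'] scaleC_fun_apply[of _ "A' \<odot> T"])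
  then show "A \<odot> T \<in> J"
    unfolding cA by (simp only: complex_vec.subspace_scale[OF J(2) b(1)])
  show "T \<odot> A \<in> J"
    using comp_scale_right[OF TB A'B, of "complex_of_real c"] unfolding cA
    by (simp only: complex_vec.subspace_scale[OF J(2) b(2)])
qed

end

section \<open>The compact operators form an M-ideal\<close>


context lp_lq
begin

abbreviation "K \<equiv> compact_ops X"

lemma compact_BO: "T \<in> K \<Longrightarrow> T \<in> BO"
  by (simp add: compact_ops_def)

lemma compactI: "T \<in> BO \<Longrightarrow> (\<And>e. e > 0 \<Longrightarrow> \<exists>M0. \<forall>M\<ge>M0. nO (Q {M..} \<odot> T) \<le> e) \<Longrightarrow> T \<in> K"
  by (simp add: compact_iff)

lemma compactD:
  assumes "T \<in> K" "e > 0"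
  obtains M0 where "\<And>M. M \<ge> M0 \<Longrightarrow> nO (Q {M..} \<odot> T) \<le> e"
proof -
  have "\<exists>M0. \<forall>M\<ge>M0. nO (Q {M..} \<odot> T) \<le> e"
    using compact_iff[OF compact_BO[OF assms(1)]] assms by simp
  then show ?thesis using that by blast
qed

lemma norm_le_of_powr: "0 \<le> b \<Longrightarrow> a powr p \<le> b powr p \<Longrightarrow> a \<le> b"
  using powr_less_mono2[of p b a] p by (meson less_trans not_le zero_less_one)

lemma nO_zero: "nO 0 = 0"
  using Y.norm_zero by simp

lemma compact_head: "T \<in> BO \<Longrightarrow> Q {..<n} \<odot> T \<in> K"
proof (rule compactI)
  assume T: "T \<in> BO"
  then show "Q {..<n} \<odot> T \<in> BO" by (intro BO_comp pr_op)
  fix e :: real assume e: "e > 0"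
  have "nO (Q {M..} \<odot> (Q {..<n} \<odot> T)) \<le> e" if "M \<ge> n" for M
  proof -
    have "{M..} \<times> UNIV \<inter> {..<n} \<times> (UNIV :: nat set) = {}" using that by auto
    then have "Q {M..} \<odot> (Q {..<n} \<odot> T) = 0"
      by (intro ext) (simp add: pr_pr pr_empty)
    then show ?thesis using e by (simp only: nO_zero)
  qed
  then show "\<exists>M0. \<forall>M\<ge>M0. nO (Q {M..} \<odot> (Q {..<n} \<odot> T)) \<le> e" by blast
qed

lemma compact_comp_head: "T \<in> BO \<Longrightarrow> T \<odot> Q {..<n} \<in> K"
proof (rule compactI)
  assume T: "T \<in> BO"
  then show "T \<odot> Q {..<n} \<in> BO" by (intro BO_comp pr_op)
  fix e :: real assume "e > 0"
  then show "\<exists>M0. \<forall>M\<ge>M0. nO (Q {M..} \<odot> (T \<odot> Q {..<n})) \<le> e"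
    using comp_pr_finite_tail[OF finite_cells T] by (simp only: pr_cells)
qed

lemma compact_subspace: "csubspace K"
proof (rule complex_vec.subspaceI)
  have eq: "Q {M..} \<odot> 0 = 0" for M
    by (rule ext) (simp add: XX.op_zero[OF pr_op(1)])
  show "0 \<in> K"
  proof (rule compactI[OF BO_zero])
    fix e :: real assume "e > 0"
    then have "nO (Q {M..} \<odot> 0) \<le> e" for M by (simp only: eq nO_zero less_imp_le)
    then show "\<exists>M0. \<forall>M\<ge>M0. nO (Q {M..} \<odot> 0) \<le> e" by blast
  qed
next
  fix S T assume S: "S \<in> K" and T: "T \<in> K"
  show "S + T \<in> K"
  proof (rule compactI)
    show "S + T \<in> BO" using S T by (intro BO_add compact_BO)
    fix e :: real assume "e > 0"
    then have e: "e/2 > 0" by simp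
    obtain M1 where M1: "\<And>M. M \<ge> M1 \<Longrightarrow> nO (Q {M..} \<odot> S) \<le> e/2" using compactD[OF S e] by blast
    obtain M2 where M2: "\<And>M. M \<ge> M2 \<Longrightarrow> nO (Q {M..} \<odot> T) \<le> e/2" using compactD[OF T e] by blast
    have "nO (Q {M..} \<odot> (S + T)) \<le> e" if "M \<ge> max M1 M2" for M
    proof -
      have "nO (Q {M..} \<odot> (S + T)) \<le> nO (Q {M..} \<odot> S) + nO (Q {M..} \<odot> T)"
        unfolding comp_add_right[OF pr_op(1) compact_BO[OF S] compact_BO[OF T]]
        using S T by (intro nO_triangle BO_comp pr_op compact_BO)
      then show ?thesis using M1[of M] M2[of M] that by simp
    qed
    then show "\<exists>M0. \<forall>M\<ge>M0. nO (Q {M..} \<odot> (S + T)) \<le> e" by blast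
  qed
next
  fix c T assume T: "T \<in> K"
  show "c *\<^sub>C T \<in> K"
  proof (rule compactI)
    show "c *\<^sub>C T \<in> BO" using T by (intro BO_scale compact_BO)
    fix e :: real assume e: "e > 0"
    then have "e / (cmod c + 1) > 0" by (simp add: add_nonneg_pos)
    then obtain M1 where M1: "\<And>M. M \<ge> M1 \<Longrightarrow> nO (Q {M..} \<odot> T) \<le> e / (cmod c + 1)" using compactD[OF T] by blast
    have "nO (Q {M..} \<odot> (c *\<^sub>C T)) \<le> e" if "M \<ge> M1" for M
    proof -
      have "nO (Q {M..} \<odot> (c *\<^sub>C T)) = cmod c * nO (Q {M..} \<odot> T)"
        unfolding comp_scale_right[OF pr_op(1) compact_BO[OF T]]
        using T by (intro nO_scale BO_comp pr_op compact_BO)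
      also have "\<dots> \<le> cmod c * (e / (cmod c + 1))" using M1[OF that] by (intro mult_left_mono) auto
      also have "\<dots> \<le> e"
      proof -
        have "cmod c / (cmod c + 1) \<le> 1" by (simp add: add_nonneg_pos)
        then have "cmod c / (cmod c + 1) * e \<le> 1 * e" using e by (intro mult_right_mono) auto
        then show ?thesis by simp
      qed
      finally show ?thesis .
    qed
    then show "\<exists>M0. \<forall>M\<ge>M0. nO (Q {M..} \<odot> (c *\<^sub>C T)) \<le> e" by blast
  qed
qed

lemma compact_closed: "closedin (ntop Y) K"
  unfolding Y.closedin_iff
proof (intro conjI ballI)
  show "K \<subseteq> carr Y" using compact_BO by auto
  fix T assume "T \<in> carr Y - K"
  then have T: "T \<in> BO" "T \<notin> K" by auto
  then obtain e where e: "e > 0" "\<And>M0. \<exists>M\<ge>M0. e < nO (Q {M..} \<odot> T)"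
    by (auto simp: compact_iff not_le)
  have "e/2 \<le> nrm Y (T - S)" if S: "S \<in> K" for S
  proof -
    have SB: "S \<in> BO" by (rule compact_BO[OF S])
    obtain M0 where M0: "\<And>M. M \<ge> M0 \<Longrightarrow> nO (Q {M..} \<odot> S) \<le> e/2"
      using compactD[OF S half_gt_zero[OF e(1)]] by blast
    obtain M where M: "M \<ge> M0" "e < nO (Q {M..} \<odot> T)" using e(2) by blast
    have B: "Q {M..} \<odot> (T - S) \<in> BO" "Q {M..} \<odot> S \<in> BO" using T(1) SB by (auto intro!: BO_comp pr_op BO_diff)
    have "Q {M..} \<odot> T = Q {M..} \<odot> (T - S) + Q {M..} \<odot> S"
      unfolding comp_diff_right[OF pr_op(1) T(1) SB] by simp
    then have "nO (Q {M..} \<odot> T) \<le> nO (Q {M..} \<odot> (T - S)) + nO (Q {M..} \<odot> S)"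
      using nO_triangle[OF B] by (simp only:)
    moreover have "nO (Q {M..} \<odot> (T - S)) \<le> nO (T - S)"
      using BO_comp_le[OF pr_op(1) BO_diff[OF T(1) SB] pr_op(2) order_refl] by simp
    ultimately show ?thesis using M M0[OF M(1)] by simp
  qed
  then show "\<exists>r>0. \<forall>S\<in>K. r \<le> nrm Y (T - S)" using e(1) by (intro exI[of _ "e/2"]) auto
qed

lemma functional_block_sum:
  assumes f: "f \<in> carr (dual_space Y)" and T: "T \<in> BO" and \<theta>: "\<And>k. cmod (\<theta> k) \<le> 1"
  shows "f (mult (\<lambda>n i. if n < N then \<theta> n else 0) \<odot> T) = (\<Sum>k<N. \<theta> k * f (Q {k} \<odot> T))"
proof (induction N)
  case 0
  have "mult (\<lambda>n i. if n < 0 then \<theta> n else 0) x = 0" for x by (auto simp: mult_def fun_eq_iff)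
  then have eq: "mult (\<lambda>n i. if n < 0 then \<theta> n else 0) \<odot> T = 0" by (intro ext) simp
  show ?case by (simp only: eq Y.functional_zero[OF f] lessThan_0 sum.empty)
next
  case (Suc N)
  let ?m = "\<lambda>N. mult (\<lambda>n i. if n < N then \<theta> n else 0)"
  have m: "?m M \<in> BO" for M using \<theta> by (intro mult_op) auto
  have "?m (Suc N) (T x) = ?m N (T x) + \<theta> N *\<^sub>C Q {N} (T x)" for x
    by (auto simp: fun_eq_iff mult_apply[OF op_mem[OF T]] pr_apply[OF op_mem[OF T]] scaleC_fun_def scaleC_complex_def less_Suc_eq)
  then have "?m (Suc N) \<odot> T = ?m N \<odot> T + \<theta> N *\<^sub>C (Q {N} \<odot> T)"
    by (intro ext) (simp add: scaleC_fun_apply[of _ "Q {N} \<odot> T"])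
  moreover have "f (?m N \<odot> T + \<theta> N *\<^sub>C (Q {N} \<odot> T)) = f (?m N \<odot> T) + \<theta> N * f (Q {N} \<odot> T)"
    using BO_comp(1)[OF m T] BO_comp(1)[OF pr_op(1) T] BO_scale[OF BO_comp(1)[OF pr_op(1) T]]
    by (simp add: Y.functional_add[OF f] Y.functional_scale[OF f])
  ultimately show ?case using Suc.IH by (simp only: sum.lessThan_Suc)
qed

lemma Q_eq_mult: "Q {..<N} = mult (\<lambda>n i. if n < N then 1 else 0)"
  unfolding pr_def by (rule arg_cong[where f = mult]) (auto simp: fun_eq_iff)

lemma functional_head:
  assumes f: "f \<in> carr (dual_space Y)" and T: "T \<in> BO"
  shows "f (Q {..<N} \<odot> T) = (\<Sum>k<N. f (Q {k} \<odot> T))"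
  using functional_block_sum[OF f T, of "\<lambda>k. 1" N] by (simp add: Q_eq_mult)

text \<open>The block sums converge absolutely: choose the phases of the blocks such that all terms become
  nonnegative, which does not increase the operator norm.\<close>

lemma functional_block_abs_sum:
  assumes f: "f \<in> carr (dual_space Y)" and T: "T \<in> BO"
  shows "(\<Sum>k<N. cmod (f (Q {k} \<odot> T))) \<le> nrm (dual_space Y) f * nO T"
proof -
  define \<theta> where "\<theta> k = (if f (Q {k} \<odot> T) = 0 then 0 else cnj (f (Q {k} \<odot> T)) / cmod (f (Q {k} \<odot> T)))" for k
  have \<theta>: "cmod (\<theta> k) \<le> 1" "\<theta> k * f (Q {k} \<odot> T) = complex_of_real (cmod (f (Q {k} \<odot> T)))" for k
    by (auto simp: \<theta>_def norm_divide mult.commute complex_norm_square[symmetric] power2_eq_square)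
  let ?m = "mult (\<lambda>n i. if n < N then \<theta> n else 0)"
  have m: "?m \<in> BO" "nO ?m \<le> 1" using \<theta>(1) by (intro mult_op; simp)+
  define s where "s = (\<Sum>k<N. cmod (f (Q {k} \<odot> T)))"
  have s0: "s \<ge> 0" by (simp add: s_def sum_nonneg)
  have "f (?m \<odot> T) = complex_of_real s"
    unfolding functional_block_sum[OF f T \<theta>(1)] s_def of_real_sum by (rule sum.cong[OF refl \<theta>(2)])
  then have "s = cmod (f (?m \<odot> T))"
    using s0 by (simp only: norm_of_real abs_of_nonneg)
  also have "\<dots> \<le> nrm (dual_space Y) f * nO T"
    using BO_comp_le[OF m(1) T m(2) order_refl] BO_comp(1)[OF m(1) T]
    by (intro Y.functional_bound'[OF f]) simp_all
  finally show ?thesis by (simp only: s_def)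
qed

text \<open>Functionals that are recovered from their values on the compact heads of each operator.
  They form the complement of the annihilator of \<open>K\<close>.\<close>

definition V :: "(((nat \<Rightarrow> nat \<Rightarrow> complex) \<Rightarrow> nat \<Rightarrow> nat \<Rightarrow> complex) \<Rightarrow> complex) set"
  where "V = {f \<in> carr (dual_space Y). \<forall>T\<in>BO. (\<lambda>n. f (Q {..<n} \<odot> T)) \<longlonglongrightarrow> f T}"

lemma V_subspace: "csubspace V"
proof (rule complex_vec.subspaceI)
  note D = cnormed.mem_zero[OF Y.cnormed_dual] cnormed.mem_add[OF Y.cnormed_dual] cnormed.mem_scale[OF Y.cnormed_dual]
  show "0 \<in> V" using D by (simp add: V_def)
  show "f + g \<in> V" if "f \<in> V" "g \<in> V" for f g
    using that D by (auto simp: V_def intro!: tendsto_add)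
  show "c *\<^sub>C f \<in> V" if "f \<in> V" for c f
    using that D by (auto simp: V_def scaleC_fun_apply[of c f] scaleC_complex_def intro!: tendsto_mult)
qed

text \<open>The limit exists as the sum of an absolutely convergent series. It agrees with
  \<open>f\<close> on heads, because a longer head projection fixes a shorter head, and therefore
  belongs to \<open>V\<close>.\<close>

lemma V_part:
  assumes f: "f \<in> carr (dual_space Y)"
  obtains g where "g \<in> V" "\<And>T. T \<in> BO \<Longrightarrow> (\<lambda>n. f (Q {..<n} \<odot> T)) \<longlonglongrightarrow> g T"
proof -
  define g where "g T = (if T \<in> BO then \<Sum>k. f (Q {k} \<odot> T) else 0)" for T
  let ?F = "nrm (dual_space Y) f"
  have sn: "summable (\<lambda>k. cmod (f (Q {k} \<odot> T)))" if "T \<in> BO" for T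
    by (rule summableI_nonneg_bounded[OF _ functional_block_abs_sum[OF f that]]) simp
  have lim: "(\<lambda>n. f (Q {..<n} \<odot> T)) \<longlonglongrightarrow> g T" if "T \<in> BO" for T
    using summable_LIMSEQ[OF summable_norm_cancel[OF sn[OF that]]] that
    by (simp add: functional_head[OF f that] g_def)
  have QT: "Q G \<odot> T \<in> BO" if "T \<in> BO" for T G by (rule BO_comp(1)[OF pr_op(1) that])
  have gd: "g \<in> carr (dual_space Y)"
  proof (rule Y.functionalI[where K = ?F], unfold carr_Y nrm_Y)
    show "g (S + T) = g S + g T" if S: "S \<in> BO" and T: "T \<in> BO" for S T
    proof -
      have "f (Q {..<n} \<odot> (S + T)) = f (Q {..<n} \<odot> S) + f (Q {..<n} \<odot> T)" for n
        unfolding comp_add_right[OF pr_op(1) S T] using QT[OF S] QT[OF T] by (simp add: Y.functional_add[OF f])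
      then have "(\<lambda>n. f (Q {..<n} \<odot> (S + T))) \<longlonglongrightarrow> g S + g T"
        using tendsto_add[OF lim[OF S] lim[OF T]] by (simp only:)
      then show ?thesis using lim[OF BO_add[OF S T]] LIMSEQ_unique by blast
    qed
    show "g (c *\<^sub>C T) = c * g T" if T: "T \<in> BO" for c T
    proof -
      have "f (Q {..<n} \<odot> (c *\<^sub>C T)) = c * f (Q {..<n} \<odot> T)" for n
        unfolding comp_scale_right[OF pr_op(1) T] using QT[OF T] by (simp add: Y.functional_scale[OF f])
      then have "(\<lambda>n. f (Q {..<n} \<odot> (c *\<^sub>C T))) \<longlonglongrightarrow> c * g T"
        using tendsto_mult[OF tendsto_const lim[OF T]] by (simp only:)
      then show ?thesis using lim[OF BO_scale[OF T]] LIMSEQ_unique by blast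
    qed
    show "cmod (g T) \<le> ?F * nO T" if T: "T \<in> BO" for T
    proof -
      have "cmod (g T) \<le> (\<Sum>k. cmod (f (Q {k} \<odot> T)))"
        using summable_norm[OF sn[OF T]] T by (simp add: g_def)
      also have "\<dots> \<le> ?F * nO T" by (rule suminf_le_const[OF sn[OF T] functional_block_abs_sum[OF f T]])
      finally show ?thesis .
    qed
    show "g T = 0" if "T \<notin> BO" for T using that by (simp add: g_def)
  qed
  have "g (Q {..<m} \<odot> T) = f (Q {..<m} \<odot> T)" if T: "T \<in> BO" for m T
  proof -
    have "Q {..<n} \<odot> (Q {..<m} \<odot> T) = Q {..<m} \<odot> T" if "n \<ge> m" for n
    proof -
      have "{..<n} \<times> UNIV \<inter> {..<m} \<times> UNIV = {..<m} \<times> (UNIV :: nat set)" using that by auto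
      then show ?thesis by (intro ext) (simp add: pr_pr)
    qed
    then have "(\<lambda>n. f (Q {..<n} \<odot> (Q {..<m} \<odot> T))) \<longlonglongrightarrow> f (Q {..<m} \<odot> T)"
      by (intro tendsto_eventually eventually_sequentiallyI[of m]) (simp only:)
    then show ?thesis using lim[OF QT[OF T]] LIMSEQ_unique by blast
  qed
  then have "g \<in> V" using gd lim by (simp add: V_def)
  then show ?thesis using that lim by blast
qed

lemma functional_head_compact:
  assumes f: "f \<in> carr (dual_space Y)" and T: "T \<in> K"
  shows "(\<lambda>n. f (Q {..<n} \<odot> T)) \<longlonglongrightarrow> f T"
proof (rule LIMSEQ_I)
  fix e :: real assume e: "e > 0"
  have TB: "T \<in> BO" by (rule compact_BO[OF T])
  let ?F = "nrm (dual_space Y) f"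
  have F0: "?F \<ge> 0" by (rule cnormed.norm_ge0[OF Y.cnormed_dual f])
  have d: "e / (?F + 1) > 0" using e F0 by simp
  obtain M0 where M0: "\<And>M. M \<ge> M0 \<Longrightarrow> nO (Q {M..} \<odot> T) \<le> e / (?F + 1)" using compactD[OF T d] by blast
  have "norm (f (Q {..<n} \<odot> T) - f T) < e" if n: "n \<ge> M0" for n
  proof -
    have B: "Q {..<n} \<odot> T \<in> BO" "Q {n..} \<odot> T \<in> BO" using TB by (auto intro!: BO_comp pr_op)
    have "T = Q {..<n} \<odot> T + Q {n..} \<odot> T"
      by (rule ext) (use Q_split[OF op_mem[OF TB], of _ "{..<n}"] in \<open>simp add: Compl_lessThan\<close>)
    then have "f T = f (Q {..<n} \<odot> T) + f (Q {n..} \<odot> T)"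
      using Y.functional_add[OF f, of "Q {..<n} \<odot> T" "Q {n..} \<odot> T"] B by simp
    then have "norm (f (Q {..<n} \<odot> T) - f T) = cmod (f (Q {n..} \<odot> T))" by simp
    also have "\<dots> \<le> ?F * (e / (?F + 1))"
      using B M0[OF n] by (intro Y.functional_bound'[OF f]) simp_all
    also have "\<dots> < e" using F0 e by (simp add: field_simps)
    finally show ?thesis .
  qed
  then show "\<exists>N. \<forall>n\<ge>N. norm (f (Q {..<n} \<odot> T) - f T) < e" by blast
qed

text \<open>Near-norming operators for \<open>u \<in> K\<^sup>\<bottom>\<close> and \<open>v \<in> V\<close> can be cut down to operators
  that act between disjoint groups of blocks, so that their sum is still a contraction.\<close>

lemma annihilator_V_norm:
  assumes u: "u \<in> annihilator Y K" and v: "v \<in> V"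
  shows "nrm (dual_space Y) (u + v) = nrm (dual_space Y) u + nrm (dual_space Y) v"
proof (rule antisym)
  interpret D: cnormed "dual_space Y" by (rule Y.cnormed_dual)
  let ?N = "nrm (dual_space Y)"
  have ud: "u \<in> carr (dual_space Y)" and uK: "\<And>T. T \<in> K \<Longrightarrow> u T = 0" using u by (auto simp: annihilator_def)
  have vd: "v \<in> carr (dual_space Y)" and vl: "\<And>T. T \<in> BO \<Longrightarrow> (\<lambda>n. v (Q {..<n} \<odot> T)) \<longlonglongrightarrow> v T"
    using v by (auto simp: V_def)
  show "?N (u + v) \<le> ?N u + ?N v" by (rule D.norm_triangle[OF ud vd])
  show "?N u + ?N v \<le> ?N (u + v)"
  proof (rule field_le_epsilon)
    fix e0 :: real assume e0: "e0 > 0"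
    \<comment> \<open>Five errors: one for each of the two norming operators, two for replacing
      \<open>S\<close> by \<open>A\<close>, one for the value of \<open>v\<close> at
      \<open>B\<close>.\<close>
    define e where "e = e0 / 5"
    have e: "e > 0" using e0 by (simp add: e_def)
    obtain T where T: "T \<in> BO" "nO T \<le> 1" "u T = complex_of_real (cmod (u T))" "?N u - e < cmod (u T)"
      using Y.functional_norming[OF ud e] by auto
    obtain S where S: "S \<in> BO" "nO S \<le> 1" "v S = complex_of_real (cmod (v S))" "?N v - e < cmod (v S)"
      using Y.functional_norming[OF vd e] by auto
    obtain m where m: "cmod (v (Q {..<m} \<odot> S) - v S) < e"
      using LIMSEQ_D[OF vl[OF S(1)] e] by (meson order_refl)
    have d: "e / (?N v + 1) > 0" using e D.norm_ge0[OF vd] by simp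
    obtain n where n: "nO (Q {..<m} \<odot> (S \<odot> Q {n..})) \<le> e / (?N v + 1)"
      using pr_finite_comp_tail[OF finite_cells S(1) d, of m] unfolding pr_cells by (meson order_refl)
    have TQ: "T \<odot> Q {n..} \<in> BO" using T by (intro BO_comp pr_op)
    obtain N0 where N0: "\<And>N. N \<ge> N0 \<Longrightarrow> cmod (v (Q {..<N} \<odot> (T \<odot> Q {n..})) - v (T \<odot> Q {n..})) < e"
      using LIMSEQ_D[OF vl[OF TQ] e] by blast
    define N where "N = max N0 m"
    have N: "m \<le> N" "cmod (v (Q {..<N} \<odot> (T \<odot> Q {n..})) - v (T \<odot> Q {n..})) < e"
      using N0[of N] by (auto simp: N_def)
    \<comment> \<open>\<open>A\<close> maps the first \<open>n\<close> blocks into the first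
      \<open>m\<close>, and \<open>B\<close> maps the blocks from \<open>n\<close> on into those
      from \<open>N\<close> on. As \<open>m \<le> N\<close>, p-th powers of norms add on both sides,
      which makes \<open>A + B\<close> a contraction.\<close>
    define A where "A = Q {..<m} \<odot> (S \<odot> Q {..<n})"
    define B where "B = Q {N..} \<odot> (T \<odot> Q {n..})"
    have AB: "A \<in> BO" "B \<in> BO" using S T by (auto simp: A_def B_def intro!: BO_comp pr_op)
    have AK: "A \<in> K" unfolding A_def using S by (intro compact_head BO_comp pr_op)
    have split: "x = Q {..<k} x + Q {k..} x" if "x \<in> CX" for x k
      using Q_split[OF that, of "{..<k}"] by (simp add: Compl_lessThan)
    have contr: "nO (A + B) \<le> 1"
    proof (rule XX.op_norm_le[OF BO_add[OF AB]])
      fix x assume x: "x \<in> CX"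
      have "(A x) k = 0 \<or> (B x) k = 0" for k
        using N(1) Q_block[OF op_mem[OF S(1)], of "{..<m}" _ k] Q_block[OF op_mem[OF T(1)], of "{N..}" _ k]
        by (auto simp: A_def B_def)
      then have "nX ((A + B) x) powr p = nX (A x) powr p + nX (B x) powr p"
        using norm_powr_add[OF op_mem[OF AB(1)] op_mem[OF AB(2)]] by simp
      also have "\<dots> \<le> nX (Q {..<n} x) powr p + nX (Q {n..} x) powr p"
      proof -
        have "nX (A x) \<le> nX (S (Q {..<n} x))" unfolding A_def using pr_norm_le[OF op_mem[OF S(1)]] by simp
        also have "\<dots> \<le> nX (Q {..<n} x)" using XX.op_norm_bound'[OF S(1) pr_mem order_refl S(2)] by simp
        finally have 1: "nX (A x) \<le> nX (Q {..<n} x)" .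
        have "nX (B x) \<le> nX (T (Q {n..} x))" unfolding B_def using pr_norm_le[OF op_mem[OF T(1)]] by simp
        also have "\<dots> \<le> nX (Q {n..} x)" using XX.op_norm_bound'[OF T(1) pr_mem order_refl T(2)] by simp
        finally show ?thesis using 1 p L.nrm_ge0 by (intro add_mono powr_mono2) auto
      qed
      also have "\<dots> = nX x powr p" using norm_powr_split[OF x, of "{..<n}"] by (simp add: Compl_lessThan)
      finally have "nX ((A + B) x) \<le> nX x" by (rule norm_le_of_powr[OF L.nrm_ge0])
      then show "nX ((A + B) x) \<le> 1 * nX x" by simp
    qed simp
    have uA: "u A = 0" by (rule uK[OF AK])
    \<comment> \<open>\<open>B\<close> differs from \<open>T\<close> by a compact operator: a head
      of an operator plus an operator restricted to finitely many blocks.\<close>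
    have uB: "u B = u T"
    proof -
      let ?C = "Q {..<N} \<odot> (T \<odot> Q {n..}) + T \<odot> Q {..<n}"
      have C: "?C \<in> K"
        by (intro complex_vec.subspace_add[OF compact_subspace] compact_head compact_comp_head TQ T(1))
      have eq: "T x = (B + ?C) x" for x
      proof (cases "x \<in> CX")
        case True
        have "T x = T (Q {..<n} x) + T (Q {n..} x)"
          using bounded_opsD(2)[OF T(1) pr_mem pr_mem] split[OF True, of n] by metis
        also have "T (Q {n..} x) = Q {..<N} (T (Q {n..} x)) + Q {N..} (T (Q {n..} x))"
          by (rule split[OF op_mem[OF T(1)]])
        finally have e: "T x = T (Q {..<n} x) + (Q {..<N} (T (Q {n..} x)) + Q {N..} (T (Q {n..} x)))" .
        show ?thesis unfolding e by (simp add: B_def ac_simps)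
      next
        case False
        have "T 0 = 0" "\<And>G. Q G 0 = 0" using XX.op_zero[OF T(1)] XX.op_zero[OF pr_op(1)] by auto
        then show ?thesis using bounded_opsD(4)[OF T(1) False] False by (simp add: B_def pr_outside)
      qed
      then have "T = B + ?C" by (rule ext)
      then have "u T = u B + u ?C" using Y.functional_add[OF ud, of B ?C] AB(2) compact_BO[OF C] by simp
      then show ?thesis using uK[OF C] by simp
    qed
    \<comment> \<open>One error is due to cutting the range of \<open>S\<close> at \<open>m\<close>,
      where membership in \<open>V\<close> helps, the other to cutting the domain at
      \<open>n\<close>, where the first \<open>m\<close> rows of \<open>S\<close> have a small
      tail.\<close>
    have vA: "cmod (v A - v S) \<le> 2 * e"
    proof -
      let ?R = "Q {..<m} \<odot> (S \<odot> Q {n..})"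
      have R: "?R \<in> BO" using S by (intro BO_comp pr_op)
      have eq: "(Q {..<m} \<odot> S) x = (A + ?R) x" for x
      proof (cases "x \<in> CX")
        case True
        have "S x = S (Q {..<n} x) + S (Q {n..} x)"
          using bounded_opsD(2)[OF S(1) pr_mem pr_mem] split[OF True, of n] by metis
        then show ?thesis using bounded_opsD(2)[OF pr_op(1) op_mem[OF S(1)] op_mem[OF S(1)]] by (simp add: A_def)
      next
        case False
        have "S 0 = 0" "\<And>G. Q G 0 = 0" using XX.op_zero[OF S(1)] XX.op_zero[OF pr_op(1)] by auto
        then show ?thesis using bounded_opsD(4)[OF S(1) False] False by (simp add: A_def pr_outside)
      qed
      then have "Q {..<m} \<odot> S = A + ?R" by (rule ext)
      then have "v (Q {..<m} \<odot> S) = v A + v ?R" using Y.functional_add[OF vd, of A ?R] AB(1) R by simp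
      then have "v A - v S = (v (Q {..<m} \<odot> S) - v S) - v ?R" by simp
      then have "cmod (v A - v S) \<le> cmod (v (Q {..<m} \<odot> S) - v S) + cmod (v ?R)"
        using norm_triangle_ineq4 by metis
      moreover have "cmod (v ?R) \<le> ?N v * (e / (?N v + 1))"
        using R n by (intro Y.functional_bound'[OF vd]) simp_all
      moreover have "?N v * (e / (?N v + 1)) \<le> e" using D.norm_ge0[OF vd] e by (simp add: field_simps)
      ultimately show ?thesis using m by simp
    qed
    have vB: "cmod (v B) \<le> e"
    proof -
      let ?R = "Q {..<N} \<odot> (T \<odot> Q {n..})"
      have R: "?R \<in> BO" by (rule BO_comp(1)[OF pr_op(1) TQ])
      have "(T \<odot> Q {n..}) x = (?R + B) x" for x
        using split[OF op_mem[OF TQ], of x N] by (simp add: B_def)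
      then have "T \<odot> Q {n..} = ?R + B" by (rule ext)
      then have "v (T \<odot> Q {n..}) = v ?R + v B" using Y.functional_add[OF vd, of ?R B] AB(2) R by simp
      then show ?thesis using N(2) by (simp add: norm_minus_commute)
    qed
    have "(u + v) (A + B) = u T + v S + ((v A - v S) + v B)"
      using Y.functional_add[OF ud, of A B] Y.functional_add[OF vd, of A B] AB uA uB by simp
    then have eq: "complex_of_real (cmod (u T) + cmod (v S)) = (u + v) (A + B) - ((v A - v S) + v B)"
      using T(3) S(3) by simp
    have "cmod (u T) + cmod (v S) = cmod ((u + v) (A + B) - ((v A - v S) + v B))"
      unfolding eq[symmetric] norm_of_real by simp
    also have "\<dots> \<le> cmod ((u + v) (A + B)) + (cmod (v A - v S) + cmod (v B))"
      by (intro order_trans[OF norm_triangle_ineq4] add_left_mono norm_triangle_ineq)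
    also have "\<dots> \<le> ?N (u + v) * 1 + (2 * e + e)"
      using vA vB contr BO_add[OF AB] by (intro add_mono Y.functional_bound'[OF D.mem_add[OF ud vd]]) simp_all
    finally show "?N u + ?N v \<le> ?N (u + v) + e0" using T(4) S(4) by (simp add: e_def)
  qed
qed

theorem compact_M_ideal: "M_ideal Y K"
  unfolding M_ideal_def
proof (intro conjI exI[of _ V])
  interpret D: cnormed "dual_space Y" by (rule Y.cnormed_dual)
  show "K \<subseteq> carr Y" using compact_BO by auto
  show Vd: "V \<subseteq> carr (dual_space Y)" by (auto simp: V_def)
  show "l1_direct_sum (dual_space Y) (annihilator Y K) V"
    unfolding l1_direct_sum_def
  proof (intro conjI ballI annihilator_V_norm V_subspace Y.annihilator_subspace)
    show "annihilator Y K \<inter> V = {0}"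
    proof
      show "annihilator Y K \<inter> V \<subseteq> {0}"
      proof
        fix f assume f: "f \<in> annihilator Y K \<inter> V"
        have "f T = 0" for T
        proof (cases "T \<in> BO")
          case True
          have "(\<lambda>n. f (Q {..<n} \<odot> T)) \<longlonglongrightarrow> f T" using f True by (auto simp: V_def)
          moreover have "f (Q {..<n} \<odot> T) = 0" for n
            using f compact_head[OF True] by (auto simp: annihilator_def)
          ultimately show ?thesis by (simp add: LIMSEQ_const_iff)
        next
          case False
          then show ?thesis using f by (auto simp: annihilator_def carr_op_space[of Y] dest: bounded_opsD(4))
        qed
        then show "f \<in> {0}" by (simp add: fun_eq_iff)
      qed
      show "{0} \<subseteq> annihilator Y K \<inter> V"
        using complex_vec.subspace_0[OF V_subspace] complex_vec.subspace_0[OF Y.annihilator_subspace] by blast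
    qed
    show "carr (dual_space Y) = {u + v |u v. u \<in> annihilator Y K \<and> v \<in> V}"
    proof (intro equalityI subsetI)
      fix f assume f: "f \<in> carr (dual_space Y)"
      obtain g where g: "g \<in> V" "\<And>T. T \<in> BO \<Longrightarrow> (\<lambda>n. f (Q {..<n} \<odot> T)) \<longlonglongrightarrow> g T"
        using V_part[OF f] by blast
      have gd: "g \<in> carr (dual_space Y)" using g Vd by auto
      have "(f - g) T = 0" if "T \<in> K" for T
        using LIMSEQ_unique[OF functional_head_compact[OF f that] g(2)[OF compact_BO[OF that]]] by simp
      then have "f - g \<in> annihilator Y K" using D.mem_diff[OF f gd] by (simp add: annihilator_def)
      moreover have "f = (f - g) + g" by simp
      ultimately show "f \<in> {u + v |u v. u \<in> annihilator Y K \<and> v \<in> V}" using g(1) by blast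
    next
      fix f assume "f \<in> {u + v |u v. u \<in> annihilator Y K \<and> v \<in> V}"
      then show "f \<in> carr (dual_space Y)" using Vd D.mem_add by (auto simp: annihilator_def)
    qed
  qed
qed (rule compact_subspace compact_closed)+

end

section \<open>M-ideals beyond the compact operators\<close>


context lp_lq
begin

text \<open>Embeds scalar sequences as first coordinates. Since a block supported in one coordinate
  has the modulus of that coordinate as its norm, this is an isometric copy of l_p inside the space,
  whatever q is.\<close>

definition fcv :: "(nat \<Rightarrow> complex) \<Rightarrow> nat \<Rightarrow> nat \<Rightarrow> complex"
  where "fcv s n i = (if i = 0 then s n else 0)"

lemma block_fcv: "bn n (fcv s n) = cmod (s n)"
proof -
  have "bn n (fcv s n) powr q = cmod (s n) powr q"
    unfolding block_powr using q by (simp add: fcv_def if_distrib[of "\<lambda>x. cmod x powr q"] sum.delta cong: if_cong)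
  then have "(bn n (fcv s n) powr q) powr (1/q) = (cmod (s n) powr q) powr (1/q)" by (rule arg_cong)
  then show ?thesis using q block_ge0 by (simp add: powr_powr)
qed

lemma fcv_mem:
  assumes "0 \<le> C" "\<And>N. (\<Sum>n<N. cmod (s n) powr p) \<le> C powr p"
  shows "fcv s \<in> CX" "nX (fcv s) \<le> C"
proof -
  have 1: "fcv s n \<in> carr (lq_fin q (Suc n))" for n by (auto simp: block_mem_iff fcv_def)
  have 2: "(\<Sum>n<N. bn n (fcv s n) powr p) \<le> C powr p" for N using assms(2) by (simp add: block_fcv)
  show "fcv s \<in> CX" "nX (fcv s) \<le> C" by (rule L.memI[OF 1 assms(1) 2])+
qed

text \<open>Turns a sequence of functionals with a p-summability bound into an operator with values
  in the copy of l_p.\<close>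

lemma fcv_op:
  assumes C: "0 \<le> C"
    and add: "\<And>x y n. x \<in> CX \<Longrightarrow> y \<in> CX \<Longrightarrow> F (x + y) n = F x n + F y n"
    and scale: "\<And>x c n. x \<in> CX \<Longrightarrow> F (c *\<^sub>C x) n = c * F x n"
    and bnd: "\<And>x N. x \<in> CX \<Longrightarrow> (\<Sum>n<N. cmod (F x n) powr p) \<le> (C * nX x) powr p"
  shows "(\<lambda>x. if x \<in> CX then fcv (F x) else 0) \<in> BO"
    "nO (\<lambda>x. if x \<in> CX then fcv (F x) else 0) \<le> C"
proof -
  have m: "fcv (F x) \<in> CX" "nX (fcv (F x)) \<le> C * nX x" if "x \<in> CX" for x
    using C L.nrm_ge0[of x] by (intro fcv_mem[OF _ bnd[OF that]]; simp)+
  show B: "(\<lambda>x. if x \<in> CX then fcv (F x) else 0) \<in> BO"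
  proof (rule bounded_opsI[where K = C])
    fix x y assume "x \<in> CX" "y \<in> CX"
    then show "(if x + y \<in> CX then fcv (F (x + y)) else 0) = (if x \<in> CX then fcv (F x) else 0) + (if y \<in> CX then fcv (F y) else 0)"
      by (simp add: X.mem_add) (simp add: fun_eq_iff fcv_def add)
  next
    fix c x assume x: "x \<in> CX"
    have "fcv (F (c *\<^sub>C x)) n i = (c *\<^sub>C fcv (F x)) n i" for n i
      by (simp add: fcv_def scale[OF x] scaleC_fun_apply[of c "fcv (F x)"] scaleC_fun_apply[of c "fcv (F x) n"] scaleC_complex_def)
    then have "fcv (F (c *\<^sub>C x)) = c *\<^sub>C fcv (F x)" by (intro ext)
    then show "(if c *\<^sub>C x \<in> CX then fcv (F (c *\<^sub>C x)) else 0) = c *\<^sub>C (if x \<in> CX then fcv (F x) else 0)"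
      using x by (simp only: X.mem_scale if_True)
  qed (use m in auto)
  show "nO (\<lambda>x. if x \<in> CX then fcv (F x) else 0) \<le> C"
    by (rule XX.op_norm_le[OF B C]) (use m in auto)
qed

definition P1 :: "(nat \<Rightarrow> nat \<Rightarrow> complex) \<Rightarrow> nat \<Rightarrow> nat \<Rightarrow> complex"
  where "P1 = pr (UNIV \<times> {0})"

lemma rank_one_op:
  assumes f: "f \<in> carr (dual_space X)" and z: "z \<in> CX"
  shows "(\<lambda>x. f x *\<^sub>C z) \<in> BO"
proof (rule bounded_opsI[where K = "nrm (dual_space X) f * nX z"])
  show "nX (f x *\<^sub>C z) \<le> nrm (dual_space X) f * nX z * nX x" if "x \<in> CX" for x
    using mult_right_mono[OF X.functional_bound[OF f that] L.nrm_ge0[of z]] X.norm_scale[OF z, of "f x"]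
    by (simp add: ac_simps)
  show "f x *\<^sub>C z = 0" if "x \<notin> CX" for x
    using f that by (simp add: carr_op_space[of X] bounded_opsD(4))
qed (use z in \<open>simp_all add: X.mem X.functional_add[OF f] X.functional_scale[OF f] scaleC_add_left\<close>)

lemma ex_norming_functional:
  assumes w: "w \<in> CX" "nX w > 0"
  obtains f where "f \<in> carr (dual_space X)" "\<And>x. x \<in> CX \<Longrightarrow> cmod (f x) \<le> nX x / nX w" "f w = 1"
proof -
  obtain F :: "(nat \<Rightarrow> nat \<Rightarrow> complex) \<Rightarrow> complex" where F:
    "\<And>x y. x \<in> CX \<Longrightarrow> y \<in> CX \<Longrightarrow> F (x + y) = F x + F y"
    "\<And>c x. x \<in> CX \<Longrightarrow> F (c *\<^sub>C x) = c * F x"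
    "\<And>x. x \<in> CX \<Longrightarrow> cmod (F x) \<le> nX x / nX w"
    "\<And>d. d \<in> {0} \<Longrightarrow> F d = 0"
    "1 \<le> Re (F w)"
    "\<And>x. x \<notin> CX \<Longrightarrow> F x = 0"
  proof (rule hahn_banach[OF X.subspace, where p = "\<lambda>x. nX x / nX w" and w = w and D = "{0}"])
    show "{0} \<subseteq> CX" by (simp add: X.mem_zero)
    show "nX (x + y) / nX w \<le> nX x / nX w + nX y / nX w" if "x \<in> CX" "y \<in> CX" for x y
      using X.norm_triangle[OF that] w(2) by (simp add: field_simps)
    show "1 \<le> nX (w + d) / nX w" if "d \<in> {0}" for d using that w by simp
  qed (use w X.norm_scale in auto)
  have "F \<in> carr (dual_space X)"
    by (rule X.functionalI[where K = "1 / nX w"]) (use F in auto)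
  moreover have "F w = 1"
  proof -
    have "cmod (F w) \<le> 1" using F(3)[OF w(1)] w(2) by simp
    then have "(Re (F w))\<^sup>2 + (Im (F w))\<^sup>2 \<le> 1" by (simp add: cmod_def)
    moreover have "1 \<le> (Re (F w))\<^sup>2" using F(5) by (simp add: one_le_power)
    ultimately have "(Im (F w))\<^sup>2 \<le> 0" by linarith
    then have "Im (F w) = 0" by simp
    moreover have "Re (F w) \<le> 1" using \<open>cmod (F w) \<le> 1\<close> complex_Re_le_cmod[of "F w"] by linarith
    ultimately show ?thesis using F(5) by (simp add: complex_eq_iff)
  qed
  ultimately show ?thesis using that F(3) by blast
qed

section \<open>M-ideals as closed two-sided ideals\<close>

context
  fixes J assumes M: "M_ideal Y J"
begin

lemma J_BO: "T \<in> J \<Longrightarrow> T \<in> BO"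
  using Y.M_idealD(1)[OF M] by auto

lemma J_sub: "csubspace J"
  by (rule Y.M_idealD(2)[OF M])

lemmas J_add = complex_vec.subspace_add[OF J_sub]
lemmas J_diff = complex_vec.subspace_diff[OF J_sub]
lemmas J_scale = complex_vec.subspace_scale[OF J_sub]
lemmas J_left = M_ideal_two_sided(1)[OF M]
lemmas J_right = M_ideal_two_sided(2)[OF M]

lemma J_limit: "T \<in> BO \<Longrightarrow> (\<And>e. e > 0 \<Longrightarrow> \<exists>S\<in>J. nO (T - S) < e) \<Longrightarrow> T \<in> J"
  using Y.closedin_limit[OF Y.M_idealD(3)[OF M], of T] by simp

text \<open>A nonzero operator placed between two suitable rank-one operators becomes a nonzero
  multiple of a given coordinate projection.\<close>

lemma single_in_J:
  assumes ne: "J \<noteq> {0}" and i: "i \<le> n"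
  shows "pr {(n, i)} \<in> J"
proof -
  obtain T where T: "T \<in> J" "T \<noteq> 0" using ne complex_vec.subspace_0[OF J_sub] by blast
  then obtain x m j where nz: "T x m j \<noteq> 0" by (metis ext zero_fun_apply)
  have TB: "T \<in> BO" by (rule J_BO[OF T(1)])
  have x: "x \<in> CX"
  proof (rule ccontr)
    assume "x \<notin> CX"
    from bounded_opsD(4)[OF TB this] have "T x m j = 0" by simp
    with nz show False by simp
  qed
  define \<alpha> where "\<alpha> = T x m j"
  \<comment> \<open>Reading the coordinate after \<open>pr UNIV\<close> makes the functional vanish
    off the carrier, as the encoding of functionals demands.\<close>
  define A where "A = (\<lambda>y. (pr UNIV y n i) *\<^sub>C x)"
  define B where "B = (\<lambda>y. (pr UNIV y m j) *\<^sub>C ee n i)"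
  have A: "A \<in> BO" unfolding A_def by (rule rank_one_op[OF coord_functional[OF pr_op(1)] x])
  have B: "B \<in> BO" unfolding B_def by (rule rank_one_op[OF coord_functional[OF pr_op(1)] ee_mem[OF i]])
  have "(B \<odot> (T \<odot> A)) y = \<alpha> *\<^sub>C pr {(n, i)} y" for y
  proof (cases "y \<in> CX")
    case True
    have "T (A y) = y n i *\<^sub>C T x"
      by (simp add: A_def pr_apply[OF True] bounded_opsD(3)[OF TB x])
    then have "pr UNIV (T (A y)) m j = y n i * \<alpha>"
      by (simp add: pr_apply[OF X.mem_scale[OF op_mem[OF TB]]] scaleC_fun_apply scaleC_complex_def \<alpha>_def)
    then show ?thesis
      by (simp add: B_def pr_single[OF True i] mult.commute)
  next
    case False
    then show ?thesis
      by (simp add: bounded_opsD(4)[OF A False] XX.op_zero[OF TB] XX.op_zero[OF B] pr_outside)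
  qed
  then have "B \<odot> (T \<odot> A) = \<alpha> *\<^sub>C pr {(n, i)}"
    by (intro ext) (simp add: scaleC_fun_apply[of \<alpha> "pr {(n, i)}"])
  then have "(1/\<alpha>) *\<^sub>C (B \<odot> (T \<odot> A)) = pr {(n, i)}"
    using nz by (simp add: \<alpha>_def)
  moreover have "(1/\<alpha>) *\<^sub>C (B \<odot> (T \<odot> A)) \<in> J" by (intro J_scale J_left[OF B] J_right[OF A] T(1))
  ultimately show ?thesis by simp
qed

lemma finite_in_J:
  assumes "J \<noteq> {0}" "finite S"
  shows "pr S \<in> J"
  using assms(2)
proof induction
  case empty
  have "pr {} = 0" by (rule ext) (simp add: pr_empty)
  then show ?case using complex_vec.subspace_0[OF J_sub] by (simp only:)
next
  case (insert c S)
  obtain n i where c: "c = (n, i)" by force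
  have 1: "pr {c} \<in> J"
  proof (cases "i \<le> n")
    case True
    then show ?thesis using single_in_J[OF assms(1)] c by simp
  next
    case False
    then have "pr {c} = 0" by (intro ext) (simp add: c pr_single_zero)
    then show ?thesis using complex_vec.subspace_0[OF J_sub] by (simp only:)
  qed
  have "pr (insert c S) = pr {c} + pr S" using pr_add[of "{c}" S] insert.hyps(2) by simp
  then show ?case using J_add[OF 1 insert.IH] by (simp only:)
qed

text \<open>The heads of a compact operator lie in the ideal, being products with finite coordinate
  projections, and they converge to it in norm.\<close>

lemma compact_in_J:
  assumes "J \<noteq> {0}" and T: "T \<in> K"
  shows "T \<in> J"
proof (rule J_limit)
  show TB: "T \<in> BO" by (rule compact_BO[OF T])
  fix e :: real assume e: "e > 0"
  obtain M where Mb: "nO (Q {M..} \<odot> T) \<le> e/2" using compactD[OF T half_gt_zero[OF e]] by blast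
  have "T x - Q {..<M} (T x) = Q {M..} (T x)" for x
    using Q_split[OF op_mem[OF TB], of x "{..<M}"] by (simp add: Compl_lessThan algebra_simps)
  then have "T - Q {..<M} \<odot> T = Q {M..} \<odot> T" by (intro ext) simp
  then have "nO (T - Q {..<M} \<odot> T) < e" using Mb e by (simp only:)
  moreover have "Q {..<M} \<odot> T \<in> J"
    using J_right[OF TB finite_in_J[OF assms(1) finite_cells]] by (simp only: pr_cells)
  ultimately show "\<exists>S\<in>J. nO (T - S) < e" by blast
qed

text \<open>The powers of \<open>S\<close> are congruent to \<open>E\<close> modulo \<open>J\<close> and tend to zero.\<close>

lemma idempotent_in_J:
  assumes E: "E \<in> BO" "E \<odot> E = E" and S: "S \<in> BO" "nO S \<le> c" and c: "c < 1" and ES: "E - S \<in> J"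
  shows "E \<in> J"
proof (rule J_limit[OF E(1)])
  fix e :: real assume e: "e > 0"
  have c0: "0 \<le> c" using S XX.op_norm_ge0[OF S(1)] by simp
  \<comment> \<open>The powers start at 1, because the zeroth power is \<open>id\<close>, which does
    not vanish off the carrier.\<close>
  have pow: "(S ^^ Suc n) \<in> BO \<and> nO (S ^^ Suc n) \<le> c ^ Suc n \<and> E - (S ^^ Suc n) \<in> J" for n
  proof (induction n)
    case 0
    have e1: "S ^^ Suc 0 = S" by simp
    show ?case unfolding e1 power_Suc0_right using S ES by blast
  next
    case (Suc n)
    define R where "R = S ^^ Suc n"
    have R: "R \<in> BO" "nO R \<le> c ^ Suc n" "E - R \<in> J" using Suc.IH unfolding R_def by blast+
    have eq: "S ^^ Suc (Suc n) = S \<odot> R" by (simp add: R_def)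
    have "S \<odot> R \<in> BO" by (rule BO_comp(1)[OF S(1) R(1)])
    moreover have "nO (S \<odot> R) \<le> c * c ^ Suc n" by (rule BO_comp_le[OF S(1) R(1) S(2) R(2)])
    moreover have "E - S \<odot> R \<in> J"
    proof -
      have "E - S \<odot> R = (E - S) \<odot> E + S \<odot> (E - R)"
        unfolding comp_diff_left comp_diff_right[OF S(1) E(1) R(1)] E(2) by simp
      also have "\<dots> \<in> J" by (intro J_add J_right[OF E(1) ES] J_left[OF S(1) R(3)])
      finally show ?thesis .
    qed
    ultimately show ?case unfolding eq power_Suc[of c "Suc n"] by blast
  qed
  have "(\<lambda>n. c ^ n) \<longlonglongrightarrow> 0" using c0 c by (intro LIMSEQ_power_zero) simp
  then obtain n where "norm (c ^ n - 0) < e" using LIMSEQ_D[OF _ e] by blast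
  then have cn: "c ^ n < e" using c0 by simp
  have "nO (E - (E - (S ^^ Suc n))) < e"
  proof -
    have "nO (S ^^ Suc n) \<le> c ^ Suc n" using pow by blast
    also have "\<dots> \<le> c ^ n" using c0 c by (simp add: mult_left_le_one_le)
    also note cn
    finally show ?thesis by simp
  qed
  then show "\<exists>S\<in>J. nO (E - S) < e" using pow by blast
qed

end

text \<open>One step of the gliding hump construction for a non-compact operator.\<close>

lemma noncompact_hump:
  assumes T: "T \<in> BO" and d: "d > 0" and big: "\<And>M. d < nO (Q {M..} \<odot> T)" and e: "e > 0"
  shows "\<exists>a b x g. N \<le> a \<and> a < b \<and> x \<in> CX \<and> nX x \<le> 1 \<and> Q {a..<b} x = x \<and>
    g \<in> carr (dual_space X) \<and> (\<forall>y\<in>CX. cmod (g y) \<le> 2 / d * nX (Q {a..<b} y)) \<and> g (T x) = 1 \<and>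
    nO (Q {..<N} \<odot> (T \<odot> Q {a..})) \<le> e \<and> nO (Q {a..} \<odot> (T \<odot> Q {..<N})) \<le> e"
proof -
  obtain a1 where a1: "\<And>M. M \<ge> a1 \<Longrightarrow> nO (Q {..<N} \<odot> (T \<odot> Q {M..})) \<le> e"
    using pr_finite_comp_tail[OF finite_cells T e, of N] unfolding pr_cells by blast
  obtain a2 where a2: "\<And>M. M \<ge> a2 \<Longrightarrow> nO (Q {M..} \<odot> (T \<odot> Q {..<N})) \<le> e"
    using comp_pr_finite_tail[OF finite_cells T e, of N] unfolding pr_cells by blast
  define a where "a = max N (max a1 a2)"
  \<comment> \<open>The budget: d/4 is lost by discarding the first \<open>a\<close> blocks of a
    norming vector, d/8 by cutting it at \<open>b1\<close>, and d/8 by cutting its image at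
    \<open>b\<close>. At least d/2 remains, whence the factor \<open>2 / d\<close> in the bound for
    \<open>g\<close>.\<close>
  have d4: "d/4 > 0" and d8: "d/8 > 0" using d by auto
  obtain M0 where M0: "\<And>M. M \<ge> M0 \<Longrightarrow> nO (Q {M..} \<odot> (T \<odot> Q {..<a})) \<le> d/4"
    using comp_pr_finite_tail[OF finite_cells T d4, of a] unfolding pr_cells by blast
  define M where "M = max a M0"
  have TQ: "Q {M..} \<odot> T \<in> BO" "Q {M..} \<odot> (T \<odot> Q {..<a}) \<in> BO" using T by (auto intro!: BO_comp pr_op)
  obtain x0 where x0: "x0 \<in> CX" "nX x0 \<le> 1" "d < nX ((Q {M..} \<odot> T) x0)"
    using XX.op_norming[OF TQ(1), of "nO (Q {M..} \<odot> T) - d"] big[of M] by auto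
  define x1 where "x1 = Q {a..} x0"
  have x1: "x1 \<in> CX" "nX x1 \<le> 1" using x0 pr_norm_le[OF x0(1), of "{a..} \<times> UNIV"] by (auto simp: x1_def pr_mem)
  have sp: "x0 = Q {..<a} x0 + x1" using Q_split[OF x0(1), of "{..<a}"] by (simp add: x1_def Compl_lessThan)
  have "Q {M..} (T x0) = Q {M..} (T (Q {..<a} x0)) + Q {M..} (T x1)"
    using bounded_opsD(2)[OF T pr_mem x1(1)] bounded_opsD(2)[OF pr_op(1) op_mem[OF T] op_mem[OF T]] sp by metis
  then have "nX (Q {M..} (T x0)) \<le> nX (Q {M..} (T (Q {..<a} x0))) + nX (Q {M..} (T x1))"
    using X.norm_triangle[OF pr_mem pr_mem] by metis
  moreover have "nX (Q {M..} (T (Q {..<a} x0))) \<le> d/4 * 1"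
    using XX.op_norm_bound'[OF TQ(2) x0(1,2) M0[of M]] by (simp add: M_def)
  ultimately have x1M: "3/4 * d \<le> nX (Q {M..} (T x1))" using x0(3) by simp
  have x1a: "3/4 * d \<le> nX (Q {a..} (T x1))"
    using x1M norm_Q_antimono[OF op_mem[OF T], of "{M..}" "{a..}" x1] by (simp add: M_def)
  have dT: "d / (8 * (nO T + 1)) > 0" using d XX.op_norm_ge0[OF T] by simp
  obtain b1 where b1: "nX (Q {b1..} x1) \<le> d / (8 * (nO T + 1))" using tail_tendsto_0[OF x1(1) dT] by blast
  define x where "x = Q {..<b1} x1"
  have x: "x \<in> CX" "nX x \<le> 1" using x1 pr_norm_le[OF x1(1), of "{..<b1} \<times> UNIV"] by (auto simp: x_def pr_mem)
  have sp1: "x1 = x + Q {b1..} x1" using Q_split[OF x1(1), of "{..<b1}"] by (simp add: x_def Compl_lessThan)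
  have "Q {a..} (T x1) = Q {a..} (T x) + Q {a..} (T (Q {b1..} x1))"
    using bounded_opsD(2)[OF T x(1) pr_mem] bounded_opsD(2)[OF pr_op(1) op_mem[OF T] op_mem[OF T]] sp1 by metis
  then have "nX (Q {a..} (T x1)) \<le> nX (Q {a..} (T x)) + nX (Q {a..} (T (Q {b1..} x1)))"
    using X.norm_triangle[OF pr_mem pr_mem] by metis
  moreover have "nX (Q {a..} (T (Q {b1..} x1))) \<le> d/8"
  proof -
    have "nX (Q {a..} (T (Q {b1..} x1))) \<le> nX (T (Q {b1..} x1))" by (rule pr_norm_le[OF op_mem[OF T]])
    also have "\<dots> \<le> nO T * (d / (8 * (nO T + 1)))" by (rule XX.op_norm_bound'[OF T pr_mem b1 order_refl])
    also have "\<dots> \<le> d/8" using d XX.op_norm_ge0[OF T] by (simp add: field_simps)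
    finally show ?thesis .
  qed
  ultimately have xa: "5/8 * d \<le> nX (Q {a..} (T x))" using x1a by simp
  obtain b2 where b2: "\<And>n. n \<ge> b2 \<Longrightarrow> nX (Q {n..} (T x)) \<le> d/8" using tail_tendsto_0[OF op_mem[OF T] d8] by blast
  define b where "b = max (Suc a) (max b1 b2)"
  define w where "w = Q {a..<b} (T x)"
  have w: "w \<in> CX" by (simp add: w_def pr_mem)
  have ab: "a < b" by (auto simp: b_def)
  have "Q {a..} (T x) = w + Q {b..} (T x)"
    unfolding w_def using ab by (auto simp: fun_eq_iff pr_apply[OF op_mem[OF T]])
  then have "nX (Q {a..} (T x)) \<le> nX w + nX (Q {b..} (T x))"
    using X.norm_triangle[OF w pr_mem] by metis
  moreover have "nX (Q {b..} (T x)) \<le> d/8" by (rule b2) (simp add: b_def)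
  ultimately have wd: "d/2 \<le> nX w" using xa by linarith
  then have w0: "nX w > 0" using d by simp
  obtain f where f: "f \<in> carr (dual_space X)" "\<And>x. x \<in> CX \<Longrightarrow> cmod (f x) \<le> nX x / nX w" "f w = 1"
    using ex_norming_functional[OF w w0] by blast
  define g where "g = (\<lambda>y. f (Q {a..<b} y))"
  have g_le: "cmod (g y) \<le> 2 / d * nX (Q {a..<b} y)" if "y \<in> CX" for y
  proof -
    have "cmod (g y) \<le> nX (Q {a..<b} y) / nX w" unfolding g_def by (rule f(2)[OF pr_mem])
    also have "\<dots> \<le> nX (Q {a..<b} y) / (d/2)" using wd d L.nrm_ge0 by (intro divide_left_mono) auto
    finally show ?thesis by (simp add: ac_simps)
  qed
  have g: "g \<in> carr (dual_space X)"
  proof (rule X.functionalI[where K = "2/d"])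
    show "cmod (g y) \<le> 2 / d * nX y" if "y \<in> CX" for y
      using g_le[OF that] mult_left_mono[OF pr_norm_le[OF that, of "{a..<b} \<times> UNIV"], of "2/d"] d by simp
  qed (simp_all add: g_def bounded_opsD(2)[OF pr_op(1)] bounded_opsD(3)[OF pr_op(1)] pr_mem
      X.functional_add[OF f(1)] X.functional_scale[OF f(1)] pr_outside X.functional_zero[OF f(1)])
  have "Q {a..<b} x = x"
  proof -
    have "x = pr (({..<b1} \<times> UNIV) \<inter> ({a..} \<times> UNIV)) x0" by (simp add: x_def x1_def pr_pr)
    then have "Q {a..<b} x = pr (({a..<b} \<times> UNIV) \<inter> (({..<b1} \<times> UNIV) \<inter> ({a..} \<times> UNIV))) x0" by (simp add: pr_pr)
    also have "({a..<b} \<times> UNIV) \<inter> (({..<b1} \<times> UNIV) \<inter> ({a..} \<times> UNIV)) = ({..<b1} \<times> UNIV) \<inter> ({a..} \<times> (UNIV :: nat set))"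
      by (auto simp: b_def)
    finally show ?thesis by (simp add: x_def x1_def pr_pr)
  qed
  moreover have "g (T x) = 1" using f(3) by (simp add: g_def w_def)
  moreover have "N \<le> a" "nO (Q {..<N} \<odot> (T \<odot> Q {a..})) \<le> e" "nO (Q {a..} \<odot> (T \<odot> Q {..<N})) \<le> e"
    using a1[of a] a2[of a] by (auto simp: a_def)
  ultimately show ?thesis using ab x g g_le by blast
qed

end


section \<open>Assembling the humps to a factorisation of \<open>P1\<close>\<close>

context lp_lq
begin

lemma P1_op: "P1 \<in> BO" "P1 \<odot> P1 = P1"
  by (simp_all add: P1_def pr_op pr_comp)

lemma P1_fcv: "x \<in> CX \<Longrightarrow> P1 x = fcv (\<lambda>n. x n 0)"
  by (auto simp: P1_def fun_eq_iff fcv_def pr_apply)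

text \<open>Blocks \<open>x k\<close> and functionals \<open>g k\<close> supported in the intervals \<open>[a k, b k)\<close>, which lie one after
  the other; \<open>A\<close> maps the \<open>k\<close>-th first coordinate vector to \<open>x k\<close> and \<open>B\<close> collects the values of the \<open>g k\<close>.\<close>

lemma hump_operators:
  fixes N a b :: "nat \<Rightarrow> nat" and x :: "nat \<Rightarrow> nat \<Rightarrow> nat \<Rightarrow> complex"
  assumes Nab: "\<And>k. N k \<le> a k" "\<And>k. a k < b k" "\<And>k. b k = N (Suc k)"
    and x: "\<And>k. x k \<in> CX" "\<And>k. nX (x k) \<le> 1" "\<And>k. Q {a k..<b k} (x k) = x k"
    and g: "\<And>k. g k \<in> carr (dual_space X)" "\<And>k y. y \<in> CX \<Longrightarrow> cmod (g k y) \<le> C * nX (Q {a k..<b k} y)"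
    and C: "C \<ge> 0"
  obtains A B where "A \<in> BO" "nO A \<le> 1" "B \<in> BO"
    "\<And>z. z \<in> CX \<Longrightarrow> B z = fcv (\<lambda>k. g k z)"
    "\<And>y k. y \<in> CX \<Longrightarrow> A (Q {k} y) = y k 0 *\<^sub>C x k"
    "\<And>y k. y \<in> CX \<Longrightarrow> Q {..<N k} (A (Q {..<k} y)) = A (Q {..<k} y)"
    "\<And>y k. y \<in> CX \<Longrightarrow> Q {a (Suc k)..} (A (Q {Suc k..} y)) = A (Q {Suc k..} y)"
proof -
  have ab: "a k < b k" "b k \<le> a (Suc k)" for k using Nab[of k] Nab(1)[of "Suc k"] by auto
  have NSN: "N k \<le> N (Suc k)" for k using Nab[of k] by linarith
  have bN: "b k \<le> N l" if "k < l" for k l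
    using lift_Suc_mono_le[of N "Suc k" l] NSN that by (simp add: Nab(3) Suc_le_eq)
  have aS: "a k < a (Suc k)" for k using ab[of k] by simp
  then have smono: "strict_mono a" by (simp add: strict_mono_Suc_iff)
  have ba: "b k \<le> a l" if "k < l" for k l
    using bN[OF that] Nab(1)[of l] by simp
  have ka: "k \<le> a k" for k using smono by (rule strict_mono_imp_increasing)
  have xz: "x k n = 0" if "\<not> (a k \<le> n \<and> n < b k)" for k n
  proof -
    have "x k n = Q {a k..<b k} (x k) n" by (simp add: x(3))
    also have "\<dots> = 0" using that by (auto simp: Q_block[OF x(1)])
    finally show ?thesis .
  qed
  have bx: "(\<Sum>n<M. bn n (x k n) powr p) \<le> 1" for k M
  proof -
    have "(\<Sum>n<M. bn n (x k n) powr p) \<le> nX (x k) powr p" by (rule L.sum_le_nrm_powr[OF x(1)]) simp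
    also have "\<dots> \<le> 1 powr p" using x(2) p L.nrm_ge0 by (intro powr_mono2) auto
    finally show ?thesis by simp
  qed
  \<comment> \<open>Since \<open>k \<le> a k\<close>, the vector \<open>x k\<close> vanishes on
    block n for k > n, so the finite sum misses nothing; on each block at most one
    \<open>x k\<close> is nonzero.\<close>
  define A0 where "A0 y n i = (\<Sum>k\<le>n. y k 0 * x k n i)" for y :: "nat \<Rightarrow> nat \<Rightarrow> complex" and n i
  have unique: "k = l" if "x k n \<noteq> 0" "x l n \<noteq> 0" for k l n
  proof (rule ccontr)
    assume "k \<noteq> l"
    have "a k \<le> n" "n < b k" "a l \<le> n" "n < b l" using xz that by blast+
    then show False using ba[of k l] ba[of l k] \<open>k \<noteq> l\<close> by (meson leD le_trans linorder_neqE_nat not_less)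
  qed
  have A0_at: "A0 y n = (\<lambda>i. y k 0 * x k n i)" if "x k n \<noteq> 0" for y n k
  proof (rule ext)
    fix i
    have kn: "k \<le> n" using that xz[of k n] ka[of k] by (meson le_trans)
    have "A0 y n i = (\<Sum>l\<in>{k}. y l 0 * x l n i)"
      unfolding A0_def
    proof (rule sum.mono_neutral_right)
      show "\<forall>l\<in>{..n} - {k}. y l 0 * x l n i = 0"
      proof
        fix l assume "l \<in> {..n} - {k}"
        then have "x l n = 0" using unique[OF that, of l] by auto
        then show "y l 0 * x l n i = 0" by simp
      qed
    qed (use kn in auto)
    then show "A0 y n i = y k 0 * x k n i" by simp
  qed
  have A0_zero: "A0 y n = 0" if "\<And>k. y k 0 \<noteq> 0 \<Longrightarrow> x k n = 0" for y n
  proof (rule ext)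
    fix i
    have z: "y k 0 * x k n i = 0" for k
    proof (cases "y k 0 = 0")
      case False
      then have "x k n = 0" by (rule that)
      then show ?thesis by simp
    qed simp
    show "A0 y n i = 0 i" unfolding A0_def by (simp only: z sum.neutral_const zero_fun_apply)
  qed
  have block_scale: "bn n (\<lambda>i. c * z i) = cmod c * bn n z" for c n z
  proof -
    have "bn n (\<lambda>i. c * z i) powr q = (cmod c * bn n z) powr q"
      using block_ge0[of n z] by (simp add: block_powr norm_mult powr_mult sum_distrib_left)
    then have "(bn n (\<lambda>i. c * z i) powr q) powr (1/q) = ((cmod c * bn n z) powr q) powr (1/q)" by (rule arg_cong)
    then show ?thesis using q block_ge0 by (simp add: powr_powr)
  qed
  have A0_mem: "A0 y \<in> CX" "nX (A0 y) \<le> nX y" if y: "y \<in> CX" for y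
  proof -
    have 1: "A0 y n \<in> carr (lq_fin q (Suc n))" for n
      using coord_zero[OF x(1)] by (auto simp: block_mem_iff A0_def)
    have ble: "bn n (A0 y n) powr p \<le> (\<Sum>k<M. cmod (y k 0) powr p * bn n (x k n) powr p)" if "n < M" for n M
    proof (cases "\<exists>k. x k n \<noteq> 0")
      case True
      then obtain k where k: "x k n \<noteq> 0" by blast
      have kn: "k < M" using k xz[of k n] ka[of k] that by (meson le_less_trans le_trans)
      have "bn n (A0 y n) powr p = cmod (y k 0) powr p * bn n (x k n) powr p"
        unfolding A0_at[OF k] block_scale using block_ge0 by (simp add: powr_mult)
      also have "\<dots> \<le> (\<Sum>k<M. cmod (y k 0) powr p * bn n (x k n) powr p)"
        using kn by (intro member_le_sum) auto
      finally show ?thesis .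
    next
      case False
      then have "A0 y n = 0" by (intro A0_zero) auto
      then show ?thesis by (simp add: sum_nonneg)
    qed
    have 2: "(\<Sum>n<M. bn n (A0 y n) powr p) \<le> nX y powr p" for M
    proof -
      have "(\<Sum>n<M. bn n (A0 y n) powr p) \<le> (\<Sum>n<M. \<Sum>k<M. cmod (y k 0) powr p * bn n (x k n) powr p)"
        by (rule sum_mono, rule ble) simp
      also have "\<dots> = (\<Sum>k<M. cmod (y k 0) powr p * (\<Sum>n<M. bn n (x k n) powr p))"
        by (subst sum.swap) (simp add: sum_distrib_left)
      also have "\<dots> \<le> (\<Sum>k<M. bn k (y k) powr p * 1)"
        using p by (intro sum_mono mult_mono powr_mono2 bx coord_le_block) (auto simp: sum_nonneg)
      also have "\<dots> \<le> nX y powr p" using L.sum_le_nrm_powr[OF y, of "{..<M}"] by simp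
      finally show ?thesis .
    qed
    show "A0 y \<in> CX" "nX (A0 y) \<le> nX y" by (rule L.memI[OF 1 L.nrm_ge0 2])+
  qed
  define A where "A y = (if y \<in> CX then A0 y else 0)" for y
  have A: "A \<in> BO"
  proof (rule bounded_opsI[where K = 1])
    show "A (y + z) = A y + A z" if "y \<in> CX" "z \<in> CX" for y z
    proof -
      have "A0 (y + z) n i = A0 y n i + A0 z n i" for n i
        by (simp add: A0_def sum.distrib distrib_right)
      then have "A0 (y + z) = A0 y + A0 z" by (intro ext) simp
      then show ?thesis using that by (simp only: A_def X.mem_add if_True)
    qed
    show "A (c *\<^sub>C y) = c *\<^sub>C A y" if "y \<in> CX" for c y
    proof -
      have "A0 (c *\<^sub>C y) n i = (c *\<^sub>C A0 y) n i" for n i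
        by (simp add: A0_def sum_distrib_left scaleC_fun_def scaleC_complex_def mult.assoc)
      then have "A0 (c *\<^sub>C y) = c *\<^sub>C A0 y" by (intro ext)
      then show ?thesis using that by (simp only: A_def X.mem_scale if_True)
    qed
  qed (use A0_mem in \<open>auto simp: A_def\<close>)
  have nA: "nO A \<le> 1" by (rule XX.op_norm_le[OF A]) (use A0_mem in \<open>auto simp: A_def\<close>)
  define B where "B = (\<lambda>z. if z \<in> CX then fcv (\<lambda>k. g k z) else 0)"
  \<comment> \<open>The intervals follow one another, so the p-th powers of the norms of the pieces
    add up to at most that of the whole. This bounds \<open>B\<close> on p-th powers.\<close>
  have partial: "(\<Sum>k<M. nX (Q {a k..<b k} z) powr p) \<le> nX (Q {..<a M} z) powr p" if z: "z \<in> CX" for z M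
  proof (induction M)
    case 0
    then show ?case by simp
  next
    case (Suc M)
    have "Q {..<a (Suc M)} z = Q {..<a M} z + Q {a M..<a (Suc M)} z"
      using aS[of M] by (auto simp: fun_eq_iff pr_apply[OF z])
    then have "nX (Q {..<a (Suc M)} z) powr p = nX (Q {..<a M} z) powr p + nX (Q {a M..<a (Suc M)} z) powr p"
      using norm_powr_add[OF pr_mem pr_mem, of "{..<a M} \<times> UNIV" z "{a M..<a (Suc M)} \<times> UNIV" z]
      by (simp add: Q_block[OF z])
    moreover have "nX (Q {a M..<b M} z) powr p \<le> nX (Q {a M..<a (Suc M)} z) powr p"
      using ab(2)[of M] z p L.nrm_ge0 by (intro powr_mono2 norm_Q_antimono) auto
    ultimately show ?case using Suc.IH by simp
  qed
  have bnd: "(\<Sum>k<M. cmod (g k z) powr p) \<le> (C * nX z) powr p" if z: "z \<in> CX" for z M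
  proof -
    have "(\<Sum>k<M. cmod (g k z) powr p) \<le> (\<Sum>k<M. (C * nX (Q {a k..<b k} z)) powr p)"
      using g(2)[OF z] p by (intro sum_mono powr_mono2) auto
    also have "\<dots> = C powr p * (\<Sum>k<M. nX (Q {a k..<b k} z) powr p)"
      using C L.nrm_ge0 by (simp add: powr_mult sum_distrib_left)
    also have "\<dots> \<le> C powr p * nX z powr p"
    proof -
      have "nX (Q {..<a M} z) powr p \<le> nX z powr p"
        using p L.nrm_ge0 by (intro powr_mono2 pr_norm_le[OF z]) auto
      then show ?thesis using partial[OF z, of M] by (intro mult_left_mono) auto
    qed
    also have "\<dots> = (C * nX z) powr p" using C L.nrm_ge0 by (simp add: powr_mult)
    finally show ?thesis .
  qed
  have B: "B \<in> BO" unfolding B_def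
    by (rule fcv_op(1)[OF C _ _ bnd]) (simp_all add: X.functional_add[OF g(1)] X.functional_scale[OF g(1)])
  show ?thesis
  proof (rule that[OF A nA B])
    show "B z = fcv (\<lambda>k. g k z)" if "z \<in> CX" for z using that by (simp add: B_def)
    fix y k assume y: "y \<in> CX"
    have Qy: "Q G y \<in> CX" for G by (rule pr_mem)
    have Ay: "A (Q G y) n = A0 (Q G y) n" for G n by (simp add: A_def Qy)
    have "A (Q {k} y) n = (y k 0 *\<^sub>C x k) n" for n
    proof (cases "x k n = 0")
      case True
      then have "A0 (Q {k} y) n = 0" by (intro A0_zero) (auto simp: pr_apply[OF y] split: if_splits)
      then show ?thesis using True by (simp only: Ay scaleC_fun_apply complex_vec.scale_zero_right)
    next
      case False
      then show ?thesis
        by (simp add: Ay A0_at pr_apply[OF y] fun_eq_iff scaleC_fun_def scaleC_complex_def)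
    qed
    then show "A (Q {k} y) = y k 0 *\<^sub>C x k" by (rule ext)
    have "A (Q {..<k} y) n = 0" if n: "\<not> n < N k" for n
    proof -
      have "A0 (Q {..<k} y) n = 0"
      proof (rule A0_zero)
        fix l assume "Q {..<k} y l 0 \<noteq> 0"
        then have "l < k" by (auto simp: pr_apply[OF y] split: if_splits)
        then show "x l n = 0" using bN[of l k] n by (intro xz) auto
      qed
      then show ?thesis by (simp only: Ay)
    qed
    then have "Q {..<N k} (A (Q {..<k} y)) n = A (Q {..<k} y) n" for n
      by (simp add: Q_block[OF op_mem[OF A]])
    then show "Q {..<N k} (A (Q {..<k} y)) = A (Q {..<k} y)" by (rule ext)
    have "A (Q {Suc k..} y) n = 0" if n: "\<not> a (Suc k) \<le> n" for n
    proof -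
      have "A0 (Q {Suc k..} y) n = 0"
      proof (rule A0_zero)
        fix l assume "Q {Suc k..} y l 0 \<noteq> 0"
        then have "k < l" by (auto simp: pr_apply[OF y] split: if_splits)
        then have "a (Suc k) \<le> a l" using smono by (simp add: strict_mono_less_eq Suc_le_eq)
        then show "x l n = 0" using n by (intro xz) auto
      qed
      then show ?thesis by (simp only: Ay)
    qed
    then have "Q {a (Suc k)..} (A (Q {Suc k..} y)) n = A (Q {Suc k..} y) n" for n
      by (simp add: Q_block[OF op_mem[OF A]])
    then show "Q {a (Suc k)..} (A (Q {Suc k..} y)) = A (Q {Suc k..} y)" by (rule ext)
  qed
qed

text \<open>With \<open>A\<close> and \<open>B\<close> built from the humps,
  \<open>B \<odot> (T \<odot> A)\<close> acts on first coordinates as the identity plus small terms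
  coming from interactions between different humps. It is within 1/2 of \<open>P1\<close>, which
  suffices for the idempotent \<open>P1\<close> to lie in the ideal.\<close>

lemma P1_in_ideal:
  assumes M: "M_ideal Y J" and T: "T \<in> J" "T \<notin> K"
  shows "P1 \<in> J"
proof -
  have TB: "T \<in> BO" by (rule J_BO[OF M T(1)])
  obtain d where d: "d > 0" and big0: "\<And>M0. \<exists>M\<ge>M0. d < nO (Q {M..} \<odot> T)"
    using T(2) TB by (auto simp: compact_iff not_le)
  \<comment> \<open>The norms of the tails decrease, so a bound exceeded by arbitrarily late tails
    is exceeded by all.\<close>
  have big: "d < nO (Q {M..} \<odot> T)" for M
  proof -
    obtain M' where M': "M' \<ge> M" "d < nO (Q {M'..} \<odot> T)" using big0 by blast
    have "nO (Q {M'..} \<odot> T) \<le> nO (Q {M..} \<odot> T)"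
    proof (rule XX.op_norm_le_ball[OF BO_comp(1)[OF pr_op(1) TB]])
      fix x assume x: "x \<in> CX" "nX x \<le> 1"
      have "nX (Q {M'..} (T x)) \<le> nX (Q {M..} (T x))" using M' by (intro norm_Q_antimono op_mem[OF TB]) auto
      also have "\<dots> \<le> nO (Q {M..} \<odot> T)" using XX.op_norm_upper[OF BO_comp(1)[OF pr_op(1) TB] x] by simp
      finally show "nX ((Q {M'..} \<odot> T) x) \<le> nO (Q {M..} \<odot> T)" by simp
    qed
    then show ?thesis using M' by simp
  qed
  \<comment> \<open>The factor d/4 compensates the norm 2/d of the functionals and the two kinds of
    error, from earlier and from later humps; exactly \<open>(1/2) ^ (l + 2)\<close> is left in
    coordinate l.\<close>
  define \<epsilon> where "\<epsilon> k = d / 4 * (1/2) ^ (k + 2)" for k :: nat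
  have \<epsilon>: "\<epsilon> k > 0" "\<epsilon> (Suc k) \<le> \<epsilon> k" for k using d by (auto simp: \<epsilon>_def)
  have "\<exists>a b x g. N \<le> a \<and> a < b \<and> x \<in> CX \<and> nX x \<le> 1 \<and> Q {a..<b} x = x \<and>
    g \<in> carr (dual_space X) \<and> (\<forall>y\<in>CX. cmod (g y) \<le> 2 / d * nX (Q {a..<b} y)) \<and> g (T x) = 1 \<and>
    nO (Q {..<N} \<odot> (T \<odot> Q {a..})) \<le> \<epsilon> k \<and> nO (Q {a..} \<odot> (T \<odot> Q {..<N})) \<le> \<epsilon> k" for N k
    by (rule noncompact_hump[OF TB d big \<epsilon>(1)])
  then obtain a' b' x' g' where hump: "\<And>N k. N \<le> a' N k \<and> a' N k < b' N k \<and> x' N k \<in> CX \<and> nX (x' N k) \<le> 1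
    \<and> Q {a' N k..<b' N k} (x' N k) = x' N k \<and>
    g' N k \<in> carr (dual_space X) \<and> (\<forall>y\<in>CX. cmod (g' N k y) \<le> 2 / d * nX (Q {a' N k..<b' N k} y)) \<and> g' N k (T (x' N k)) = 1 \<and>
    nO (Q {..<N} \<odot> (T \<odot> Q {a' N k..})) \<le> \<epsilon> k \<and> nO (Q {a' N k..} \<odot> (T \<odot> Q {..<N})) \<le> \<epsilon> k"
    by metis
  \<comment> \<open>The right end of each hump is the starting point for the choice of the
    next.\<close>
  define N where "N = rec_nat 0 (\<lambda>k n. b' n k)"
  have NS: "N (Suc k) = b' (N k) k" for k by (simp add: N_def)
  define a where "a k = a' (N k) k" for k
  define b where "b k = b' (N k) k" for k
  define x where "x k = x' (N k) k" for k
  define g where "g k = g' (N k) k" for k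
  have h: "N k \<le> a k" "a k < b k" "x k \<in> CX" "nX (x k) \<le> 1" "Q {a k..<b k} (x k) = x k"
    "g k \<in> carr (dual_space X)" "y \<in> CX \<Longrightarrow> cmod (g k y) \<le> 2 / d * nX (Q {a k..<b k} y)" "g k (T (x k)) = 1"
    "nO (Q {..<N k} \<odot> (T \<odot> Q {a k..})) \<le> \<epsilon> k" "nO (Q {a k..} \<odot> (T \<odot> Q {..<N k})) \<le> \<epsilon> k" for k y
    using hump[of "N k" k] by (auto simp: a_def b_def x_def g_def)
  have bN: "b k = N (Suc k)" for k by (simp add: NS b_def)
  have d2: "2/d \<ge> 0" using d by simp
  obtain A B where A: "A \<in> BO" "nO A \<le> 1" and B: "B \<in> BO"
    and Bz: "\<And>z. z \<in> CX \<Longrightarrow> B z = fcv (\<lambda>k. g k z)"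
    and A1: "\<And>y k. y \<in> CX \<Longrightarrow> A (Q {k} y) = y k 0 *\<^sub>C x k"
    and A2: "\<And>y k. y \<in> CX \<Longrightarrow> Q {..<N k} (A (Q {..<k} y)) = A (Q {..<k} y)"
    and A3: "\<And>y k. y \<in> CX \<Longrightarrow> Q {a (Suc k)..} (A (Q {Suc k..} y)) = A (Q {Suc k..} y)"
    using hump_operators[of N a b x g "2/d", OF h(1,2) bN h(3-7) d2] by blast
  define S where "S = P1 - B \<odot> (T \<odot> A)"
  have BTA: "B \<odot> (T \<odot> A) \<in> BO" using A(1) B TB by (intro BO_comp)
  have SB: "S \<in> BO" unfolding S_def by (intro BO_diff P1_op(1) BTA)
  \<comment> \<open>The image of y under \<open>A\<close> consists of the humps before l, the hump l
    and the humps after l. The middle one contributes exactly \<open>y l 0\<close>; the others are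
    governed by the two smallness conditions, the later ones by that imposed when hump l + 1 was
    chosen.\<close>
  have tail: "cmod (y l 0 - g l (T (A y))) \<le> (1/2) ^ (l + 2) * nX y" if y: "y \<in> CX" for y l
  proof -
    define u where "u = A (Q {..<l} y)"
    define v where "v = A (Q {Suc l..} y)"
    have uv: "u \<in> CX" "v \<in> CX" by (simp_all add: u_def v_def op_mem[OF A(1)])
    have nu: "nX u \<le> nX y" and nv: "nX v \<le> nX y"
      using XX.op_norm_bound'[OF A(1) pr_mem pr_norm_le[OF y] A(2)] by (simp_all add: u_def v_def)
    have "y = (Q {..<l} y + Q {l} y) + Q {Suc l..} y"
      by (auto simp: fun_eq_iff pr_apply[OF y])
    then have "A y = A ((Q {..<l} y + Q {l} y) + Q {Suc l..} y)" by (rule arg_cong)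
    also have "\<dots> = (u + y l 0 *\<^sub>C x l) + v"
      by (simp only: bounded_opsD(2)[OF A(1) X.mem_add[OF pr_mem pr_mem] pr_mem] bounded_opsD(2)[OF A(1) pr_mem pr_mem]
          A1[OF y] u_def v_def)
    finally have Ay: "A y = (u + y l 0 *\<^sub>C x l) + v" .
    have cx: "y l 0 *\<^sub>C x l \<in> CX" by (rule X.mem_scale[OF h(3)])
    have "T (A y) = (T u + y l 0 *\<^sub>C T (x l)) + T v"
      unfolding Ay by (simp only: bounded_opsD(2)[OF TB X.mem_add[OF uv(1) cx] uv(2)] bounded_opsD(2)[OF TB uv(1) cx]
          bounded_opsD(3)[OF TB h(3)])
    moreover have m: "T u \<in> CX" "T v \<in> CX" "T (x l) \<in> CX" by (rule op_mem[OF TB])+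
    ultimately have "g l (T (A y)) = g l (T u) + y l 0 + g l (T v)"
      by (simp add: X.functional_add[OF h(6)] X.functional_scale[OF h(6)] X.mem h(8))
    then have "y l 0 - g l (T (A y)) = - (g l (T u) + g l (T v))" by simp
    then have "cmod (y l 0 - g l (T (A y))) = cmod (g l (T u) + g l (T v))" by (simp only: norm_minus_cancel)
    also have "\<dots> \<le> cmod (g l (T u)) + cmod (g l (T v))" by (rule norm_triangle_ineq)
    also have "\<dots> \<le> 2/d * (\<epsilon> l * nX y) + 2/d * (\<epsilon> (Suc l) * nX y)"
    proof (rule add_mono)
      have BO1: "Q {a l..} \<odot> (T \<odot> Q {..<N l}) \<in> BO" using TB by (intro BO_comp pr_op)
      have "nX (Q {a l..<b l} (T u)) \<le> nX (Q {a l..} (T u))"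
        by (rule norm_Q_antimono[OF m(1)]) auto
      also have "Q {a l..} (T u) = (Q {a l..} \<odot> (T \<odot> Q {..<N l})) u"
        using A2[OF y, of l] by (simp add: u_def)
      also have "nX \<dots> \<le> \<epsilon> l * nX y" by (rule XX.op_norm_bound'[OF BO1 uv(1) nu h(10)])
      finally have "2/d * nX (Q {a l..<b l} (T u)) \<le> 2/d * (\<epsilon> l * nX y)" using d2 by (intro mult_left_mono)
      then show "cmod (g l (T u)) \<le> 2/d * (\<epsilon> l * nX y)" using h(7)[OF m(1), of l] by simp
      have BO2: "Q {..<N (Suc l)} \<odot> (T \<odot> Q {a (Suc l)..}) \<in> BO" using TB by (intro BO_comp pr_op)
      have "nX (Q {a l..<b l} (T v)) \<le> nX (Q {..<N (Suc l)} (T v))"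
        by (rule norm_Q_antimono[OF m(2)]) (auto simp: bN)
      also have "Q {..<N (Suc l)} (T v) = (Q {..<N (Suc l)} \<odot> (T \<odot> Q {a (Suc l)..})) v"
        using A3[OF y, of l] by (simp add: v_def)
      also have "nX \<dots> \<le> \<epsilon> (Suc l) * nX y" by (rule XX.op_norm_bound'[OF BO2 uv(2) nv h(9)])
      finally have "2/d * nX (Q {a l..<b l} (T v)) \<le> 2/d * (\<epsilon> (Suc l) * nX y)" using d2 by (intro mult_left_mono)
      then show "cmod (g l (T v)) \<le> 2/d * (\<epsilon> (Suc l) * nX y)" using h(7)[OF m(2), of l] by simp
    qed
    also have "\<dots> \<le> 2/d * (\<epsilon> l * nX y) + 2/d * (\<epsilon> l * nX y)"
      using d2 \<epsilon>(2)[of l] L.nrm_ge0[of y] by (intro add_left_mono mult_left_mono mult_right_mono)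
    also have "\<dots> = (1/2) ^ (l + 2) * nX y" using d by (simp add: \<epsilon>_def)
    finally show ?thesis .
  qed
  have "nO S \<le> 1/2"
  proof (rule XX.op_norm_le[OF SB])
    fix y assume y: "y \<in> CX"
    define s where "s = (\<lambda>l. y l 0 - g l (T (A y)))"
    have "S y = P1 y - B (T (A y))" by (simp add: S_def)
    also have "\<dots> = fcv s"
      by (simp add: P1_fcv[OF y] Bz[OF op_mem[OF TB]] fun_eq_iff fcv_def s_def)
    finally have Sy: "S y = fcv s" .
    have "(\<Sum>l<M. cmod (s l) powr p) \<le> (1/2 * nX y) powr p" for M
    proof -
      have "cmod (s l) powr p \<le> (1/4 * nX y) powr p * (1/2) ^ l" for l
      proof -
        have "cmod (s l) powr p \<le> ((1/2) ^ (l + 2) * nX y) powr p"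
          using tail[OF y, of l] p by (intro powr_mono2) (auto simp: s_def)
        also have "(1/2) ^ (l + 2) * nX y = (1/4 * nX y) * (1/2) ^ l" by (simp add: power_add power2_eq_square)
        also have "\<dots> powr p = (1/4 * nX y) powr p * ((1/2) ^ l) powr p"
          by (rule powr_mult)
        also have "\<dots> \<le> (1/4 * nX y) powr p * (1/2) ^ l"
        proof (rule mult_left_mono)
          have "((1/2::real) ^ l) powr p \<le> ((1/2) ^ l) powr 1"
            using p by (intro powr_mono') (auto intro: power_le_one)
          then show "((1/2::real) ^ l) powr p \<le> (1/2) ^ l" by simp
        qed simp
        finally show ?thesis .
      qed
      then have "(\<Sum>l<M. cmod (s l) powr p) \<le> (\<Sum>l<M. (1/4 * nX y) powr p * (1/2) ^ l)" by (rule sum_mono)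
      also have "\<dots> = (1/4 * nX y) powr p * (\<Sum>l<M. (1/2) ^ l)" by (simp only: sum_distrib_left)
      also have "\<dots> \<le> (1/4 * nX y) powr p * 2"
      proof (rule mult_left_mono)
        have "(\<Sum>l<M. (1/2::real) ^ l) \<le> (\<Sum>l. (1/2) ^ l)"
          by (rule sum_le_suminf) (auto simp: summable_geometric)
        then show "(\<Sum>l<M. (1/2::real) ^ l) \<le> 2" by (simp add: suminf_geometric)
      qed simp
      also have "\<dots> \<le> (1/4 * nX y) powr p * 2 powr p"
        using p powr_mono[of 1 p 2] by (intro mult_left_mono) auto
      also have "\<dots> = (1/2 * nX y) powr p"
        using L.nrm_ge0[of y] by (simp flip: powr_mult)
      finally show ?thesis .
    qed
    then show "nX (S y) \<le> 1/2 * nX y"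
      unfolding Sy using L.nrm_ge0[of y] by (intro fcv_mem(2)) auto
  qed simp
  moreover have "P1 - S \<in> J"
  proof -
    have "P1 - S = B \<odot> (T \<odot> A)" by (simp add: S_def)
    then show ?thesis using J_left[OF M B J_right[OF M A(1) T(1)]] by (simp only:)
  qed
  ultimately show ?thesis
    using idempotent_in_J[OF M P1_op SB, of "1/2"] by simp
qed

end


section \<open>Shifts of first coordinates and the second use of the M-ideal property\<close>

lemma scaleC_apply2: "(c *\<^sub>C f) n i = c * f n i" for f :: "nat \<Rightarrow> nat \<Rightarrow> complex"
  by (simp add: scaleC_fun_def scaleC_complex_def)

lemma add_diff_add_cancel: "(a + d) - (d + x) = a - (x :: 'a :: ab_group_add)"
  by simp

context lp_lq
begin

definition lshift :: "(nat \<Rightarrow> nat \<Rightarrow> complex) \<Rightarrow> nat \<Rightarrow> nat \<Rightarrow> complex"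
  where "lshift = (\<lambda>x. if x \<in> CX then fcv (\<lambda>n. x (Suc n) 0) else 0)"

definition rshift :: "(nat \<Rightarrow> nat \<Rightarrow> complex) \<Rightarrow> nat \<Rightarrow> nat \<Rightarrow> complex"
  where "rshift = (\<lambda>x. if x \<in> CX then fcv (\<lambda>n. if n = 0 then 0 else x (n - 1) 0) else 0)"

lemma sum_first_coord_le:
  assumes x: "x \<in> CX" and F: "finite F"
  shows "(\<Sum>n\<in>F. cmod (x n 0) powr p) \<le> nX x powr p"
proof -
  have "(\<Sum>n\<in>F. cmod (x n 0) powr p) \<le> (\<Sum>n\<in>F. bn n (x n) powr p)"
    using p by (intro sum_mono powr_mono2 coord_le_block) auto
  also have "\<dots> \<le> nX x powr p" by (rule L.sum_le_nrm_powr[OF x F])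
  finally show ?thesis .
qed

lemma lshift_op: "lshift \<in> BO" "nO lshift \<le> 1"
proof -
  have bnd: "(\<Sum>n<N. cmod (x (Suc n) 0) powr p) \<le> (1 * nX x) powr p" if x: "x \<in> CX" for x N
    using sum_first_coord_le[OF x, of "Suc ` {..<N}"] by (simp add: sum.reindex)
  show "lshift \<in> BO" "nO lshift \<le> 1"
    unfolding lshift_def by (rule fcv_op[OF _ _ _ bnd]; simp add: scaleC_fun_def scaleC_complex_def)+
qed

lemma rshift_op: "rshift \<in> BO" "nO rshift \<le> 1"
proof -
  have bnd: "(\<Sum>n<N. cmod (if n = 0 then 0 else x (n - 1) 0) powr p) \<le> (1 * nX x) powr p" if x: "x \<in> CX" for x N
  proof (cases N)
    case (Suc M)
    then show ?thesis
      using sum_first_coord_le[OF x, of "{..<M}"]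
      by (simp add: sum.lessThan_Suc_shift del: sum.lessThan_Suc)
  qed (simp add: L.nrm_ge0)
  show "rshift \<in> BO" "nO rshift \<le> 1"
    unfolding rshift_def by (rule fcv_op[OF _ _ _ bnd]; simp add: scaleC_fun_def scaleC_complex_def)+
qed

text \<open>Replaces every block by its norm in the first coordinate. The result has the same norm
  but can be moved between blocks by \<open>lshift\<close> and \<open>rshift\<close>.\<close>

definition lv :: "(nat \<Rightarrow> nat \<Rightarrow> complex) \<Rightarrow> nat \<Rightarrow> nat \<Rightarrow> complex"
  where "lv x = fcv (\<lambda>n. complex_of_real (bn n (x n)))"

lemma lv_apply: "lv x n i = (if i = 0 then complex_of_real (bn n (x n)) else 0)"
  by (simp add: lv_def fcv_def)

lemma lv_mem: "x \<in> CX \<Longrightarrow> lv x \<in> CX"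
  unfolding lv_def
  by (rule fcv_mem(1)[OF L.nrm_ge0[of x]]) (use L.sum_le_nrm_powr[of x] block_ge0 in simp)

lemma lv_norm: "nX (lv x) = nX x"
  by (simp add: L.nrm_eq lv_def block_fcv block_ge0)

lemma block_double:
  assumes "z 0 = 0" "cmod t = bn n z"
  shows "bn n (\<lambda>i. if i = 0 then t else z i) powr q = 2 * bn n z powr q"
proof -
  have "cmod (if i = 0 then t else z i) powr q = cmod (z i) powr q + (if i = 0 then cmod t powr q else 0)" for i
    using assms(1) by simp
  then have "bn n (\<lambda>i. if i = 0 then t else z i) powr q = (\<Sum>i\<le>n. cmod (z i) powr q) + cmod t powr q"
    by (simp add: block_powr sum.distrib)
  then show ?thesis using assms(2) by (simp add: block_powr)
qed

text \<open>The place where the exponents separate: inside a block the q-th power doubles, so the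
  p-th power of the norm grows by 2^(p/q), whereas a copy in other blocks would give the factor
  2.\<close>

lemma norm_double:
  assumes y: "y \<in> CX" and w: "w \<in> CX" and y0: "\<And>n. y n 0 = 0"
    and w0: "\<And>n. cmod (w n 0) = bn n (y n)" and wy: "\<And>n i. i \<noteq> 0 \<Longrightarrow> w n i = y n i"
  shows "nX w powr p = 2 powr (p/q) * nX y powr p"
proof -
  have "bn n (w n) powr p = 2 powr (p/q) * bn n (y n) powr p" for n
  proof -
    have e: "w n = (\<lambda>i. if i = 0 then w n 0 else y n i)" using wy by auto
    have "bn n (w n) powr q = 2 * bn n (y n) powr q"
      by (subst e, rule block_double[of "y n" "w n 0" n, OF y0 w0])
    then have "(bn n (w n) powr q) powr (p/q) = (2 * bn n (y n) powr q) powr (p/q)" by (rule arg_cong)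
    then show ?thesis using q by (simp add: powr_powr powr_mult)
  qed
  then show ?thesis
    by (simp add: L.nrm_powr[OF y] L.nrm_powr[OF w] suminf_mult[OF L.summable_comp[OF y]])
qed

lemma norm_half_sum:
  assumes A: "A \<in> BO" "nO A \<le> 1" and B: "B \<in> BO" "nO B \<le> 1"
    and u: "u \<in> CX" "nX u \<le> r" and v: "v \<in> CX" "nX v \<le> r"
  shows "nX ((1/2) *\<^sub>C (A u + B v)) \<le> r"
proof -
  have "nX (A u + B v) \<le> nX (A u) + nX (B v)" by (rule X.norm_triangle[OF op_mem[OF A(1)] op_mem[OF B(1)]])
  also have "\<dots> \<le> 1 * r + 1 * r"
    by (intro add_mono XX.op_norm_bound'[OF A(1) u A(2)] XX.op_norm_bound'[OF B(1) v B(2)])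
  finally show ?thesis
    using X.norm_scale[OF X.mem_add[OF op_mem[OF A(1)] op_mem[OF B(1)]], of "1/2" u v] by (simp add: norm_divide)
qed

text \<open>Twice T x + j b is the sum of (T + j) (x + b) and (T - j) (x - b). Bounds for T + j and
  T - j thus let \<open>T\<close> and \<open>j\<close> act on different vectors; replacing b by -b
  gives the other sign.\<close>

lemma two_ball_average:
  assumes T: "T \<in> BO" and j: "j \<in> BO" and n: "nO (T + j) \<le> \<kappa>" "nO (T - j) \<le> \<kappa>"
    and x: "x \<in> CX" and b: "b \<in> CX" and r: "nX (x + b) \<le> r" "nX (x - b) \<le> r"
  shows "nX (T x + j b) \<le> \<kappa> * r" "nX (T x - j b) \<le> \<kappa> * r"
proof -
  have main: "nX (T x + j b) \<le> \<kappa> * r" if b: "b \<in> CX" and r: "nX (x + b) \<le> r" "nX (x - b) \<le> r" for b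
  proof -
    have m: "x + b \<in> CX" "x - b \<in> CX" using x b by (auto intro: X.mem)
    have B: "T + j \<in> BO" "T - j \<in> BO" using T j by (auto intro: BO_add BO_diff)
    have c: "T x + j b \<in> CX" by (intro X.mem_add op_mem T j)
    have "(T + j) (x + b) + (T - j) (x - b)
        = (T (x + b) + j (x + b)) + (T (x - b) - j (x - b))" by simp
    also have "\<dots> = (T x + j b) + (T x + j b)"
      unfolding bounded_opsD(2)[OF T x b] bounded_opsD(2)[OF j x b] XX.op_diff[OF T x b] XX.op_diff[OF j x b]
      by (simp add: algebra_simps)
    also have "\<dots> = 2 *\<^sub>C (T x + j b)" using scaleC_add_left[of 1 1 "T x + j b"] by simp
    finally have e: "2 *\<^sub>C (T x + j b) = (T + j) (x + b) + (T - j) (x - b)" by (rule sym)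
    have "2 * nX (T x + j b) = nX (2 *\<^sub>C (T x + j b))" using X.norm_scale[OF c, of 2] by simp
    also have "\<dots> \<le> nX ((T + j) (x + b)) + nX ((T - j) (x - b))"
      unfolding e by (rule X.norm_triangle[OF op_mem[OF B(1)] op_mem[OF B(2)]])
    also have "\<dots> \<le> \<kappa> * r + \<kappa> * r"
      by (intro add_mono XX.op_norm_bound'[OF B(1) m(1) r(1) n(1)] XX.op_norm_bound'[OF B(2) m(2) r(2) n(2)])
    finally show ?thesis by simp
  qed
  show "nX (T x + j b) \<le> \<kappa> * r" by (rule main[OF b r])
  show "nX (T x - j b) \<le> \<kappa> * r"
    using main[OF X.mem_neg[OF b]] r XX.op_neg[OF j b] by simp
qed

lemma pr_G_facts:
  shows "Q G \<odot> P1 = pr (G \<times> {0})" "pr (G \<times> {0}) + pr (G \<times> {0<..}) = Q G"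
    "pr (G \<times> {0<..}) \<odot> Q G = pr (G \<times> {0<..})" "Q G \<odot> pr (G \<times> {0<..}) = pr (G \<times> {0<..})" "Q G \<odot> Q G = Q G"
proof -
  have "(G \<times> UNIV) \<inter> (UNIV \<times> {0}) = G \<times> {0::nat}" "(G \<times> {0<..}) \<inter> (G \<times> UNIV) = G \<times> {0::nat<..}"
    "(G \<times> UNIV) \<inter> (G \<times> {0<..}) = G \<times> {0::nat<..}" by auto
  then show "Q G \<odot> P1 = pr (G \<times> {0})" "pr (G \<times> {0<..}) \<odot> Q G = pr (G \<times> {0<..})"
    "Q G \<odot> pr (G \<times> {0<..}) = pr (G \<times> {0<..})" "Q G \<odot> Q G = Q G"
    by (simp_all only: P1_def pr_comp Int_absorb)
  have "(G \<times> {0}) \<union> (G \<times> {0<..}) = G \<times> (UNIV :: nat set)" by auto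
  then show "pr (G \<times> {0}) + pr (G \<times> {0<..}) = Q G"
    using pr_add[of "G \<times> {0}" "G \<times> {0<..}"] by auto
qed

lemma powr_root_cancel: "0 \<le> z \<Longrightarrow> (z powr (1/p)) powr p = z"
  using p by (simp add: powr_powr)

lemma norm_le_root:
  assumes "nX w powr p \<le> z" "0 \<le> z"
  shows "nX w \<le> z powr (1/p)"
  by (rule norm_le_of_powr) (use assms in \<open>simp_all add: powr_root_cancel\<close>)

context
  fixes J assumes M: "M_ideal Y J" and P1J: "P1 \<in> J"
begin

text \<open>The root takes the place of 1 + e, so that p-th powers of norms will be enlarged by the
  factor \<mu> only.\<close>

lemma two_ball_perturbation:
  assumes j: "j \<in> J" "nO j \<le> 1" and \<mu>: "\<mu> > 1"
  obtains k where "k \<in> J" "nO (Q G + k + j) \<le> \<mu> powr (1/p)" "nO (Q G + k - j) \<le> \<mu> powr (1/p)"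
proof -
  have "1 powr (1/p) < \<mu> powr (1/p)" using \<mu> p by (intro powr_less_mono2) auto
  then have e: "\<mu> powr (1/p) - 1 > 0" by simp
  show ?thesis
    using Y.M_ideal_two_ball[OF M j(1) _ _ _ e, of "Q G"] j(2) pr_op[of "G \<times> UNIV"] that by auto
qed

text \<open>For \<open>q < p\<close> the operator \<open>j\<close> moves vectors between different blocks into the first coordinate
  of the given block, so that the \<open>\<ell>\<^sub>q\<close>-norm of the image exceeds the \<open>\<ell>\<^sub>p\<close>-norm of the argument
  unless the perturbation of \<open>Q G\<close> is a strict contraction.\<close>

lemma blocks_in_ideal_gt:
  assumes pq: "q < p" and G: "\<And>n. n \<in> G \<Longrightarrow> Suc n \<notin> G"
  shows "Q G \<in> J"
proof -
  define \<theta> where "\<theta> = 2 powr (p/q)"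
  have "2 powr 1 < 2 powr (p/q)" using pq q by (intro powr_less_mono) auto
  then have \<theta>: "\<theta> > 2" by (simp add: \<theta>_def)
  \<comment> \<open>Halfway between 1 and \<theta>/2. Being less than \<theta>/2, it makes the
    quotient \<mu>/(\<theta> - \<mu>) smaller than one.\<close>
  define \<mu> where "\<mu> = (\<theta> + 2) / 4"
  have \<mu>: "\<mu> > 1" using \<theta> by (simp add: \<mu>_def)
  have \<mu>\<theta>: "\<theta> - \<mu> > \<mu>" using \<theta> by (simp add: \<mu>_def field_simps)
  define j where "j = Q G \<odot> lshift"
  have jB: "j \<in> BO" "nO j \<le> 1"
    using lshift_op pr_op BO_comp_le[OF pr_op(1) lshift_op(1) pr_op(2) lshift_op(2)] by (auto simp: j_def intro!: BO_comp)
  have "P1 \<odot> lshift = lshift"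
  proof (rule ext)
    fix x
    have "fcv (\<lambda>n. lshift x n 0) = lshift x" by (auto simp: fun_eq_iff lshift_def fcv_def)
    then show "(P1 \<odot> lshift) x = lshift x" by (simp only: o_apply P1_fcv[OF op_mem[OF lshift_op(1)]])
  qed
  then have "lshift \<in> J" using J_right[OF M lshift_op(1) P1J] by simp
  then have jJ: "j \<in> J" unfolding j_def by (rule J_left[OF M pr_op(1)])
  obtain k where k: "k \<in> J" "nO (Q G + k + j) \<le> \<mu> powr (1/p)" "nO (Q G + k - j) \<le> \<mu> powr (1/p)"
    by (rule two_ball_perturbation[OF jJ jB(2) \<mu>])
  define D where "D = pr (G \<times> {0<..})"
  have D: "D \<in> BO" by (simp add: D_def pr_op)
  define T where "T = Q G + k"
  have kB: "k \<in> BO" by (rule J_BO[OF M k(1)])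
  have T: "T \<in> BO" unfolding T_def by (intro BO_add pr_op kB)
  \<comment> \<open>Dropping the first coordinates with \<open>D\<close> is harmless modulo
    \<open>J\<close>, because \<open>P1\<close> belongs to \<open>J\<close>.\<close>
  define S where "S = D \<odot> (T \<odot> Q G)"
  have S: "S \<in> BO" unfolding S_def by (intro BO_comp D T pr_op)
  have "Q G - S \<in> J"
  proof -
    have kQ: "k \<odot> Q G \<in> BO" by (intro BO_comp kB pr_op)
    have sp: "Q G = Q G \<odot> P1 + D" by (simp only: pr_G_facts(1) D_def pr_G_facts(2))
    have "S = D + D \<odot> (k \<odot> Q G)"
      unfolding S_def T_def comp_add_left pr_G_facts(5) comp_add_right[OF D pr_op(1) kQ]
      by (simp only: D_def pr_G_facts(3))
    then have "Q G - S = Q G \<odot> P1 - D \<odot> (k \<odot> Q G)"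
      using add_diff_add_cancel[of "Q G \<odot> P1" D "D \<odot> (k \<odot> Q G)"] by (simp only: sp[symmetric])
    moreover have "Q G \<odot> P1 - D \<odot> (k \<odot> Q G) \<in> J"
      by (intro J_diff[OF M] J_left[OF M] J_right[OF M] pr_op D P1J k(1))
    ultimately show ?thesis by (simp only:)
  qed
  moreover define c where "c = (\<mu> / (\<theta> - \<mu>)) powr (1/p)"
  have c1: "c < 1" unfolding c_def using \<mu> \<mu>\<theta> p powr_less_mono2[of "1/p" "\<mu> / (\<theta> - \<mu>)" 1] by simp
  have "nO S \<le> c"
  proof (rule XX.op_norm_le[OF S])
    show "0 \<le> c" by (simp add: c_def)
    fix x assume x: "x \<in> CX"
    define x' where "x' = Q G x"
    define z where "z = T x'"
    define y where "y = D z"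
    \<comment> \<open>\<open>l\<close> occupies the free first coordinates of the blocks of
      \<open>y\<close>. Its shifted copy \<open>b\<close> lies one block further on, hence outside
      \<open>G\<close> and disjoint from \<open>x'\<close>, and \<open>j\<close> takes
      \<open>b\<close> back to \<open>l\<close>.\<close>
    define l where "l = lv y"
    define b where "b = rshift l"
    have m: "x' \<in> CX" "z \<in> CX" "y \<in> CX" "b \<in> CX"
      by (simp_all add: x'_def z_def y_def b_def pr_mem op_mem[OF T] op_mem[OF D] op_mem[OF rshift_op(1)])
    have l: "l \<in> CX" using m by (simp add: l_def lv_mem)
    have y_ap: "y n i = (if n \<in> G \<and> 0 < i then z n i else 0)" for n i
      by (simp add: y_def D_def pr_apply[OF m(2)])
    have y_out: "y n = 0" if "n \<notin> G" for n using that by (simp add: fun_eq_iff y_ap)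
    have l_out: "l n i = 0" if "n \<notin> G" for n i using that by (simp add: l_def lv_apply y_out)
    have b_ap: "b n i = (if i = 0 \<and> n \<noteq> 0 then l (n - 1) 0 else 0)" for n i
      using l by (simp add: b_def rshift_def fcv_def)
    have jb: "j b = l"
    proof -
      have "lshift b n i = l n i" for n i
        using m(4) by (simp add: lshift_def fcv_def b_ap) (simp add: l_def lv_apply)
      then have lb: "lshift b = l" by (intro ext)
      have "j b = Q G l" by (simp only: j_def o_apply lb)
      also have "\<dots> = l" using l_out by (auto simp: fun_eq_iff pr_apply[OF l])
      finally show ?thesis .
    qed
    have nb: "nX b \<le> nX y"
      using XX.op_norm_bound'[OF rshift_op(1) l order_refl rshift_op(2)] by (simp add: b_def l_def lv_norm)
    have dis: "x' n = 0 \<or> b n = 0" for n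
    proof (cases "n \<in> G")
      case True
      then have "n = 0 \<or> n - 1 \<notin> G" using G[of "n - 1"] by auto
      then have "b n = 0" using l_out by (auto simp: fun_eq_iff b_ap)
      then show ?thesis ..
    next
      case False
      then show ?thesis by (simp add: x'_def Q_block[OF x])
    qed
    define R where "R = nX x powr p + nX y powr p"
    have R0: "R \<ge> 0" by (simp add: R_def)
    have xb: "nX (x' + b) \<le> R powr (1/p)" "nX (x' - b) \<le> R powr (1/p)"
    proof -
      have le: "nX x' powr p + nX b powr p \<le> R"
        unfolding R_def x'_def using nb p L.nrm_ge0 by (intro add_mono powr_mono2 pr_norm_le[OF x]) auto
      have "nX (x' + b) powr p = nX x' powr p + nX b powr p" by (rule norm_powr_add[OF m(1,4) dis])
      then show "nX (x' + b) \<le> R powr (1/p)" using le R0 by (intro norm_le_root) auto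
      have "nX (x' + - b) powr p = nX x' powr p + nX (- b) powr p"
        using dis by (intro norm_powr_add m X.mem_neg) auto
      then show "nX (x' - b) \<le> R powr (1/p)" using le R0 X.norm_neg[OF m(4)] by (intro norm_le_root) auto
    qed
    have "nX (z + l) \<le> \<mu> powr (1/p) * R powr (1/p)" "nX (z - l) \<le> \<mu> powr (1/p) * R powr (1/p)"
      using two_ball_average[OF T jB(1) _ _ m(1,4) xb, of "\<mu> powr (1/p)"] k(2,3) unfolding jb z_def T_def by auto
    moreover have "\<mu> powr (1/p) * R powr (1/p) = (\<mu> * R) powr (1/p)" using \<mu> \<mu>\<theta> R0 by (simp add: powr_mult)
    ultimately have zl: "nX (z + l) \<le> (\<mu> * R) powr (1/p)" "nX (z - l) \<le> (\<mu> * R) powr (1/p)" by simp_all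
    \<comment> \<open>The average of \<open>Q G (z + l)\<close> and \<open>U (z - l)\<close> cancels
      the first coordinates of \<open>z\<close> and everything outside \<open>G\<close>; what
      survives is \<open>y + l\<close>.\<close>
    define U where "U = mult (\<lambda>n i. if n \<in> G then if i = 0 then -1 else 1 else 0)"
    have U: "U \<in> BO" "nO U \<le> 1" unfolding U_def by (rule mult_op; simp)+
    have zlm: "z + l \<in> CX" "z - l \<in> CX" using m l by (auto intro: X.mem)
    define w where "w = y + l"
    have w: "w \<in> CX" using m l by (simp add: w_def X.mem_add)
    have l0: "l n i = 0" if "i \<noteq> 0" for n i using that by (simp add: l_def lv_apply)
    have "w n i = (1/2) * (Q G (z + l) n i + U (z - l) n i)" for n i
      using l_out[of n i] l0[of i n]
      by (simp add: w_def y_ap U_def pr_apply[OF zlm(1)] mult_apply[OF zlm(2)])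
    then have "w n i = ((1/2) *\<^sub>C (Q G (z + l) + U (z - l))) n i" for n i
      by (simp add: scaleC_apply2)
    then have "w = (1/2) *\<^sub>C (Q G (z + l) + U (z - l))" by (intro ext)
    then have "nX w \<le> (\<mu> * R) powr (1/p)"
      using norm_half_sum[OF pr_op U zlm(1) zl(1) zlm(2) zl(2), of "G \<times> UNIV"] by (simp only:)
    then have "nX w powr p \<le> ((\<mu> * R) powr (1/p)) powr p" using p L.nrm_ge0 by (intro powr_mono2) auto
    then have wp: "nX w powr p \<le> \<mu> * R" using \<mu> \<mu>\<theta> R0 by (simp add: powr_root_cancel)
    have "nX w powr p = \<theta> * nX y powr p"
      unfolding \<theta>_def
      by (rule norm_double[OF m(3) w]) (auto simp: w_def l_def lv_apply y_ap block_ge0)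
    then have "(\<theta> - \<mu>) * nX y powr p \<le> \<mu> * nX x powr p" using wp by (simp add: R_def algebra_simps)
    then have "nX y powr p \<le> \<mu> / (\<theta> - \<mu>) * nX x powr p" using \<mu> \<mu>\<theta> by (simp add: field_simps)
    also have "\<dots> = (c * nX x) powr p"
      using \<mu> \<mu>\<theta> by (simp add: c_def powr_mult powr_root_cancel)
    finally have "nX y \<le> c * nX x" by (rule norm_le_of_powr[rotated]) (simp add: c_def L.nrm_ge0)
    then show "nX (S x) \<le> c * nX x" by (simp add: S_def y_def z_def x'_def)
  qed
  ultimately show ?thesis
    using idempotent_in_J[OF M pr_op(1) pr_G_facts(5) S _ c1] by blast
qed

text \<open>For \<open>p < q\<close> the roles of arguments and images are exchanged: \<open>j\<close> moves the first coordinate of a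
  block to a different block.\<close>

lemma blocks_in_ideal_lt:
  assumes pq: "p < q" and G: "\<And>n. n \<in> G \<Longrightarrow> Suc n \<notin> G"
  shows "Q G \<in> J"
proof -
  define \<theta> where "\<theta> = 2 powr (p/q)"
  have "(2::real) powr (p/q) < 2 powr 1" by (rule powr_less_mono) (use pq q in auto)
  moreover have "(2::real) powr 0 < 2 powr (p/q)" by (rule powr_less_mono) (use p q in auto)
  ultimately have \<theta>: "1 < \<theta>" "\<theta> < 2" by (simp_all add: \<theta>_def)
  \<comment> \<open>Halfway between 1 and 2/\<theta>, so that \<open>\<mu> * \<theta> - 1\<close>
    equals \<theta>/2, which is less than one.\<close>
  define \<mu> where "\<mu> = (2/\<theta> + 1) / 2"
  have \<mu>: "\<mu> > 1" "\<mu> * \<theta> - 1 = \<theta> / 2" using \<theta> by (auto simp: \<mu>_def field_simps)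
  define j where "j = rshift \<odot> Q G"
  have jB: "j \<in> BO" "nO j \<le> 1"
    using rshift_op pr_op BO_comp_le[OF rshift_op(1) pr_op(1) rshift_op(2) pr_op(2)] by (auto simp: j_def intro!: BO_comp)
  have "P1 \<odot> rshift = rshift"
  proof (rule ext)
    fix x
    have "fcv (\<lambda>n. rshift x n 0) = rshift x" by (auto simp: fun_eq_iff rshift_def fcv_def)
    then show "(P1 \<odot> rshift) x = rshift x" by (simp only: o_apply P1_fcv[OF op_mem[OF rshift_op(1)]])
  qed
  then have "rshift \<in> J" using J_right[OF M rshift_op(1) P1J] by simp
  then have jJ: "j \<in> J" unfolding j_def by (rule J_right[OF M pr_op(1)])
  obtain k where k: "k \<in> J" "nO (Q G + k + j) \<le> \<mu> powr (1/p)" "nO (Q G + k - j) \<le> \<mu> powr (1/p)"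
    by (rule two_ball_perturbation[OF jJ jB(2) \<mu>(1)])
  define D where "D = pr (G \<times> {0<..})"
  have D: "D \<in> BO" by (simp add: D_def pr_op)
  define T where "T = Q G + k"
  have kB: "k \<in> BO" by (rule J_BO[OF M k(1)])
  have T: "T \<in> BO" unfolding T_def by (intro BO_add pr_op kB)
  \<comment> \<open>Here \<open>D\<close> acts on the argument, which frees the first coordinates of
    its blocks for the copy \<open>l\<close> of the block norms.\<close>
  define S where "S = Q G \<odot> (T \<odot> D)"
  have S: "S \<in> BO" unfolding S_def by (intro BO_comp D T pr_op)
  have "Q G - S \<in> J"
  proof -
    have kD: "k \<odot> D \<in> BO" by (intro BO_comp kB D)
    have QD: "Q G \<odot> D = D" by (simp only: D_def pr_G_facts(4))
    have sp: "Q G = Q G \<odot> P1 + D" by (simp only: pr_G_facts(1) D_def pr_G_facts(2))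
    have "S = D + Q G \<odot> (k \<odot> D)"
      unfolding S_def T_def comp_add_left QD comp_add_right[OF pr_op(1) D kD] ..
    then have "Q G - S = Q G \<odot> P1 - Q G \<odot> (k \<odot> D)"
      using add_diff_add_cancel[of "Q G \<odot> P1" D "Q G \<odot> (k \<odot> D)"] by (simp only: sp[symmetric])
    moreover have "Q G \<odot> P1 - Q G \<odot> (k \<odot> D) \<in> J"
      by (intro J_diff[OF M] J_left[OF M] J_right[OF M] pr_op D P1J k(1))
    ultimately show ?thesis by (simp only:)
  qed
  moreover define c where "c = (\<theta> / 2) powr (1/p)"
  have c1: "c < 1" unfolding c_def using \<theta> p powr_less_mono2[of "1/p" "\<theta> / 2" 1] by simp
  have "nO S \<le> c"
  proof (rule XX.op_norm_le[OF S])
    show "0 \<le> c" by (simp add: c_def)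
    fix x assume x: "x \<in> CX"
    define y where "y = D x"
    define l where "l = lv y"
    define z where "z = T y"
    define b where "b = rshift l"
    have m: "y \<in> CX" "z \<in> CX" "b \<in> CX"
      by (simp_all add: z_def y_def b_def op_mem[OF T] op_mem[OF D] op_mem[OF rshift_op(1)])
    have l: "l \<in> CX" using m by (simp add: l_def lv_mem)
    have y_ap: "y n i = (if n \<in> G \<and> 0 < i then x n i else 0)" for n i
      by (simp add: y_def D_def pr_apply[OF x])
    have y_out: "y n = 0" if "n \<notin> G" for n using that by (simp add: fun_eq_iff y_ap)
    have l_out: "l n i = 0" if "n \<notin> G" for n i using that by (simp add: l_def lv_apply y_out)
    have b_ap: "b n i = (if i = 0 \<and> n \<noteq> 0 then l (n - 1) 0 else 0)" for n i
      using l by (simp add: b_def rshift_def fcv_def)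
    have b_in: "b n i = 0" if "n \<in> G" for n i
    proof (cases n)
      case (Suc m)
      then have "m \<notin> G" using G[of m] that by auto
      then show ?thesis using l_out[of m 0] Suc by (simp add: b_ap)
    qed (simp add: b_ap)
    have jl: "j l = b"
    proof -
      have "Q G l = l" using l_out by (auto simp: fun_eq_iff pr_apply[OF l])
      then show ?thesis by (simp add: j_def b_def)
    qed
    \<comment> \<open>The right shift does not decrease the norm of a vector of first coordinates,
      since the left shift is a contraction that undoes it.\<close>
    have nb: "nX y \<le> nX b"
    proof -
      have "lshift b n i = l n i" for n i
        using m(3) by (simp add: lshift_def fcv_def b_ap) (simp add: l_def lv_apply)
      then have "lshift b = l" by (intro ext)
      then show ?thesis
        using XX.op_norm_bound'[OF lshift_op(1) m(3) order_refl lshift_op(2)] by (simp add: l_def lv_norm)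
    qed
    define R where "R = \<theta> * nX y powr p"
    have R0: "R \<ge> 0" using \<theta> by (simp add: R_def)
    have yl: "nX (y + l) \<le> R powr (1/p)" "nX (y - l) \<le> R powr (1/p)"
    proof -
      have "nX (y + l) powr p = R" unfolding R_def \<theta>_def
        by (rule norm_double) (use m l in \<open>auto simp: X.mem l_def lv_apply y_ap block_ge0\<close>)
      then show "nX (y + l) \<le> R powr (1/p)" using R0 by (intro norm_le_root) auto
      have "nX (y - l) powr p = R" unfolding R_def \<theta>_def
        by (rule norm_double) (use m l in \<open>auto simp: X.mem l_def lv_apply y_ap block_ge0\<close>)
      then show "nX (y - l) \<le> R powr (1/p)" using R0 by (intro norm_le_root) auto
    qed
    have "nX (z + b) \<le> \<mu> powr (1/p) * R powr (1/p)" "nX (z - b) \<le> \<mu> powr (1/p) * R powr (1/p)"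
      using two_ball_average[OF T jB(1) _ _ m(1) l yl, of "\<mu> powr (1/p)"] k(2,3) unfolding jl z_def T_def by auto
    moreover have "\<mu> powr (1/p) * R powr (1/p) = (\<mu> * R) powr (1/p)" using \<mu> R0 by (simp add: powr_mult)
    ultimately have zb: "nX (z + b) \<le> (\<mu> * R) powr (1/p)" "nX (z - b) \<le> (\<mu> * R) powr (1/p)" by simp_all
    \<comment> \<open>Averaging keeps \<open>z\<close> on the blocks of \<open>G\<close> and
      \<open>b\<close> on the other blocks.\<close>
    define U where "U = mult (\<lambda>n i. if n \<in> G then 1 else -1)"
    have U: "U \<in> BO" "nO U \<le> 1" unfolding U_def by (rule mult_op; simp)+
    have zbm: "z + b \<in> CX" "z - b \<in> CX" using m by (auto intro: X.mem)
    define w where "w = Q G z + b"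
    have w: "w \<in> CX" using m by (simp add: w_def X.mem_add pr_mem)
    have "w n i = (1/2) * (pr UNIV (z + b) n i + U (z - b) n i)" for n i
      using b_in[of n i]
      by (simp add: w_def U_def pr_apply[OF zbm(1)] pr_apply[OF m(2)] mult_apply[OF zbm(2)])
    then have "w n i = ((1/2) *\<^sub>C (pr UNIV (z + b) + U (z - b))) n i" for n i
      by (simp add: scaleC_apply2)
    then have "w = (1/2) *\<^sub>C (pr UNIV (z + b) + U (z - b))" by (intro ext)
    then have "nX w \<le> (\<mu> * R) powr (1/p)"
      using norm_half_sum[OF pr_op U zbm(1) zb(1) zbm(2) zb(2), of UNIV] by (simp only:)
    then have "nX w powr p \<le> ((\<mu> * R) powr (1/p)) powr p" using p L.nrm_ge0 by (intro powr_mono2) auto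
    then have wp: "nX w powr p \<le> \<mu> * R" using \<mu> R0 by (simp add: powr_root_cancel)
    \<comment> \<open>In the p-th power of the norm, \<open>b\<close> uses up at least that of
      \<open>y\<close>, so only \<open>\<mu> * \<theta> - 1\<close> times the p-th power of the norm
      of \<open>y\<close> is left for \<open>Q G z\<close>.\<close>
    have "nX w powr p = nX (Q G z) powr p + nX b powr p"
      unfolding w_def by (rule norm_powr_add[OF pr_mem m(3)]) (use b_in in \<open>auto simp: Q_block[OF m(2)] fun_eq_iff\<close>)
    moreover have "nX y powr p \<le> nX b powr p" using nb p L.nrm_ge0 by (intro powr_mono2) auto
    ultimately have "nX (Q G z) powr p \<le> (\<mu> * \<theta> - 1) * nX y powr p" using wp by (simp add: R_def algebra_simps)
    also have "\<dots> \<le> \<theta> / 2 * nX x powr p"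
      unfolding \<mu>(2) y_def D_def using \<theta> p L.nrm_ge0 by (intro mult_left_mono powr_mono2 pr_norm_le[OF x]) auto
    also have "\<dots> = (c * nX x) powr p"
      using \<theta> by (simp add: c_def powr_mult powr_root_cancel)
    finally have "nX (Q G z) \<le> c * nX x" by (rule norm_le_of_powr[rotated]) (simp add: c_def L.nrm_ge0)
    then show "nX (S x) \<le> c * nX x" by (simp add: S_def y_def z_def)
  qed
  ultimately show ?thesis
    using idempotent_in_J[OF M pr_op(1) pr_G_facts(5) S _ c1] by blast
qed

text \<open>For \<open>p = q\<close> the space is \<open>\<ell>\<^sub>p\<close>, so it is isometric to the range of \<open>P1\<close>.\<close>

lemma identity_in_ideal_eq:
  assumes pq: "p = q"
  shows "pr UNIV \<in> J"
proof -
  \<comment> \<open>All pairs (n, i) are enumerated, including those with i > n; these contribute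
    zeros.\<close>
  define W where "W = (\<lambda>x. if x \<in> CX then fcv (\<lambda>m. case prod_decode m of (n, i) \<Rightarrow> x n i) else 0)"
  have bnd: "(\<Sum>m<N. cmod (case prod_decode m of (n, i) \<Rightarrow> x n i) powr p) \<le> (1 * nX x) powr p" if x: "x \<in> CX" for x N
  proof -
    define F where "F = prod_decode ` {..<N}"
    \<comment> \<open>A number of blocks that covers all enumerated pairs; the added 0 keeps the
      maximum meaningful when there are none.\<close>
    define k where "k = Suc (Max (fst ` F \<union> {0}))"
    have F: "finite F" by (simp add: F_def)
    have sub: "{c \<in> F. snd c \<le> fst c} \<subseteq> cells k"
      using F by (auto simp: cells_def k_def less_Suc_eq_le intro!: Max_ge imageI)
        (metis Max_ge finite_imageI finite_insert fst_conv image_eqI insertI2)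
    have "(\<Sum>m<N. cmod (case prod_decode m of (n, i) \<Rightarrow> x n i) powr p) = (\<Sum>c\<in>F. cmod (x (fst c) (snd c)) powr p)"
      unfolding F_def by (subst sum.reindex) (auto simp: inj_prod_decode inj_on_subset[OF inj_prod_decode] case_prod_beta)
    also have "\<dots> = (\<Sum>c\<in>{c \<in> F. snd c \<le> fst c}. cmod (x (fst c) (snd c)) powr p)"
      using F coord_zero[OF x] p by (intro sum.mono_neutral_right) (auto simp: not_le)
    also have "\<dots> \<le> (\<Sum>c\<in>cells k. cmod (x (fst c) (snd c)) powr p)"
      using sub finite_cells by (intro sum_mono2) auto
    also have "\<dots> = (\<Sum>n<k. \<Sum>i\<le>n. cmod (x n i) powr p)"
      unfolding cells_def by (simp add: sum.Sigma split_def)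
    also have "\<dots> = (\<Sum>n<k. bn n (x n) powr p)"
      using block_powr pq by simp
    also have "\<dots> \<le> nX x powr p" by (rule L.sum_le_nrm_powr[OF x]) simp
    finally show ?thesis by simp
  qed
  have W: "W \<in> BO" unfolding W_def
    by (rule fcv_op(1)[OF _ _ _ bnd]) (auto simp: scaleC_fun_def scaleC_complex_def split: prod.split)
  define V where "V = (\<lambda>x::nat \<Rightarrow> nat \<Rightarrow> complex. if x \<in> CX then (\<lambda>n i. if i \<le> n then x (prod_encode (n, i)) 0 else 0) else 0)"
  have Vm: "V x \<in> CX" "nX (V x) \<le> nX x" if x: "x \<in> CX" for x
  proof -
    have 1: "V x n \<in> carr (lq_fin q (Suc n))" for n using x by (simp add: block_mem_iff V_def)
    have 2: "(\<Sum>n<N. bn n (V x n) powr p) \<le> nX x powr p" for N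
    proof -
      have "(\<Sum>n<N. bn n (V x n) powr p) = (\<Sum>n<N. \<Sum>i\<le>n. cmod (V x n i) powr p)"
        using block_powr pq by simp
      also have "\<dots> = (\<Sum>n<N. \<Sum>i\<le>n. cmod (x (prod_encode (n, i)) 0) powr p)"
        using x by (intro sum.cong refl) (simp add: V_def)
      also have "\<dots> = (\<Sum>c\<in>cells N. cmod (x (prod_encode c) 0) powr p)"
        unfolding cells_def by (subst sum.Sigma) (auto simp: case_prod_beta)
      also have "\<dots> = (\<Sum>m\<in>prod_encode ` cells N. cmod (x m 0) powr p)"
        by (subst sum.reindex) (auto simp: inj_prod_encode)
      also have "\<dots> \<le> nX x powr p" by (rule sum_first_coord_le[OF x]) (simp add: finite_cells)
      finally show ?thesis .
    qed
    show "V x \<in> CX" "nX (V x) \<le> nX x" by (rule L.memI[OF 1 L.nrm_ge0 2])+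
  qed
  have V: "V \<in> BO"
  proof (rule bounded_opsI[where K = 1])
    show "V (x + y) = V x + V y" if "x \<in> CX" "y \<in> CX" for x y
      using that X.mem_add[OF that] by (simp add: V_def fun_eq_iff)
    show "V (c *\<^sub>C x) = c *\<^sub>C V x" if "x \<in> CX" for c x
      using that X.mem_scale[OF that] by (simp add: V_def fun_eq_iff scaleC_fun_def scaleC_complex_def)
  qed (use Vm in \<open>auto simp: V_def\<close>)
  have "(V \<odot> (P1 \<odot> W)) x = pr UNIV x" for x
  proof (cases "x \<in> CX")
    case True
    have "V (P1 (W x)) n i = x n i" for n i
      using coord_zero[OF True, of n i] op_mem[OF W, of x] True op_mem[OF P1_op(1)]
      by (simp add: V_def P1_fcv fcv_def W_def)
    then show ?thesis using True by (auto simp: fun_eq_iff pr_apply)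
  next
    case False
    then show ?thesis
      by (simp add: bounded_opsD(4)[OF W False] XX.op_zero[OF P1_op(1)] XX.op_zero[OF V] pr_outside)
  qed
  then have "V \<odot> (P1 \<odot> W) = pr UNIV" by (rule ext)
  then show ?thesis using J_left[OF M V J_right[OF M W P1J]] by (simp only:)
qed

text \<open>Neither the even nor the odd numbers contain two neighbours, and the two block
  projections add up to the identity.\<close>

lemma identity_in_ideal: "pr UNIV \<in> J"
proof (cases "p = q")
  case True
  then show ?thesis by (rule identity_in_ideal_eq)
next
  case False
  have alt: "Q G \<in> J" if G: "\<And>n. n \<in> G \<Longrightarrow> Suc n \<notin> G" for G
  proof (cases "q < p")
    case True
    then show ?thesis using G by (rule blocks_in_ideal_gt)
  next
    case False
    with \<open>p \<noteq> q\<close> have "p < q" by simp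
    then show ?thesis using G by (rule blocks_in_ideal_lt)
  qed
  have "Q {n. even n} \<in> J" "Q {n. odd n} \<in> J" by (rule alt, simp)+
  moreover have "Q {n. even n} + Q {n. odd n} = pr UNIV"
  proof -
    have "({n. even n} \<times> UNIV) \<inter> ({n. odd n} \<times> UNIV) = ({} :: (nat \<times> nat) set)"
      "({n. even n} \<times> UNIV) \<union> ({n. odd n} \<times> UNIV) = (UNIV :: (nat \<times> nat) set)" by auto
    then show ?thesis using pr_add by metis
  qed
  ultimately show ?thesis using J_add[OF M] by metis
qed

end

lemma ideal_cases:
  assumes M: "M_ideal Y J" and ne: "J \<noteq> {0}" "J \<noteq> carr Y"
  shows "J = K"
proof (rule ccontr)
  assume "J \<noteq> K"
  then obtain T where "T \<in> J" "T \<notin> K" using compact_in_J[OF M ne(1)] by blast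
  then have I: "pr UNIV \<in> J" using identity_in_ideal[OF M P1_in_ideal[OF M]] by blast
  have "BO \<subseteq> J"
  proof
    fix S assume S: "S \<in> BO"
    show "S \<in> J" using J_right[OF M S I] by (simp only: pr_UNIV_comp(1)[OF S])
  qed
  then show False using J_BO[OF M] ne(2) by auto
qed

text \<open>The projection onto the first block is a nonzero compact operator; the identity is not
  compact, since each of its tails fixes a unit vector.\<close>

lemma compact_nontrivial: "K \<noteq> {0}" "K \<noteq> carr Y"
proof -
  have "Q {M..} (ee M 0) n i = ee M 0 n i" for M n i
    unfolding pr_apply[OF ee_mem[OF le0]] by (simp add: ee_def)
  then have e: "Q {M..} (ee M 0) = ee M 0" for M by (intro ext)
  have "(Q {..<1} \<odot> pr UNIV) (ee 0 0) 0 0 = 1"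
    by (simp add: pr_pr pr_apply[OF ee_mem]) (simp add: ee_def)
  then have "Q {..<1} \<odot> pr UNIV \<noteq> 0" by (metis zero_fun_apply zero_neq_one)
  then show "K \<noteq> {0}" using compact_head[OF pr_op(1), of 1 UNIV] by blast
  have "pr UNIV \<notin> K"
  proof
    assume "pr UNIV \<in> K"
    then obtain M where Mb: "nO (Q {M..} \<odot> pr UNIV) \<le> 1/2" using compactD[of "pr UNIV" "1/2"] by auto
    have "nX ((Q {M..} \<odot> pr UNIV) (ee M 0)) \<le> 1/2 * 1"
      by (rule XX.op_norm_bound'[OF BO_comp(1)[OF pr_op(1) pr_op(1)] ee_mem _ Mb]) (simp_all add: ee_norm)
    moreover have "(Q {M..} \<odot> pr UNIV) (ee M 0) = ee M 0" by (simp add: pr_pr e)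
    ultimately show False by (simp add: ee_norm)
  qed
  then show "K \<noteq> carr Y" using pr_op(1) by auto
qed

end

theorem theorem3p3:
  fixes p q :: real
  assumes "1 < p" and "1 < q"
  shows "nontrivial_M_ideal (endo_space (lp_lq_sum p q)) (compact_ops (lp_lq_sum p q)) \<and>
    (\<forall>J. nontrivial_M_ideal (endo_space (lp_lq_sum p q)) J \<longrightarrow> J = compact_ops (lp_lq_sum p q))"
proof -
  interpret lp_lq p q by unfold_locales (fact assms)+
  show ?thesis
    unfolding nontrivial_M_ideal_def
  proof (intro conjI allI impI compact_M_ideal compact_nontrivial)
    show "J = compact_ops (lp_lq_sum p q)"
      if "M_ideal (endo_space (lp_lq_sum p q)) J \<and> J \<noteq> {0} \<and> J \<noteq> carr (endo_space (lp_lq_sum p q))" for J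
      using that by (intro ideal_cases) blast+
  qed
qed

end
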